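(* Let $0\le\alpha<n$, let $\delta:\mathbb{R}^n\to(0,n)$, let $p(\cdot),q(\cdot),r(\cdot)\in\mathcal{P}^{\log}(\mathbb{R}^n)$ and let $\beta\in(1,p_-)$ satisfy: (i) $\delta_->0$, $(r(\alpha+\delta))_+<n$ and $r_\infty\,(\alpha+\delta(\cdot))_+<n$; (ii) $p(x)\ge p_\infty$ for a.e. $x\in\mathbb{R}^n$; (iii) $\frac1\beta-\frac{1}{p(x)}=\frac{\delta(x)}{n}=\frac{1}{r(x)}-\frac{\alpha}{n}-\frac{1}{q(x)}$ for $x\in\mathbb{R}^n$. Let $b$ be a locally integrable function on $\mathbb{R}^n$. Then $b\in\mathbb{L}(\delta(\cdot))$ if and only if the fractional maximal commutator $\mathcal{M}_{\alpha,b}$ is bounded from $L^{r(\cdot)}(\mathbb{R}^n)$ to $L^{q(\cdot)}(\mathbb{R}^n)$.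
   Context: For a real function $g$ on $\mathbb{R}^n$ put $g_-:=\inf_{x\in\mathbb{R}^n}g(x)$ and $g_+:=\sup_{x\in\mathbb{R}^n}g(x)$; e.g. $(r(\alpha+\delta))_+=\sup_x r(x)(\alpha+\delta(x))$. $\mathcal{P}(\mathbb{R}^n)$ is the set of measurable $p(\cdot):\mathbb{R}^n\to(1,\infty)$ with $1<p_-\le p_+<\infty$. $\mathcal{P}^{\log}(\mathbb{R}^n)$ is the set of $p(\cdot)\in\mathcal{P}(\mathbb{R}^n)$ for which there exist $C_{\log}(p),C_\infty\in(0,\infty)$ and $p_\infty\in\mathbb{R}$ with $|p(x)-p(y)|\le \frac{C_{\log}(p)}{\ln(e+1/|x-y|)}$ and $|p(x)-p_\infty|\le\frac{C_\infty}{\ln(e+|x|)}$ for all $x,y\in\mathbb{R}^n$. Thus $p_\infty=\lim_{|x|\to\infty}p(x)$, and similarly for $r_\infty$. For $p(\cdot)\in\mathcal{P}(\mathbb{R}^n)$, $L^{p(\cdot)}(\mathbb{R}^n)$ is the space of measurable $f$ with $\int_{\mathbb{R}^n}(|f(x)|/\lambda)^{p(x)}dx<\infty$ for some $\lambda>0$, with norm $\|f\|_{L^{p(\cdot)}(\mathbb{R}^n)}=\inf\{\lambda>0:\int_{\mathbb{R}^n}(|f(x)|/\lambda)^{p(x)}dx\le1\}$. Variable Lipschitz space: $b\in\mathbb{L}(\delta(\cdot))$ if there is a constant $C$ with $|b(x)-b(y)|\le C|x-y|^{\delta(x)}$ for all $x,y\in\mathbb{R}^n$. Functions equal almost everywhere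 are identified (so $b\in\mathbb{L}(\delta(\cdot))$ is understood after possibly changing $b$ on a null set). Cubes $Q\subset\mathbb{R}^n$ have sides parallel to the coordinate axes and $|Q|$ is Lebesgue measure. The fractional maximal commutator is $\mathcal{M}_{\alpha,b}(f)(x):=\sup_{Q\ni x}\frac{1}{|Q|^{1-\alpha/n}}\int_Q|b(x)-b(y)||f(y)|\,dy$, the supremum being over all cubes containing $x$. An operator $T$ (possibly nonlinear) is bounded from $L^{r(\cdot)}(\mathbb{R}^n)$ to $L^{q(\cdot)}(\mathbb{R}^n)$ if there is a constant $C$ such that $\|Tf\|_{L^{q(\cdot)}(\mathbb{R}^n)}\le C\|f\|_{L^{r(\cdot)}(\mathbb{R}^n)}$ for all $f\in L^{r(\cdot)}(\mathbb{R}^n)$. *)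

theory Defs
  imports "HOL-Analysis.Analysis"
begin

definition fun_inf :: "('a \<Rightarrow> real) \<Rightarrow> ereal" where
  "fun_inf g = (INF x. ereal (g x))"

definition fun_sup :: "('a \<Rightarrow> real) \<Rightarrow> ereal" where
  "fun_sup g = (SUP x. ereal (g x))"

definition var_exponent :: "(real^'n::finite \<Rightarrow> real) \<Rightarrow> bool" where
  "var_exponent p \<longleftrightarrow>
     p \<in> borel_measurable lebesgue \<and> (\<forall>x. 1 < p x) \<and> 1 < fun_inf p \<and> fun_sup p < \<infinity>"

text \<open>At \<open>x = y\<close> the local condition reads \<open>0 \<le> C1\<close>, since \<open>1 / 0 = 0\<close>.\<close>

definition log_exponent :: "(real^'n::finite \<Rightarrow> real) \<Rightarrow> bool" where
  "log_exponent p \<longleftrightarrow>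
     var_exponent p \<and>
     (\<exists>C1>0. \<forall>x y. \<bar>p x - p y\<bar> \<le> C1 / ln (exp 1 + 1 / norm (x - y))) \<and>
     (\<exists>C2>0. \<exists>pinf. \<forall>x. \<bar>p x - pinf\<bar> \<le> C2 / ln (exp 1 + norm x))"

definition exponent_at_infinity :: "(real^'n::finite \<Rightarrow> real) \<Rightarrow> real" where
  "exponent_at_infinity p = Lim at_infinity p"

lemma exponent_at_infinity_eqI:
  fixes p :: "real^'n::finite \<Rightarrow> real"
  assumes "\<forall>x. \<bar>p x - pinf\<bar> \<le> C / ln (exp 1 + norm x)"
  shows "exponent_at_infinity p = pinf"
proof -
  have "filterlim (\<lambda>x::real^'n. ln (exp 1 + norm x)) at_top at_infinity"
    by (intro filterlim_compose[OF ln_at_top] filterlim_tendsto_add_at_top[OF tendsto_const]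
        filterlim_norm_at_top)
  then have "((\<lambda>x::real^'n. C / ln (exp 1 + norm x)) \<longlongrightarrow> 0) at_infinity"
    by (intro tendsto_divide_0[OF tendsto_const] filterlim_at_top_imp_at_infinity)
  then have "((\<lambda>x. p x - pinf) \<longlongrightarrow> 0) at_infinity"
    by (rule Lim_null_comparison[rotated]) (use assms in simp)
  then have "(p \<longlongrightarrow> pinf) at_infinity"
    by (simp add: LIM_zero_iff)
  then show ?thesis
    unfolding exponent_at_infinity_def by (intro tendsto_Lim trivial_limit_at_infinity)
qed

text \<open>Maximal functions may take the value \<open>\<infinity>\<close>, so modular and norm are defined for functions
  with values in \<open>[0,\<infinity>]\<close>; a real-valued \<open>f\<close> enters through \<open>\<bar>f\<bar>\<close>. The norm is \<open>\<infinity>\<close>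
  when no admissible \<open>l\<close> exists.\<close>

definition ennreal_powr :: "ennreal \<Rightarrow> real \<Rightarrow> ennreal" where
  "ennreal_powr t a = (if t = \<infinity> then \<infinity> else ennreal (enn2real t powr a))"

definition var_modular :: "(real^'n::finite \<Rightarrow> real) \<Rightarrow> (real^'n \<Rightarrow> ennreal) \<Rightarrow> ennreal" where
  "var_modular p g = (\<integral>\<^sup>+x. ennreal_powr (g x) (p x) \<partial>lebesgue)"

definition var_norm :: "(real^'n::finite \<Rightarrow> real) \<Rightarrow> (real^'n \<Rightarrow> ennreal) \<Rightarrow> ennreal" where
  "var_norm p g = Inf {ennreal l | l. 0 < l \<and> var_modular p (\<lambda>x. g x / ennreal l) \<le> 1}"

definition var_Lp :: "(real^'n::finite \<Rightarrow> real) \<Rightarrow> (real^'n \<Rightarrow> real) set" where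
  "var_Lp p = {f \<in> borel_measurable lebesgue.
     \<exists>l>0. var_modular p (\<lambda>x. ennreal \<bar>f x\<bar> / ennreal l) < \<infinity>}"

definition bounded_var_Lp ::
  "(real^'n::finite \<Rightarrow> real) \<Rightarrow> (real^'n \<Rightarrow> real) \<Rightarrow>
   ((real^'n \<Rightarrow> real) \<Rightarrow> (real^'n \<Rightarrow> ennreal)) \<Rightarrow> bool" where
  "bounded_var_Lp r q T \<longleftrightarrow>
     (\<exists>C::real. \<forall>f \<in> var_Lp r. var_norm q (T f) \<le> ennreal C * var_norm r (\<lambda>x. ennreal \<bar>f x\<bar>))"

definition locally_integrable :: "(real^'n::finite \<Rightarrow> real) \<Rightarrow> bool" where
  "locally_integrable b \<longleftrightarrow> (\<forall>K. compact K \<longrightarrow> set_integrable lebesgue K b)"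

text \<open>Functions are identified when they agree almost everywhere, hence the representative \<open>b'\<close>.\<close>

definition var_Lipschitz :: "(real^'n::finite \<Rightarrow> real) \<Rightarrow> (real^'n \<Rightarrow> real) set" where
  "var_Lipschitz \<delta> = {b. \<exists>b'. (AE x in lebesgue. b' x = b x) \<and>
     (\<exists>C. \<forall>x y. \<bar>b' x - b' y\<bar> \<le> C * norm (x - y) powr \<delta> x)}"

text \<open>Cubes are taken closed; open cubes give the same maximal function, because a closed cube
  is the intersection of slightly larger open cubes and boundaries of cubes are null sets.\<close>

definition cubes :: "(real^'n::finite) set set" where
  "cubes = {cbox a (\<chi> i. a $ i + l) | a l. 0 < l}"

definition frac_max_commutator ::
  "real \<Rightarrow> (real^'n::finite \<Rightarrow> real) \<Rightarrow> (real^'n \<Rightarrow> real) \<Rightarrow> (real^'n \<Rightarrow> ennreal)" where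
  "frac_max_commutator \<alpha> b f x =
     (SUP Q \<in> {Q \<in> cubes. x \<in> Q}.
        (\<integral>\<^sup>+y\<in>Q. ennreal (\<bar>b x - b y\<bar> * \<bar>f y\<bar>) \<partial>lebesgue)
          / ennreal (measure lebesgue Q powr (1 - \<alpha> / real CARD('n))))"

end

(* For small cubes, log-Hoelder continuity lets one freeze the exponent on a cube; for large cubes
   the exponent may be replaced by its value at infinity up to the integrable error
   (e + |x|)^(-2n). Hence every cube Q satisfies avg_Q g <= K |Q|^(-1/r) when the modular of g is
   at most 1, and Hedberg's trick bounds (|Q|^((alpha+delta)/n) avg_Q g)^q by (avg_Q g)^r. The
   latter is controlled by the Hardy-Littlewood maximal function with constant exponents, applied
   separately to the parts of g above and below 1; this gives boundedness for Lipschitz b.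

   Conversely, testing on indicators of cubes bounds the mean oscillation of b on Q by
   side(Q)^delta(x) (small Q) or side(Q)^delta_inf (large Q). Campanato's telescoping of averages
   over shrinking cubes produces the Lipschitz representative; delta >= delta_inf, which is the
   hypothesis p >= p_inf, absorbs the large cubes. *)

theory Submission
  imports Defs
begin

subsection \<open>Powers and layer cake in the extended nonnegative reals\<close>

text \<open>The Lipschitz bound turns the commutator into a fractional maximal function of order
  \<gamma>(x) = \<alpha> + \<delta>(x). Distribution-function arguments need one exponent for all x,
  which forces the cut of g at height 1: where g >= 1 the power g^(r/m), with 1 < m <= r, is used at
  the exponent m; where g < 1 exponents may be exchanged for r_inf. On a large cube the first part
  is only known to have integral at most 1, since r_inf may exceed r(x); there its average is at
  most 1 and the weak-type bound suffices. A second obstacle is the factor |Q|^(\<gamma>(x)/n -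
  \<gamma>_inf/n), with \<gamma>_inf the limit of \<gamma>, which may blow up with |Q|. It is
  harmless while |Q| is at most a fixed power of e + |x|; beyond that, the slack in r_inf * sup
  \<gamma> < n yields decay in x. In the converse, averages around y obey a modulus with the
  exponent at y, whereas the Lipschitz condition asks for the exponent at x; log-Hoelder continuity
  of \<delta> swaps the two at small distances.\<close>

lemma ennreal_powr_ennreal: "0 \<le> a \<Longrightarrow> ennreal_powr (ennreal a) p = ennreal (a powr p)"
  by (simp add: ennreal_powr_def)

lemma ennreal_powr_mono: "u \<le> v \<Longrightarrow> 0 \<le> p \<Longrightarrow> ennreal_powr u p \<le> ennreal_powr v p"
  by (cases u; cases v) (auto simp: ennreal_powr_def top_unique ennreal_le_iff2 powr_mono2)

lemma ennreal_powr_mult: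
  assumes "0 < c"
  shows "ennreal_powr (ennreal c * u) p = ennreal (c powr p) * ennreal_powr u p"
proof (cases u)
  case (real v)
  then have "ennreal c * u = ennreal (c * v)" using assms by (simp add: ennreal_mult)
  then have "ennreal_powr (ennreal c * u) p = ennreal ((c * v) powr p)"
    using real assms by (simp only:) (simp add: ennreal_powr_ennreal)
  then show ?thesis using real assms by (simp add: ennreal_powr_ennreal powr_mult ennreal_mult)
next
  case top
  then show ?thesis using assms by (simp add: ennreal_powr_def ennreal_mult_top)
qed

lemma ennreal_powr_inverse:
  assumes "0 < p"
  shows "ennreal_powr (ennreal_powr u (1 / p)) p = u"
  using assms by (cases u) (auto simp: ennreal_powr_def powr_powr)

lemma measurable_ennreal_powr [measurable]:
  assumes [measurable]: "u \<in> borel_measurable M" "p \<in> borel_measurable M"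
  shows "(\<lambda>x. ennreal_powr (u x) (p x)) \<in> borel_measurable M"
  unfolding ennreal_powr_def by measurable

lemma nn_integral_powr_segment:
  fixes c e :: real
  assumes "0 < e" "0 \<le> c"
  shows "(\<integral>\<^sup>+t. ennreal (t powr (e - 1)) * indicator {t. 0 < t \<and> t < c} t \<partial>lborel) = ennreal (c powr e / e)"
proof -
  have h: "((\<lambda>x. x powr (e - 1)) has_integral (c powr e / e)) {0..c}"
    using has_integral_powr_from_0[of "e - 1" c] assms by simp
  have h: "((\<lambda>x. x powr (e - 1) * indicator {0..c} x) has_integral (c powr e / e)) UNIV"
    using has_integral_restrict_UNIV[THEN iffD2, OF h]
    by (rule has_integral_eq[rotated]) (simp add: indicator_def)
  have "(\<integral>\<^sup>+t. ennreal (t powr (e - 1)) * indicator {t. 0 < t \<and> t < c} t \<partial>lborel)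
      = (\<integral>\<^sup>+t. ennreal (t powr (e - 1) * indicator {0..c} t) \<partial>lborel)"
  proof (rule nn_integral_cong_AE)
    show "AE t in lborel. ennreal (t powr (e - 1)) * indicator {t. 0 < t \<and> t < c} t
        = ennreal (t powr (e - 1) * indicator {0..c} t)"
      using AE_lborel_singleton[of 0] AE_lborel_singleton[of c]
      by eventually_elim (auto simp: indicator_def)
  qed
  also have "\<dots> = ennreal (c powr e / e)"
    by (rule nn_integral_has_integral_lborel[OF _ _ h]) auto
  finally show ?thesis .
qed

text \<open>For finite v this is the integral of p t^(p-1) over (0, v). For v = \<infinity> the
  right side exceeds every real d, as it dominates the finite case at height d^(1/p).\<close>

lemma ennreal_powr_layer_cake:
  fixes p :: real
  assumes "0 < p"
  shows "ennreal_powr v p =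
    (\<integral>\<^sup>+t. ennreal (p * t powr (p - 1)) * indicator {t. 0 < t \<and> ennreal t < v} t \<partial>lborel)"
proof -
  have fin: "(\<integral>\<^sup>+t. ennreal (p * t powr (p - 1)) * indicator {t. 0 < t \<and> ennreal t < ennreal c} t \<partial>lborel)
     = ennreal (c powr p)" if "0 \<le> c" for c
  proof -
    have "(\<integral>\<^sup>+t. ennreal (p * t powr (p - 1)) * indicator {t. 0 < t \<and> ennreal t < ennreal c} t \<partial>lborel)
       = (\<integral>\<^sup>+t. ennreal p * (ennreal (t powr (p - 1)) * indicator {t. 0 < t \<and> t < c} t) \<partial>lborel)"
      using assms by (intro nn_integral_cong)
        (auto simp: indicator_def ennreal_mult ennreal_less_iff mult.assoc)
    also have "\<dots> = ennreal p * ennreal (c powr p / p)"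
      using assms that by (subst nn_integral_cmult) (auto simp: nn_integral_powr_segment)
    also have "\<dots> = ennreal (c powr p)" using assms by (simp flip: ennreal_mult)
    finally show ?thesis .
  qed
  show ?thesis
  proof (cases v)
    case (real c)
    then show ?thesis using fin[of c] by (simp add: ennreal_powr_ennreal)
  next
    case top
    let ?I = "\<integral>\<^sup>+t. ennreal (p * t powr (p - 1)) * indicator {t. 0 < t \<and> ennreal t < v} t \<partial>lborel"
    have "ennreal d \<le> ?I" if "0 \<le> d" for d
    proof -
      have "ennreal d = ennreal ((d powr (1 / p)) powr p)" using assms that by (simp add: powr_powr)
      also have "\<dots> \<le> ?I"
        unfolding fin[of "d powr (1/p)", OF powr_ge_zero, symmetric]
        by (intro nn_integral_mono) (auto simp: indicator_def top)
      finally show ?thesis .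
    qed
    note le = this
    have "?I = top"
    proof (cases ?I)
      case (real d)
      then show ?thesis using le[of "d + 1"] by (simp add: ennreal_le_iff)
    qed
    then show ?thesis by (simp add: top ennreal_powr_def)
  qed
qed

lemma nn_integral_ennreal_powr_layer_cake:
  fixes u :: "'a::euclidean_space \<Rightarrow> ennreal" and p :: real
  assumes "0 < p" and u [measurable]: "u \<in> borel_measurable borel"
  shows "(\<integral>\<^sup>+x. ennreal_powr (u x) p \<partial>lborel) =
    (\<integral>\<^sup>+t. ennreal (p * t powr (p - 1)) * indicator {0<..} t * emeasure lborel {x. ennreal t < u x} \<partial>lborel)"
proof -
  have "(\<integral>\<^sup>+x. ennreal_powr (u x) p \<partial>lborel) =
     (\<integral>\<^sup>+x. \<integral>\<^sup>+t. ennreal (p * t powr (p - 1)) * indicator {0<..} t * indicator {x. ennreal t < u x} x \<partial>lborel \<partial>lborel)"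
    unfolding ennreal_powr_layer_cake[OF assms(1)]
    by (intro nn_integral_cong) (auto simp: indicator_def)
  also have "\<dots> = (\<integral>\<^sup>+t. \<integral>\<^sup>+x. ennreal (p * t powr (p - 1)) * indicator {0<..} t * indicator {x. ennreal t < u x} x \<partial>lborel \<partial>lborel)"
    by (rule lborel_pair.Fubini') measurable
  also have "\<dots> = (\<integral>\<^sup>+t. ennreal (p * t powr (p - 1)) * indicator {0<..} t * emeasure lborel {x. ennreal t < u x} \<partial>lborel)"
    by (intro nn_integral_cong) (simp add: nn_integral_cmult)
  finally show ?thesis .
qed

subsection \<open>The Hardy--Littlewood maximal function\<close>

text \<open>The uncentred maximal function over open balls, although the commutator uses cubes:
  superlevel sets are then unions of open balls, hence measurable for any g, and fit the Vitali
  covering lemma.\<close>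

definition max_fun :: "('a::euclidean_space \<Rightarrow> ennreal) \<Rightarrow> 'a \<Rightarrow> ennreal" where
  "max_fun g x = (SUP B \<in> {ball c s | c s. x \<in> ball c s}.
     (\<integral>\<^sup>+y\<in>B. g y \<partial>lborel) / emeasure lborel B)"

lemma less_max_fun_iff:
  "t < max_fun g x \<longleftrightarrow>
     (\<exists>c s. x \<in> ball c s \<and> t < (\<integral>\<^sup>+y\<in>ball c s. g y \<partial>lborel) / emeasure lborel (ball c s))"
  unfolding max_fun_def less_SUP_iff by blast

lemma max_fun_superlevel:
  "{x. t < max_fun g x} =
     (\<Union>(c, s) \<in> {(c, s). 0 < s \<and> t < (\<integral>\<^sup>+y\<in>ball c s. g y \<partial>lborel) / emeasure lborel (ball c s)}. ball c s)"
proof -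
  have "0 < s" if "x \<in> ball c s" for x c :: 'a and s
    using that by (metis ball_eq_empty equals0D not_le)
  then show ?thesis
    by (auto simp: less_max_fun_iff) blast+
qed

lemma borel_measurable_max_fun [measurable]: "max_fun g \<in> borel_measurable borel"
proof (rule borel_measurableI_greater)
  fix t
  have "open {x. t < max_fun g x}"
    unfolding max_fun_superlevel by auto
  then show "{x \<in> space borel. t < max_fun g x} \<in> sets borel" by simp
qed

text \<open>A ball B witnessing a value above t has t |B| at most the integral of g over B. Vitali
  selects disjoint balls whose 5-fold dilates still cover the superlevel set, whence the factor
  5^n.\<close>

lemma max_fun_weak_type:
  fixes g :: "'a::euclidean_space \<Rightarrow> ennreal"
  assumes [measurable]: "g \<in> borel_measurable borel" and t: "0 < t"
  shows "ennreal t * emeasure lborel {x. ennreal t < max_fun g x} \<le> 5 ^ DIM('a) * (\<integral>\<^sup>+x. g x \<partial>lborel)"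
proof (cases "(\<integral>\<^sup>+x. g x \<partial>lborel)")
  case top
  then show ?thesis by (simp add: ennreal_mult_top)
next
  case (real I)
  define K where "K = {(c, s). 0 < s \<and>
      ennreal t < (\<integral>\<^sup>+y\<in>ball c s. g y \<partial>lborel) / emeasure lborel (ball (c::'a) s)}"
  have ball_m: "emeasure lborel (ball c s) = ennreal (unit_ball_vol (real DIM('a)) * s ^ DIM('a))"
    if "0 < s" for c :: 'a and s
    using that by (intro emeasure_ball) auto
  have avg: "ennreal t * emeasure lborel (ball c s) \<le> (\<integral>\<^sup>+y\<in>ball c s. g y \<partial>lborel)"
    if "(c, s) \<in> K" for c s
  proof -
    have "0 < s" "ennreal t \<le> (\<integral>\<^sup>+y\<in>ball c s. g y \<partial>lborel) / emeasure lborel (ball c s)"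
      using that by (auto simp: K_def)
    moreover have "emeasure lborel (ball c s) \<noteq> 0" "emeasure lborel (ball c s) \<noteq> top"
      using \<open>0 < s\<close> by (auto simp: ball_m ennreal_eq_0_iff not_le)
    ultimately have "ennreal t * emeasure lborel (ball c s)
        \<le> (\<integral>\<^sup>+y\<in>ball c s. g y \<partial>lborel) / emeasure lborel (ball c s) * emeasure lborel (ball c s)"
      by (intro mult_right_mono) auto
    also have "\<dots> = (\<integral>\<^sup>+y\<in>ball c s. g y \<partial>lborel)"
      using \<open>emeasure lborel (ball c s) \<noteq> 0\<close> \<open>emeasure lborel (ball c s) \<noteq> top\<close>
      by (simp add: ennreal_divide_times ennreal_divide_self less_top)
    finally show ?thesis .
  qed
  have V: "0 < unit_ball_vol (real DIM('a))" by simp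
  \<comment> \<open>Vitali needs bounded radii. A radius s > 1 satisfies s <= s^n, and t times the
    volume of the ball is at most the finite integral I.\<close>
  define R where "R = max 1 (I / (t * unit_ball_vol (real DIM('a))))"
  have bd: "s \<le> R" if "(c, s) \<in> K" for c s
  proof (cases "s \<le> 1")
    case False
    have "ennreal t * emeasure lborel (ball c s) \<le> (\<integral>\<^sup>+x. g x \<partial>lborel)"
      using avg[OF that] by (rule order_trans) (auto intro!: nn_integral_mono simp: indicator_def)
    then have "t * (unit_ball_vol (real DIM('a)) * s ^ DIM('a)) \<le> I"
      using False t real V by (simp add: ball_m ennreal_mult'[symmetric] ennreal_le_iff)
    moreover have "s \<le> s ^ DIM('a)"
      using False by (intro self_le_power) auto
    then have "t * unit_ball_vol (real DIM('a)) * s \<le> t * (unit_ball_vol (real DIM('a)) * s ^ DIM('a))"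
      using t V by (simp add: mult.assoc)
    ultimately have "t * unit_ball_vol (real DIM('a)) * s \<le> I" by linarith
    then have "s \<le> I / (t * unit_ball_vol (real DIM('a)))"
      using t V by (subst pos_le_divide_eq) (auto simp: mult_ac)
    then show ?thesis by (simp add: R_def)
  qed (simp add: R_def)
  have cov: "{x. ennreal t < max_fun g x} \<subseteq> (\<Union>i\<in>K. ball (fst i) (snd i))"
    unfolding max_fun_superlevel K_def by force
  obtain C where C: "countable C" "C \<subseteq> K"
     "pairwise (\<lambda>i j. disjnt (ball (fst i) (snd i)) (ball (fst j) (snd j))) C"
     "{x. ennreal t < max_fun g x} \<subseteq> (\<Union>i\<in>C. ball (fst i) (5 * snd i))"
  proof (rule Vitali_covering_lemma_balls[OF cov])
    show "0 < snd i \<and> snd i \<le> R" if "i \<in> K" for i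
      using that bd[of "fst i" "snd i"] by (auto simp: K_def)
  qed
  define e where "e = to_nat_on C"
  have inj: "inj_on e C" using C(1) unfolding e_def by (rule inj_on_to_nat_on)
  define B where "B k = (if k \<in> e ` C then ball (fst (inv_into C e k)) (snd (inv_into C e k)) else {})" for k
  define B5 where "B5 k = (if k \<in> e ` C then ball (fst (inv_into C e k)) (5 * snd (inv_into C e k)) else {})" for k
  have disj: "disjoint_family B"
    unfolding disjoint_family_on_def
  proof (intro ballI impI)
    fix k l :: nat assume "k \<noteq> l"
    show "B k \<inter> B l = {}"
    proof (cases "k \<in> e ` C \<and> l \<in> e ` C")
      case True
      then obtain i j where "i \<in> C" "j \<in> C" "k = e i" "l = e j" by auto
      moreover from this \<open>k \<noteq> l\<close> have "ball (fst i) (snd i) \<inter> ball (fst j) (snd j) = {}"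
        using pairwiseD[OF C(3), of i j] by (auto simp only: disjnt_def)
      ultimately show ?thesis
        using inj by (simp add: B_def inv_into_f_f)
    qed (auto simp: B_def)
  qed
  have B5: "ennreal t * emeasure lborel (B5 k) \<le> 5 ^ DIM('a) * (\<integral>\<^sup>+y\<in>B k. g y \<partial>lborel)" for k
  proof (cases "k \<in> e ` C")
    case True
    then obtain i where i: "i \<in> C" "k = e i" by auto
    obtain c s where cs: "i = (c, s)" by force
    have "(c, s) \<in> K" using i C(2) cs by auto
    then have "0 < s" by (auto simp: K_def)
    have "emeasure lborel (ball c (5 * s)) = 5 ^ DIM('a) * emeasure lborel (ball c s)"
      using \<open>0 < s\<close> V by (simp add: ball_m power_mult_distrib ennreal_mult' ennreal_power mult_ac
        flip: ennreal_numeral)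
    then have "ennreal t * emeasure lborel (ball c (5 * s)) \<le> 5 ^ DIM('a) * (\<integral>\<^sup>+y\<in>ball c s. g y \<partial>lborel)"
      using mult_left_mono[OF avg[OF \<open>(c, s) \<in> K\<close>], of "5 ^ DIM('a)"] by (simp add: mult_ac)
    then show ?thesis using i inj cs by (simp add: B_def B5_def inv_into_f_f)
  qed (simp add: B5_def)
  have [measurable]: "B k \<in> sets borel" "B5 k \<in> sets borel" for k by (auto simp: B_def B5_def)
  have "{x. ennreal t < max_fun g x} \<subseteq> (\<Union>k. B5 k)"
  proof
    fix x assume "x \<in> {x. ennreal t < max_fun g x}"
    then obtain i where "i \<in> C" "x \<in> ball (fst i) (5 * snd i)" using C(4) by blast
    then have "x \<in> B5 (e i)" using inj by (simp add: B5_def inv_into_f_f)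
    then show "x \<in> (\<Union>k. B5 k)" by blast
  qed
  then have "emeasure lborel {x. ennreal t < max_fun g x} \<le> emeasure lborel (\<Union>k. B5 k)"
    by (intro emeasure_mono) auto
  also have "\<dots> \<le> (\<Sum>k. emeasure lborel (B5 k))"
    by (intro emeasure_subadditive_countably) auto
  finally have "ennreal t * emeasure lborel {x. ennreal t < max_fun g x} \<le> (\<Sum>k. ennreal t * emeasure lborel (B5 k))"
    by (simp add: mult_left_mono)
  also have "\<dots> \<le> (\<Sum>k. 5 ^ DIM('a) * (\<integral>\<^sup>+y\<in>B k. g y \<partial>lborel))"
    by (intro suminf_le B5) auto
  also have "\<dots> = 5 ^ DIM('a) * (\<integral>\<^sup>+y. (\<Sum>k. g y * indicator (B k) y) \<partial>lborel)"
    by (subst nn_integral_suminf) (auto simp: ennreal_suminf_cmult)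
  also have "(\<lambda>y. \<Sum>k. g y * indicator (B k) y) = (\<lambda>y. g y * indicator (\<Union>k. B k) y)"
    using disj by (simp add: suminf_indicator)
  also have "5 ^ DIM('a) * (\<integral>\<^sup>+y. g y * indicator (\<Union>k. B k) y \<partial>lborel)
      \<le> 5 ^ DIM('a) * (\<integral>\<^sup>+y. g y \<partial>lborel)"
    by (intro mult_left_mono nn_integral_mono) (auto simp: indicator_def)
  finally show ?thesis .
qed

section \<open>Truncation and strong-type bounds for the maximal function\<close>

lemma max_fun_add_const:
  fixes g h :: "'a::euclidean_space \<Rightarrow> ennreal"
  assumes [measurable]: "h \<in> borel_measurable borel" and le: "\<And>x. g x \<le> h x + ennreal a"
  shows "max_fun g x \<le> max_fun h x + ennreal a"
  unfolding max_fun_def[of g]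
proof (rule SUP_least, clarsimp)
  fix c s assume x: "dist c x < s"
  have [measurable]: "ball c s \<in> sets borel" by simp
  have x': "x \<in> ball c s" using x by simp
  have m: "emeasure lborel (ball c s) \<noteq> 0" "emeasure lborel (ball c s) \<noteq> top"
    using x zero_le_dist[of c x] by (auto simp: emeasure_ball ennreal_eq_0_iff not_le simp del: zero_le_dist)
  have "(\<integral>\<^sup>+y\<in>ball c s. g y \<partial>lborel) \<le> (\<integral>\<^sup>+y. h y * indicator (ball c s) y + ennreal a * indicator (ball c s) y \<partial>lborel)"
    using le by (intro nn_integral_mono) (auto simp: indicator_def)
  also have "\<dots> = (\<integral>\<^sup>+y\<in>ball c s. h y \<partial>lborel) + ennreal a * emeasure lborel (ball c s)"
    by (subst nn_integral_add) (auto simp: nn_integral_cmult_indicator)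
  finally have "(\<integral>\<^sup>+y\<in>ball c s. g y \<partial>lborel) / emeasure lborel (ball c s)
     \<le> ((\<integral>\<^sup>+y\<in>ball c s. h y \<partial>lborel) + ennreal a * emeasure lborel (ball c s)) / emeasure lborel (ball c s)"
    by (rule divide_right_mono_ennreal)
  also have "\<dots> = (\<integral>\<^sup>+y\<in>ball c s. h y \<partial>lborel) / emeasure lborel (ball c s) + ennreal a"
    using m by (simp add: add_divide_distrib_ennreal ennreal_mult_divide_eq)
  also have "\<dots> \<le> max_fun h x + ennreal a"
    unfolding max_fun_def using x' by (intro add_right_mono SUP_upper) blast
  finally show "(\<integral>\<^sup>+y\<in>ball c s. g y \<partial>lborel) / emeasure lborel (ball c s) \<le> max_fun h x + ennreal a" .
qed

text \<open>Discarding the values of g up to t/2 lowers every average by at most t/2, so the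
  superlevel set at t lies in that of the truncated function at t/2. Writing t = 2 (t/2) gives the
  extra factor 2.\<close>

lemma max_fun_weak_type_truncated:
  fixes g :: "'a::euclidean_space \<Rightarrow> ennreal"
  assumes [measurable]: "g \<in> borel_measurable borel" and t: "0 < t"
  shows "ennreal t * emeasure lborel {x. ennreal t < max_fun g x}
    \<le> ennreal (2 * 5 ^ DIM('a)) * (\<integral>\<^sup>+x. g x * indicator {x. ennreal (t / 2) < g x} x \<partial>lborel)"
proof -
  let ?h = "\<lambda>x. g x * indicator {x. ennreal (t / 2) < g x} x"
  have sub: "{x. ennreal t < max_fun g x} \<subseteq> {x. ennreal (t / 2) < max_fun ?h x}"
  proof clarsimp
    fix x assume "ennreal t < max_fun g x"
    also have "max_fun g x \<le> max_fun ?h x + ennreal (t / 2)"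
      by (rule max_fun_add_const) (auto simp: indicator_def not_less)
    finally have "ennreal (t / 2) + ennreal (t / 2) < max_fun ?h x + ennreal (t / 2)"
      using t by (simp flip: ennreal_plus)
    then show "ennreal (t / 2) < max_fun ?h x"
      by (metis add_right_mono not_le)
  qed
  have "ennreal t * emeasure lborel {x. ennreal t < max_fun g x}
      \<le> 2 * (ennreal (t / 2) * emeasure lborel {x. ennreal (t / 2) < max_fun ?h x})"
  proof -
    have "ennreal t = 2 * ennreal (t / 2)" using t by (simp flip: ennreal_numeral ennreal_mult)
    then show ?thesis using emeasure_mono[OF sub, of lborel] by (simp add: mult.assoc mult_left_mono)
  qed
  also have "\<dots> \<le> 2 * (5 ^ DIM('a) * (\<integral>\<^sup>+x. ?h x \<partial>lborel))"
    using t by (intro mult_left_mono max_fun_weak_type) auto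
  also have "\<dots> = ennreal (2 * 5 ^ DIM('a)) * (\<integral>\<^sup>+x. ?h x \<partial>lborel)"
    by (simp add: ennreal_mult mult.assoc flip: ennreal_power)
  finally show ?thesis .
qed

text \<open>Marcinkiewicz interpolation: after Tonelli the inner integral of t^(p-2) over 0 < t < 2
  g(x) equals (2 g(x))^(p-1) / (p-1), convergent at 0 because p > 1.\<close>

lemma max_fun_powr_bound:
  fixes g :: "'a::euclidean_space \<Rightarrow> real"
  assumes [measurable]: "g \<in> borel_measurable borel" and g: "\<And>x. 0 \<le> g x" and p: "1 < p"
  shows "(\<integral>\<^sup>+x. ennreal_powr (max_fun (\<lambda>x. ennreal (g x)) x) p \<partial>lborel)
    \<le> ennreal (2 * 5 ^ DIM('a) * p * 2 powr (p - 1) / (p - 1)) * (\<integral>\<^sup>+x. ennreal (g x powr p) \<partial>lborel)"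
proof -
  let ?g = "\<lambda>x. ennreal (g x)" and ?N = "2 * 5 ^ DIM('a) :: real"
  have "(\<integral>\<^sup>+x. ennreal_powr (max_fun ?g x) p \<partial>lborel)
     = (\<integral>\<^sup>+t. ennreal (p * t powr (p - 1)) * indicator {0<..} t * emeasure lborel {x. ennreal t < max_fun ?g x} \<partial>lborel)"
    using p by (intro nn_integral_ennreal_powr_layer_cake) auto
  also have "\<dots> \<le> (\<integral>\<^sup>+t. \<integral>\<^sup>+x. ennreal (?N * p) * (ennreal (g x) * (ennreal (t powr (p - 2)) *
       indicator {t. 0 < t \<and> t < 2 * g x} t)) \<partial>lborel \<partial>lborel)"
  proof (rule nn_integral_mono)
    fix t :: real
    show "ennreal (p * t powr (p - 1)) * indicator {0<..} t * emeasure lborel {x. ennreal t < max_fun ?g x}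
      \<le> (\<integral>\<^sup>+x. ennreal (?N * p) * (ennreal (g x) * (ennreal (t powr (p - 2)) *
       indicator {t. 0 < t \<and> t < 2 * g x} t)) \<partial>lborel)"
    proof (cases "0 < t")
      case True
      have "t powr (p - 1) = t powr (p - 2) * t" using True by (simp add: powr_mult_base' powr_diff power2_eq_square)
      then have "ennreal (p * t powr (p - 1)) * indicator {0<..} t * emeasure lborel {x. ennreal t < max_fun ?g x}
        = ennreal (p * t powr (p - 2)) * (ennreal t * emeasure lborel {x. ennreal t < max_fun ?g x})"
        using True p by (simp add: ennreal_mult mult.assoc)
      also have "\<dots> \<le> ennreal (p * t powr (p - 2)) *
          (ennreal ?N * (\<integral>\<^sup>+x. ?g x * indicator {x. ennreal (t / 2) < ?g x} x \<partial>lborel))"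
        using True by (intro mult_left_mono max_fun_weak_type_truncated) auto
      also have "\<dots> = ennreal (p * t powr (p - 2) * ?N) * (\<integral>\<^sup>+x. ?g x * indicator {x. ennreal (t / 2) < ?g x} x \<partial>lborel)"
        using p by (simp add: ennreal_mult mult.assoc)
      also have "\<dots> = (\<integral>\<^sup>+x. ennreal (p * t powr (p - 2) * ?N) * (?g x * indicator {x. ennreal (t / 2) < ?g x} x) \<partial>lborel)"
        by (subst nn_integral_cmult) auto
      also have "\<dots> = (\<integral>\<^sup>+x. ennreal (?N * p) * (ennreal (g x) * (ennreal (t powr (p - 2)) *
          indicator {t. 0 < t \<and> t < 2 * g x} t)) \<partial>lborel)"
        using True p g by (intro nn_integral_cong)
          (auto simp: indicator_def ennreal_less_iff simp flip: ennreal_mult)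
      finally show ?thesis .
    qed auto
  qed
  also have "\<dots> = (\<integral>\<^sup>+x. \<integral>\<^sup>+t. ennreal (?N * p) * (ennreal (g x) * (ennreal (t powr (p - 2)) *
       indicator {t. 0 < t \<and> t < 2 * g x} t)) \<partial>lborel \<partial>lborel)"
    by (rule lborel_pair.Fubini') measurable
  also have "\<dots> = (\<integral>\<^sup>+x. ennreal (?N * p * 2 powr (p - 1) / (p - 1)) * ennreal (g x powr p) \<partial>lborel)"
  proof (rule nn_integral_cong)
    fix x
    have "(\<integral>\<^sup>+t. ennreal (?N * p) * (ennreal (g x) * (ennreal (t powr (p - 2)) *
       indicator {t. 0 < t \<and> t < 2 * g x} t)) \<partial>lborel)
       = ennreal (?N * p) * (ennreal (g x) * ennreal ((2 * g x) powr (p - 1) / (p - 1)))"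
      using nn_integral_powr_segment[of "p - 1" "2 * g x"] p g
      by (subst nn_integral_cmult, simp, subst nn_integral_cmult) (simp_all add: algebra_simps)
    also have "\<dots> = ennreal (?N * p * (g x * ((2 * g x) powr (p - 1) / (p - 1))))"
      using p g by (simp flip: ennreal_mult)
    also have "g x * ((2 * g x) powr (p - 1) / (p - 1)) = 2 powr (p - 1) / (p - 1) * g x powr p"
      using g[of x] p by (cases "g x = 0") (auto simp: powr_mult powr_diff)
    finally show "(\<integral>\<^sup>+t. ennreal (?N * p) * (ennreal (g x) * (ennreal (t powr (p - 2)) *
       indicator {t. 0 < t \<and> t < 2 * g x} t)) \<partial>lborel)
       = ennreal (?N * p * 2 powr (p - 1) / (p - 1)) * ennreal (g x powr p)"
      using p g by (simp flip: ennreal_mult)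
  qed
  also have "\<dots> = ennreal (?N * p * 2 powr (p - 1) / (p - 1)) * (\<integral>\<^sup>+x. ennreal (g x powr p) \<partial>lborel)"
    by (subst nn_integral_cmult) auto
  finally show ?thesis by simp
qed

text \<open>Capping at 1 stops the layer cake at t = 1, where the plain weak-type bound leaves the
  integrable t^(p-2). The right side therefore involves only the integral of g, not of its p-th
  power.\<close>

lemma min_max_fun_powr_bound:
  fixes g :: "'a::euclidean_space \<Rightarrow> ennreal"
  assumes [measurable]: "g \<in> borel_measurable borel" and p: "1 < p"
  shows "(\<integral>\<^sup>+x. ennreal_powr (min 1 (max_fun g x)) p \<partial>lborel)
    \<le> ennreal (5 ^ DIM('a) * p / (p - 1)) * (\<integral>\<^sup>+x. g x \<partial>lborel)"
proof -
  let ?I = "\<integral>\<^sup>+x. g x \<partial>lborel"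
  have "(\<integral>\<^sup>+x. ennreal_powr (min 1 (max_fun g x)) p \<partial>lborel)
     = (\<integral>\<^sup>+t. ennreal (p * t powr (p - 1)) * indicator {0<..} t * emeasure lborel {x. ennreal t < min 1 (max_fun g x)} \<partial>lborel)"
    using p by (intro nn_integral_ennreal_powr_layer_cake) auto
  also have "\<dots> \<le> (\<integral>\<^sup>+t. (ennreal (p * 5 ^ DIM('a)) * ?I) * (ennreal (t powr (p - 2)) * indicator {t. 0 < t \<and> t < 1} t) \<partial>lborel)"
  proof (rule nn_integral_mono)
    fix t :: real
    consider "0 < t" "t < 1" | "t \<le> 0" | "1 \<le> t" by linarith
    then show "ennreal (p * t powr (p - 1)) * indicator {0<..} t * emeasure lborel {x. ennreal t < min 1 (max_fun g x)}
      \<le> (ennreal (p * 5 ^ DIM('a)) * ?I) * (ennreal (t powr (p - 2)) * indicator {t. 0 < t \<and> t < 1} t)"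
    proof cases
      case 1
      have "t powr (p - 1) = t powr (p - 2) * t" using 1 by (simp add: powr_mult_base' powr_diff power2_eq_square)
      then have "ennreal (p * t powr (p - 1)) * indicator {0<..} t * emeasure lborel {x. ennreal t < min 1 (max_fun g x)}
        = ennreal (p * t powr (p - 2)) * (ennreal t * emeasure lborel {x. ennreal t < min 1 (max_fun g x)})"
        using 1 p by (simp add: ennreal_mult mult.assoc)
      also have "\<dots> \<le> ennreal (p * t powr (p - 2)) * (ennreal t * emeasure lborel {x. ennreal t < max_fun g x})"
        by (intro mult_left_mono emeasure_mono) auto
      also have "\<dots> \<le> ennreal (p * t powr (p - 2)) * (5 ^ DIM('a) * ?I)"
        using 1 by (intro mult_left_mono max_fun_weak_type) auto
      also have "\<dots> = (ennreal (p * 5 ^ DIM('a)) * ?I) * (ennreal (t powr (p - 2)) * indicator {t. 0 < t \<and> t < 1} t)"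
        using 1 p by (simp add: ennreal_mult mult_ac flip: ennreal_power)
      finally show ?thesis .
    next
      case 3
      then have "1 \<le> ennreal t" by (simp add: ennreal_1[symmetric] ennreal_le_iff del: ennreal_1)
      then have "{x. ennreal t < min 1 (max_fun g x)} = {}" by (auto simp: not_less[symmetric])
      then show ?thesis by (simp only: emeasure_empty) simp
    qed auto
  qed
  also have "\<dots> = (ennreal (p * 5 ^ DIM('a)) * ?I) * ennreal (1 / (p - 1))"
    using nn_integral_powr_segment[of "p - 1" 1] p
    by (subst nn_integral_cmult) (simp_all add: algebra_simps)
  also have "\<dots> = ennreal (5 ^ DIM('a) * p / (p - 1)) * ?I"
    using p by (simp add: mult_ac flip: ennreal_mult)
  finally show ?thesis .
qed

subsection \<open>Cubes and an integrable weight\<close>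

abbreviation cube :: "real^'n::finite \<Rightarrow> real \<Rightarrow> (real^'n) set" where
  "cube a l \<equiv> cbox a (\<chi> i. a $ i + l)"

lemma cube_cases:
  fixes Q :: "(real^'n::finite) set"
  assumes "Q \<in> cubes"
  obtains a l where "0 < l" "Q = cube a l"
  using assms unfolding cubes_def by blast

lemma measure_cube:
  fixes a :: "real^'n::finite"
  assumes "0 < l"
  shows "measure lebesgue (cube a l) = l ^ CARD('n)"
    and "emeasure lborel (cube a l) = ennreal (l ^ CARD('n))"
proof -
  have ne: "cube a l \<noteq> {}"
    using assms by (auto simp: interval_ne_empty_cart)
  show m: "measure lebesgue (cube a l) = l ^ CARD('n)"
    using content_cbox_cart[OF ne] by (simp add: measure_completion)
  then show "emeasure lborel (cube a l) = ennreal (l ^ CARD('n))"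
    using emeasure_lborel_cbox_finite[of a "\<chi> i. a $ i + l"]
    by (simp add: emeasure_eq_ennreal_measure measure_completion)
qed

lemma norm_diff_cube:
  fixes a :: "real^'n::finite"
  assumes "x \<in> cube a l" "y \<in> cube a l"
  shows "norm (x - y) \<le> real CARD('n) * l"
proof -
  have "norm (x - y) \<le> (\<Sum>i\<in>UNIV. \<bar>(x - y) $ i\<bar>)" by (rule norm_le_l1_cart)
  also have "\<dots> \<le> (\<Sum>i\<in>(UNIV :: 'n set). l)"
  proof (rule sum_mono)
    fix i :: 'n
    have "a $ i \<le> x $ i \<and> x $ i \<le> a $ i + l" "a $ i \<le> y $ i \<and> y $ i \<le> a $ i + l"
      using assms by (auto simp: mem_box_cart)
    then show "\<bar>(x - y) $ i\<bar> \<le> l" by (simp add: abs_le_iff)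
  qed
  finally show ?thesis by simp
qed

text \<open>A ball of radius 2 n l fits into a cube of side 4 n l; this is the volume of the latter
  divided by l^n.\<close>

definition max_fun_const :: "'n::finite itself \<Rightarrow> real" where
  "max_fun_const _ = (4 * real CARD('n)) ^ CARD('n)"

lemma max_fun_const_ge_1: "1 \<le> max_fun_const TYPE('n::finite)"
proof -
  have "1 \<le> real CARD('n)" by (simp add: Suc_le_eq)
  then show ?thesis unfolding max_fun_const_def by (intro one_le_power) linarith
qed

lemma cube_integral_le_max_fun:
  fixes a :: "real^'n::finite"
  assumes l: "0 < l" and x: "x \<in> cube a l"
  shows "(\<integral>\<^sup>+y\<in>cube a l. g y \<partial>lborel)
     \<le> ennreal (max_fun_const TYPE('n) * l ^ CARD('n)) * max_fun g x"
proof -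
  have n1: "1 \<le> real CARD('n)" by (simp add: Suc_le_eq)
  \<comment> \<open>Twice the bound n l on the diameter, so that the open ball about x contains the
    closed cube.\<close>
  define s where "s = 2 * real CARD('n) * l"
  have s: "0 < s" using l n1 by (simp add: s_def)
  have sub: "cube a l \<subseteq> ball x s"
  proof
    fix y assume "y \<in> cube a l"
    then have "norm (x - y) \<le> real CARD('n) * l" using x norm_diff_cube by blast
    also have "\<dots> < s" using l n1 by (simp add: s_def)
    finally show "y \<in> ball x s" by (simp add: dist_norm)
  qed
  have m0: "emeasure lborel (ball x s) \<noteq> 0" "emeasure lborel (ball x s) \<noteq> top"
    using s by (auto simp: emeasure_ball ennreal_eq_0_iff not_le)
  define c where "c = x - vec s"
  have c: "c $ i = x $ i - s" for i by (simp add: c_def)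
  have sub2: "ball x s \<subseteq> cube c (2 * s)"
  proof
    fix y assume "y \<in> ball x s"
    have "x $ i - s \<le> y $ i \<and> y $ i \<le> x $ i + s" for i
    proof -
      have "\<bar>(x - y) $ i\<bar> \<le> s"
        using component_le_norm_cart[of "x - y" i] \<open>y \<in> ball x s\<close> by (simp add: dist_norm)
      then show ?thesis unfolding abs_le_iff vector_minus_component by linarith
    qed
    then show "y \<in> cube c (2 * s)"
      by (auto simp: mem_box_cart c algebra_simps)
  qed
  have "0 < 2 * s" using s by simp
  have "emeasure lborel (ball x s) \<le> emeasure lborel (cube c (2 * s))"
    by (rule emeasure_mono[OF sub2]) simp
  also have "\<dots> = ennreal ((2 * s) ^ CARD('n))"
    by (rule measure_cube(2)[OF \<open>0 < 2 * s\<close>])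
  also have "(2 * s) ^ CARD('n) = max_fun_const TYPE('n) * l ^ CARD('n)"
  proof -
    have "2 * s = 4 * real CARD('n) * l" by (simp add: s_def)
    then show ?thesis by (simp only: max_fun_const_def power_mult_distrib)
  qed
  finally have m: "emeasure lborel (ball x s) \<le> ennreal (max_fun_const TYPE('n) * l ^ CARD('n))" .
  have "(\<integral>\<^sup>+y\<in>cube a l. g y \<partial>lborel) \<le> (\<integral>\<^sup>+y\<in>ball x s. g y \<partial>lborel)"
    using sub by (intro nn_integral_mono) (auto simp: indicator_def)
  also have "\<dots> = emeasure lborel (ball x s) * ((\<integral>\<^sup>+y\<in>ball x s. g y \<partial>lborel) / emeasure lborel (ball x s))"
    using m0 by (subst mult.commute) (simp add: ennreal_divide_times ennreal_divide_self less_top)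
  also have "\<dots> \<le> ennreal (max_fun_const TYPE('n) * l ^ CARD('n)) * max_fun g x"
  proof (intro mult_mono m)
    have "ball x s \<in> {ball c s | c s. x \<in> ball c s}" using s by force
    then show "(\<integral>\<^sup>+y\<in>ball x s. g y \<partial>lborel) / emeasure lborel (ball x s) \<le> max_fun g x"
      unfolding max_fun_def by (rule SUP_upper)
  qed auto
  finally show ?thesis .
qed

section \<open>A polynomially decaying integrable weight\<close>

definition decay_weight :: "real^'n::finite \<Rightarrow> real" where
  "decay_weight x = (exp 1 + norm x) powr (- 2 * real CARD('n))"

lemma decay_weight_pos: "0 < decay_weight x"
  unfolding decay_weight_def using add_pos_nonneg[OF exp_gt_zero norm_ge_zero, of 1 x] by simp

lemma one_le_exp_plus_norm: "1 \<le> exp 1 + norm x"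
  using exp_ge_add_one_self[of 1] norm_ge_zero[of x] by linarith

lemma one_le_ln_exp_plus:
  fixes c :: real
  assumes "0 \<le> c"
  shows "1 \<le> ln (exp 1 + c)"
  using assms by (subst ln_ge_iff) (auto intro: add_pos_nonneg)

lemma decay_weight_le_1: "decay_weight x \<le> 1"
  unfolding decay_weight_def using one_le_exp_plus_norm[of x]
  by (simp add: powr_minus_divide ge_one_powr_ge_zero)

lemma borel_measurable_decay_weight [measurable]: "decay_weight \<in> borel_measurable borel"
  unfolding decay_weight_def[abs_def] by measurable

lemma nn_integral_inverse_square_finite:
  "(\<integral>\<^sup>+t. ennreal (1 / (1 + t\<^sup>2)) \<partial>lborel) < \<infinity>"
proof -
  have tail: "(\<integral>\<^sup>+t. ennreal (1 / (1 + t\<^sup>2)) * indicator {0..} t \<partial>lborel) = ennreal (pi / 2 - arctan 0)"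
    by (rule nn_integral_FTC_atLeast)
      (auto intro!: derivative_eq_intros tendsto_arctan_at_top simp: field_simps)
  have "(\<integral>\<^sup>+t. ennreal (1 / (1 + t\<^sup>2)) * indicator {..0} t \<partial>lborel) =
     (\<integral>\<^sup>+t. ennreal (1 / (1 + t\<^sup>2)) * indicator {0..} t \<partial>lborel)"
    by (subst nn_integral_real_affine[where c = "-1" and t = 0]) (auto simp: indicator_def)
  note neg = this
  have "(\<integral>\<^sup>+t. ennreal (1 / (1 + t\<^sup>2)) \<partial>lborel) \<le>
     (\<integral>\<^sup>+t. ennreal (1 / (1 + t\<^sup>2)) * indicator {..0} t + ennreal (1 / (1 + t\<^sup>2)) * indicator {0..} t \<partial>lborel)"
    by (intro nn_integral_mono) (auto simp: indicator_def)
  also have "\<dots> = ennreal (pi / 2 - arctan 0) + ennreal (pi / 2 - arctan 0)"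
    by (subst nn_integral_add) (simp_all only: neg tail, simp_all)
  also have "\<dots> < \<infinity>" by simp
  finally show ?thesis .
qed

text \<open>The exponent -2n is spread over the n coordinates: each factor (e + |x|)^(-2) is at most
  1 / (1 + x_i^2), and the product of these integrates to a power of a one-dimensional
  integral.\<close>

lemma decay_weight_integral_finite: "(\<integral>\<^sup>+x. ennreal (decay_weight (x::real^'n::finite)) \<partial>lborel) < \<infinity>"
proof -
  have "(\<integral>\<^sup>+x. ennreal (decay_weight (x::real^'n)) \<partial>lborel)
     \<le> (\<integral>\<^sup>+(x::real^'n). (\<Prod>b\<in>Basis. ennreal (1 / (1 + (x \<bullet> b)\<^sup>2))) \<partial>lborel)"
  proof (rule nn_integral_mono)
    fix x :: "real^'n"
    have "decay_weight x = ((exp 1 + norm x) powr (- 2)) powr real CARD('n)"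
      unfolding decay_weight_def powr_powr by simp
    also have "\<dots> = (\<Prod>b\<in>(Basis :: (real^'n) set). (exp 1 + norm x) powr (- 2))"
      using one_le_exp_plus_norm[of x] by (subst powr_realpow) auto
    also have "\<dots> \<le> (\<Prod>b\<in>(Basis :: (real^'n) set). 1 / (1 + (x \<bullet> b)\<^sup>2))"
    proof (rule prod_mono, intro conjI)
      fix b :: "real^'n" assume "b \<in> Basis"
      have e: "1 \<le> exp (1::real)" using exp_ge_add_one_self[of 1] by linarith
      have "1 + (x \<bullet> b)\<^sup>2 \<le> (exp 1)\<^sup>2 + (norm x)\<^sup>2"
        using Basis_le_norm[OF \<open>b \<in> Basis\<close>, of x] e
        by (intro add_mono) (auto simp: abs_le_square_iff[symmetric])
      also have "\<dots> \<le> (exp 1 + norm x)\<^sup>2" by (simp add: power2_sum)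
      finally have *: "1 + (x \<bullet> b)\<^sup>2 \<le> (exp 1 + norm x)\<^sup>2" .
      have "0 < 1 + (x \<bullet> b)\<^sup>2" by (simp add: add_pos_nonneg)
      then show "(exp 1 + norm x) powr (- 2) \<le> 1 / (1 + (x \<bullet> b)\<^sup>2)"
        using one_le_exp_plus_norm[of x] * by (simp add: powr_minus_divide powr_numeral frac_le)
    qed simp
    finally show "ennreal (decay_weight x) \<le> (\<Prod>b\<in>Basis. ennreal (1 / (1 + (x \<bullet> b)\<^sup>2)))"
      by (simp add: prod_ennreal ennreal_leI)
  qed
  also have "\<dots> = (\<Prod>b\<in>(Basis :: (real^'n) set). (\<integral>\<^sup>+t. ennreal (1 / (1 + t\<^sup>2)) \<partial>lborel))"
    by (rule nn_integral_lborel_prod) auto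
  also have "\<dots> < \<infinity>"
    using nn_integral_inverse_square_finite by (simp add: ennreal_prod_eq_top less_top power_less_top_ennreal)
  finally show ?thesis .
qed

definition decay_const :: "'n::finite itself \<Rightarrow> real" where
  "decay_const _ = enn2real (\<integral>\<^sup>+x. ennreal (decay_weight (x::real^'n)) \<partial>lborel)"

lemma decay_const: 
  "(\<integral>\<^sup>+x. ennreal (decay_weight (x::real^'n::finite)) \<partial>lborel) = ennreal (decay_const TYPE('n))"
  "0 \<le> decay_const TYPE('n)"
  using decay_weight_integral_finite[where 'n='n] by (auto simp: decay_const_def less_top)

subsection \<open>Log-Hoelder exponents\<close>

text \<open>The exponent is (C / L) * n (1 + ln n) L with L = ln (e + 1 / (n l)): a bound for the
  oscillation times a bound for -n ln l, in which L cancels.\<close>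

definition local_const :: "'n::finite itself \<Rightarrow> real \<Rightarrow> real" where
  "local_const _ C = exp (real CARD('n) * C * (1 + ln (real CARD('n))))"

lemma local_const_ge_1: "0 \<le> C \<Longrightarrow> 1 \<le> local_const TYPE('n::finite) C"
  by (simp add: local_const_def Suc_le_eq)

text \<open>On a cube of side \<open>l \<le> 1\<close> the oscillation of a log-Hoelder function is \<open>O(1 / ln (1 / l))\<close>,
  so replacing one value of the exponent by another costs only a constant factor.\<close>

lemma small_cube_powr_bound:
  fixes x y a :: "real^'n::finite"
  assumes l: "0 < l" "l \<le> 1"
    and xy: "x \<in> cube a l" "y \<in> cube a l"
    and C: "0 \<le> C" and d: "d \<le> C / ln (exp 1 + 1 / norm (x - y))" and d0: "x = y \<Longrightarrow> d \<le> 0"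
    and th: "\<bar>\<theta>\<bar> \<le> d"
  shows "(l ^ CARD('n)) powr \<theta> \<le> local_const TYPE('n) C"
proof (cases "x = y")
  \<comment> \<open>At \<open>x = y\<close> the convention \<open>1 / 0 = 0\<close> leaves only
    \<open>d \<le> C\<close>, too weak for arbitrarily small l; hence the separate assumption
    \<open>d0\<close>.\<close>
  case True
  then have "\<theta> = 0" using d0 th by simp
  then show ?thesis using l local_const_ge_1[OF C, where 'n='n] by simp
next
  case False
  define n where "n = real CARD('n)"
  have n: "1 \<le> n" by (simp add: n_def Suc_le_eq)
  \<comment> \<open>Replacing |x - y| by its upper bound n l makes the estimate depend on the cube
    only.\<close>
  define L where "L = ln (exp 1 + 1 / (n * l))"
  have L1: "1 \<le> L" unfolding L_def using l n by (intro one_le_ln_exp_plus) simp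
  have "norm (x - y) \<le> n * l" unfolding n_def using xy by (rule norm_diff_cube)
  then have "1 / (n * l) \<le> 1 / norm (x - y)" using False l n by (intro divide_left_mono mult_pos_pos) auto
  moreover have "0 < exp 1 + 1 / (n * l)" using l n by (simp add: add_pos_nonneg)
  ultimately have "L \<le> ln (exp 1 + 1 / norm (x - y))"
    unfolding L_def by (intro ln_mono) auto
  then have "C / ln (exp 1 + 1 / norm (x - y)) \<le> C / L" using C L1 by (intro divide_left_mono) auto
  then have dL: "\<bar>\<theta>\<bar> \<le> C / L" using d th by linarith
  \<comment> \<open>-ln l is at most ln n + L, and L \<ge> 1 absorbs the constant ln n into a
    multiple of L.\<close>
  have "ln (1 / (n * l)) \<le> L"
    unfolding L_def using l n by (intro ln_mono) auto
  then have "- ln l \<le> ln n + L" using l n by (simp add: ln_div ln_mult)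
  moreover have "ln n \<le> ln n * L" using n L1 by (simp add: mult_le_cancel_left1)
  ultimately have lnl: "- ln l \<le> (1 + ln n) * L" by (simp add: algebra_simps)
  have "\<theta> * (n * ln l) \<le> \<bar>\<theta>\<bar> * (n * (- ln l))"
  proof -
    have "\<theta> * (n * ln l) \<le> \<bar>\<theta> * (n * ln l)\<bar>" by simp
    also have "\<dots> = \<bar>\<theta>\<bar> * (n * (- ln l))" using l n by (simp add: abs_mult abs_of_nonneg abs_of_nonpos)
    finally show ?thesis .
  qed
  also have "\<dots> \<le> C / L * (n * ((1 + ln n) * L))"
    using dL lnl n l C L1 by (intro mult_mono mult_nonneg_nonneg) auto
  also have "\<dots> = n * C * (1 + ln n)" using L1 by simp
  finally show ?thesis
    using l by (simp add: powr_def local_const_def n_def ln_realpow)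
qed

text \<open>If t is at most the weight, then t^a <= t because a \<ge> 1, and the weight alone
  suffices. Otherwise -ln t is at most 2 n ln (e + |x|), and the decay of the exponent difference
  cancels this logarithm.\<close>

lemma powr_exchange_decay:
  fixes x :: "real^'n::finite"
  assumes t: "0 \<le> t" "t \<le> 1" and ab: "1 \<le> a" "1 \<le> b"
    and d: "\<bar>a - b\<bar> \<le> C / ln (exp 1 + norm x)"
  shows "t powr a \<le> exp (2 * real CARD('n) * C) * t powr b + decay_weight x"
proof (cases "t \<le> decay_weight x")
  case True
  have "t powr a \<le> t"
    using t ab powr_mono'[of 1 a t] by simp
  then show ?thesis using True by (smt (verit) exp_ge_zero mult_nonneg_nonneg powr_ge_zero)
next
  case False
  have t0: "0 < t" using False decay_weight_pos[of x] by linarith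
  define N where "N = exp 1 + norm x"
  have N: "0 < N" "1 \<le> ln N" unfolding N_def using one_le_exp_plus_norm[of x] one_le_ln_exp_plus[of "norm x"] by auto
  have "ln (decay_weight x) \<le> ln t" using False decay_weight_pos[of x] by (intro ln_mono) auto
  then have lt: "- ln t \<le> 2 * real CARD('n) * ln N"
    using N by (simp add: decay_weight_def N_def[symmetric] ln_powr)
  have "(a - b) * ln t \<le> \<bar>a - b\<bar> * (- ln t)"
    using t t0 by (smt (verit) ln_le_zero_iff minus_mult_minus mult_nonneg_nonpos2 mult_right_mono_neg)
  also have "\<dots> \<le> C / ln N * (2 * real CARD('n) * ln N)"
    using d lt t t0 N by (intro mult_mono) (auto simp: N_def intro: order_trans[OF abs_ge_zero])
  also have "\<dots> = 2 * real CARD('n) * C"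
  proof -
    have "C / c * (2 * real CARD('n) * c) = 2 * real CARD('n) * C" if "1 \<le> c" for c
      using that by simp
    then show ?thesis using N(2) .
  qed
  finally have "t powr (a - b) \<le> exp (2 * real CARD('n) * C)"
    using t0 by (simp add: powr_def)
  then have "t powr (a - b) * t powr b \<le> exp (2 * real CARD('n) * C) * t powr b"
    by (intro mult_right_mono) auto
  then show ?thesis using t0 decay_weight_pos[of x] by (simp flip: powr_add)
qed

text \<open>For g > th the ratio g / th exceeds 1 and grows under the power s. Integrated over a
  cube with a fixed threshold, this replaces Jensen's inequality when s varies from point to
  point.\<close>

lemma young_threshold:
  fixes g :: real
  assumes "0 \<le> g" "0 < th" "1 \<le> s"
  shows "g \<le> th + th powr (1 - s) * g powr s"
proof (cases "g \<le> th")
  case True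
  then show ?thesis by (simp add: add_increasing2)
next
  case False
  then have "g = th * (g / th) powr 1" using assms by simp
  also have "\<dots> \<le> th * (g / th) powr s"
    using False assms by (intro mult_left_mono powr_mono) auto
  also have "\<dots> = th powr (1 - s) * g powr s"
    using False assms by (simp add: powr_divide powr_diff)
  finally show ?thesis using assms by simp
qed

section \<open>Averages over cubes for a log-Hoelder exponent\<close>

locale log_holder =
  fixes s :: "real^'n::finite \<Rightarrow> real" and s_inf C R :: real
  assumes lower: "1 \<le> s x" and upper: "s x \<le> R" and C_nonneg: "0 \<le> C"
    and local: "\<bar>s x - s y\<bar> \<le> C / ln (exp 1 + 1 / norm (x - y))"
    and decay: "\<bar>s x - s_inf\<bar> \<le> C / ln (exp 1 + norm x)"
begin

lemma tendsto_at_infinity: "(s \<longlongrightarrow> s_inf) at_infinity"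
proof -
  have "filterlim (\<lambda>x::real^'n. ln (exp 1 + norm x)) at_top at_infinity"
    by (intro filterlim_compose[OF ln_at_top] filterlim_tendsto_add_at_top[OF tendsto_const]
        filterlim_norm_at_top)
  then have "((\<lambda>x::real^'n. C / ln (exp 1 + norm x)) \<longlongrightarrow> 0) at_infinity"
    by (intro tendsto_divide_0[OF tendsto_const] filterlim_at_top_imp_at_infinity)
  then have "((\<lambda>x. s x - s_inf) \<longlongrightarrow> 0) at_infinity"
    by (rule Lim_null_comparison[rotated]) (use decay in simp)
  then show ?thesis by (simp add: LIM_zero_iff)
qed

lemma ge_imp_inf_ge:
  assumes "\<And>x. m \<le> s x"
  shows "m \<le> s_inf"
  using tendsto_lowerbound[OF tendsto_at_infinity, of m] assms trivial_limit_at_infinity by auto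

lemma inf_lower: "1 \<le> s_inf"
  using ge_imp_inf_ge lower by blast

lemma inf_upper: "s_inf \<le> R"
  using tendsto_upperbound[OF tendsto_at_infinity, of R] upper trivial_limit_at_infinity by auto

text \<open>The logarithm in the local condition tends to infinity as y tends to x. Continuity gives
  Borel measurability, and later upgrades an almost-everywhere lower bound on the exponent to every
  point.\<close>

lemma continuous: "continuous_on UNIV s"
  unfolding continuous_on_eq_continuous_at[OF open_UNIV] isCont_def
proof
  fix x :: "real^'n"
  have "filterlim (\<lambda>y. norm (y - x)) (at_right 0) (at x)"
    by (intro filterlim_at_withinI tendsto_norm_zero)
      (auto simp: eventually_at_filter LIM_zero_iff)
  then have "filterlim (\<lambda>y. 1 / norm (x - y)) at_top (at x)"
    by (simp add: inverse_eq_divide[symmetric] norm_minus_commute filterlim_inverse_at_top_right[THEN filterlim_compose])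
  then have "filterlim (\<lambda>y. ln (exp 1 + 1 / norm (x - y))) at_top (at x)"
    by (intro filterlim_compose[OF ln_at_top] filterlim_tendsto_add_at_top[OF tendsto_const])
  then have "((\<lambda>y. C / ln (exp 1 + 1 / norm (x - y))) \<longlongrightarrow> 0) (at x)"
    by (intro tendsto_divide_0[OF tendsto_const] filterlim_at_top_imp_at_infinity)
  then have "((\<lambda>y. s y - s x) \<longlongrightarrow> 0) (at x)"
    by (rule Lim_null_comparison[rotated]) (use local[of x] in \<open>simp add: abs_minus_commute\<close>)
  then show "(s \<longlongrightarrow> s x) (at x)" by (simp add: LIM_zero_iff)
qed

lemma measurable_exponent [measurable]: "s \<in> borel_measurable borel"
  using continuous by (rule borel_measurable_continuous_onI)

lemma small_cube_powr:
  assumes "0 < l" "l \<le> 1" "x \<in> cube a l" "y \<in> cube a l"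
    "\<bar>\<theta>\<bar> \<le> \<bar>s x - s y\<bar>"
  shows "(l ^ CARD('n)) powr \<theta> \<le> local_const TYPE('n) C"
  by (rule small_cube_powr_bound[OF assms(1-4) C_nonneg local _ assms(5)]) simp

lemma powr_le_powr_inf:
  assumes "0 \<le> t" "t \<le> 1"
  shows "t powr s x \<le> exp (2 * real CARD('n) * C) * t powr s_inf + decay_weight x"
  using powr_exchange_decay[OF assms lower inf_lower decay] .

lemma powr_inf_le_powr:
  assumes "0 \<le> t" "t \<le> 1"
  shows "t powr s_inf \<le> exp (2 * real CARD('n) * C) * t powr s x + decay_weight x"
  using powr_exchange_decay[OF assms inf_lower lower] decay[of x] by (simp add: abs_minus_commute)

text \<open>With the threshold A^(1 / s x), passing from s y to s x costs a factor of at most A^|s x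
  - s y|. As A is at most the inverse volume of the cube, log-Hoelder continuity bounds it. The
  outcome replaces Jensen's inequality: mean of g^s at most A forces mean of g at most a constant
  times A^(1 / s x).\<close>

lemma integral_small_cube:
  assumes l: "0 < l" "l \<le> 1" and x: "x \<in> cube a l"
    and [measurable]: "g \<in> borel_measurable borel" and g: "\<And>y. 0 \<le> g y"
    and A: "1 \<le> A" "A * l ^ CARD('n) \<le> 1"
    and int: "(\<integral>\<^sup>+y\<in>cube a l. ennreal (g y powr s y) \<partial>lborel) \<le> ennreal (A * l ^ CARD('n))"
  shows "(\<integral>\<^sup>+y\<in>cube a l. ennreal (g y) \<partial>lborel)
     \<le> ennreal ((1 + local_const TYPE('n) C) * l ^ CARD('n) * A powr (1 / s x))"
proof -
  define Q where "Q = cube a l"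
  define V where "V = l ^ CARD('n)"
  define K where "K = local_const TYPE('n) C"
  define th where "th = A powr (1 / s x)"
  have V: "0 < V" using l by (simp add: V_def)
  have K: "1 \<le> K" unfolding K_def by (rule local_const_ge_1[OF C_nonneg])
  have sx: "1 \<le> s x" by (rule lower)
  have th: "0 < th" using A by (simp add: th_def)
  have th_s: "th powr s x = A" using A sx by (simp add: th_def powr_powr)
  have [measurable]: "Q \<in> sets borel" by (simp add: Q_def)
  have bd: "th powr (1 - s y) \<le> K * th powr (1 - s x)" if y: "y \<in> Q" for y
  proof -
    have "th powr (s x - s y) = A powr ((s x - s y) / s x)" by (simp add: th_def powr_powr)
    also have "\<dots> \<le> A powr (\<bar>s x - s y\<bar>)"
    proof (rule powr_mono)
      have "(s x - s y) / s x \<le> \<bar>s x - s y\<bar> / s x" using sx by (intro divide_right_mono) auto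
      also have "\<dots> \<le> \<bar>s x - s y\<bar>" using sx by (simp add: divide_le_eq mult_le_cancel_left1)
      finally show "(s x - s y) / s x \<le> \<bar>s x - s y\<bar>" .
    qed (use A in simp)
    also have "\<dots> \<le> (1 / V) powr \<bar>s x - s y\<bar>"
      using A V by (intro powr_mono2) (auto simp: V_def[symmetric] field_simps)
    also have "\<dots> = V powr (- \<bar>s x - s y\<bar>)" using V by (simp add: powr_divide powr_minus_divide)
    also have "\<dots> \<le> K"
      unfolding V_def K_def using l x y by (intro small_cube_powr[where x = x and y = y]) (auto simp: Q_def)
    finally have "th powr (s x - s y) * th powr (1 - s x) \<le> K * th powr (1 - s x)"
      by (intro mult_right_mono) auto
    then show ?thesis by (simp flip: powr_add)
  qed
  have "(\<integral>\<^sup>+y\<in>Q. ennreal (g y) \<partial>lborel) \<le> (\<integral>\<^sup>+y. ennreal th * indicator Q y +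
      ennreal (K * th powr (1 - s x)) * (ennreal (g y powr s y) * indicator Q y) \<partial>lborel)"
  proof (rule nn_integral_mono)
    fix y
    show "ennreal (g y) * indicator Q y \<le> ennreal th * indicator Q y +
      ennreal (K * th powr (1 - s x)) * (ennreal (g y powr s y) * indicator Q y)"
    proof (cases "y \<in> Q")
      case True
      have "g y \<le> th + th powr (1 - s y) * g y powr s y"
        using g th lower by (rule young_threshold)
      also have "\<dots> \<le> th + K * th powr (1 - s x) * g y powr s y"
        using bd[OF True] by (intro add_left_mono mult_right_mono) auto
      finally show ?thesis
        using True th K by (simp add: ennreal_mult[symmetric] ennreal_plus[symmetric] ennreal_leI del: ennreal_plus)
    qed simp
  qed
  also have "\<dots> = ennreal th * emeasure lborel Q +
      ennreal (K * th powr (1 - s x)) * (\<integral>\<^sup>+y\<in>Q. ennreal (g y powr s y) \<partial>lborel)"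
    by (subst nn_integral_add) (auto simp: nn_integral_cmult nn_integral_cmult_indicator)
  also have "\<dots> \<le> ennreal th * ennreal V + ennreal (K * th powr (1 - s x)) * ennreal (A * V)"
    using int l by (intro add_mono mult_left_mono) (auto simp: Q_def V_def measure_cube)
  also have "\<dots> = ennreal (th * V + K * th powr (1 - s x) * (A * V))"
    using th V K A by (simp add: ennreal_mult)
  also have "th powr (1 - s x) * A = th"
    using th by (subst th_s[symmetric]) (simp flip: powr_add)
  then have "th * V + K * th powr (1 - s x) * (A * V) = (1 + K) * V * th"
    by (simp add: algebra_simps)
  finally show ?thesis by (simp add: Q_def V_def K_def th_def)
qed

lemma integral_small_cube_le:
  assumes l: "0 < l" "l \<le> 1" and x: "x \<in> cube a l"
    and "g \<in> borel_measurable borel" "\<And>y. 0 \<le> g y"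
    and int: "(\<integral>\<^sup>+y. ennreal (g y powr s y) \<partial>lborel) \<le> 1"
  shows "(\<integral>\<^sup>+y\<in>cube a l. ennreal (g y) \<partial>lborel)
     \<le> ennreal ((1 + local_const TYPE('n) C) * (l ^ CARD('n)) powr (1 - 1 / s x))"
proof -
  have V: "0 < l ^ CARD('n)" "l ^ CARD('n) \<le> 1" using l by (auto simp: power_le_one)
  have "(\<integral>\<^sup>+y\<in>cube a l. ennreal (g y powr s y) \<partial>lborel) \<le> (\<integral>\<^sup>+y. ennreal (g y powr s y) \<partial>lborel)"
    by (intro nn_integral_mono) (auto simp: indicator_def)
  also note int
  \<comment> \<open>The choice A = 1 / |Q| turns the side condition A |Q| <= 1 into an
    equality.\<close>
  also have "1 = ennreal (1 / l ^ CARD('n) * l ^ CARD('n))"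
    using l by simp
  finally have "(\<integral>\<^sup>+y\<in>cube a l. ennreal (g y) \<partial>lborel)
     \<le> ennreal ((1 + local_const TYPE('n) C) * l ^ CARD('n) * (1 / l ^ CARD('n)) powr (1 / s x))"
    using V by (intro integral_small_cube assms) auto
  also have "(1 + local_const TYPE('n) C) * l ^ CARD('n) * (1 / l ^ CARD('n)) powr (1 / s x)
     = (1 + local_const TYPE('n) C) * (l ^ CARD('n)) powr (1 - 1 / s x)"
    using V by (simp add: powr_diff powr_divide)
  finally show ?thesis .
qed

text \<open>The summand 2 collects the threshold term and the stray 1 from the points with g > 1;
  the others come from exchanging exponents.\<close>

definition large_const :: real where
  "large_const = 2 + exp (2 * real CARD('n) * C) + decay_const TYPE('n)"

lemma large_const_ge_1: "1 \<le> large_const"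
  unfolding large_const_def using decay_const(2)[where 'n='n] exp_ge_zero[of "2 * real CARD('n) * C"] by linarith

text \<open>The threshold is |Q|^(-1 / s_inf). Where g <= 1, s_inf is exchanged for s y at the price
  of the weight; where g > 1, g <= g^(s y) holds outright. The bounded integrals left over are
  absorbed because |Q|^(1 - 1 / s_inf) \<ge> 1.\<close>

lemma integral_large_cube_le:
  assumes l: "1 \<le> l"
    and [measurable]: "g \<in> borel_measurable borel" and g: "\<And>y. 0 \<le> g y"
    and int: "(\<integral>\<^sup>+y. ennreal (g y powr s y) \<partial>lborel) \<le> 1"
  shows "(\<integral>\<^sup>+y\<in>cube a l. ennreal (g y) \<partial>lborel)
     \<le> ennreal (large_const * (l ^ CARD('n)) powr (1 - 1 / s_inf))"
proof -
  define Q where "Q = cube a l"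
  define V where "V = l ^ CARD('n)"
  define E where "E = exp (2 * real CARD('n) * C)"
  define th where "th = V powr (- 1 / s_inf)"
  have V: "1 \<le> V" using l by (simp add: V_def)
  have E: "0 < E" by (simp add: E_def)
  have th: "0 < th" using V by (simp add: th_def)
  have th_s: "th powr (1 - s_inf) = th * V"
  proof -
    have "th powr s_inf = 1 / V"
      using V inf_lower unfolding th_def powr_powr by (simp add: powr_minus_divide)
    then show ?thesis using th by (simp add: powr_diff)
  qed
  have [measurable]: "Q \<in> sets borel" by (simp add: Q_def)
  have pt: "g y \<le> th + (1 + th * V * E) * g y powr s y + th * V * decay_weight y" for y
  proof (cases "g y \<le> 1")
    case True
    have "g y \<le> th + th powr (1 - s_inf) * g y powr s_inf"
      using g th inf_lower by (rule young_threshold)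
    also have "\<dots> \<le> th + th * V * (E * g y powr s y + decay_weight y)"
      unfolding th_s E_def using powr_inf_le_powr[OF g True, of y] th V
      by (intro add_left_mono mult_left_mono) auto
    also have "\<dots> \<le> th + (1 + th * V * E) * g y powr s y + th * V * decay_weight y"
      using powr_ge_zero[of "g y" "s y"] unfolding distrib_left distrib_right mult.assoc by linarith
    finally show ?thesis .
  next
    case False
    then have "g y \<le> g y powr s y" using powr_mono[of 1 "s y" "g y"] lower[of y] by simp
    also have "\<dots> \<le> (1 + th * V * E) * g y powr s y"
      using th V E by (simp add: mult_le_cancel_right1)
    finally show ?thesis using th V decay_weight_pos[of y] by (simp add: add_increasing add_increasing2)
  qed
  have "(\<integral>\<^sup>+y\<in>Q. ennreal (g y) \<partial>lborel) \<le> (\<integral>\<^sup>+y. ennreal th * indicator Q y +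
      (ennreal (1 + th * V * E) * ennreal (g y powr s y) + ennreal (th * V) * ennreal (decay_weight y)) \<partial>lborel)"
  proof (rule nn_integral_mono)
    fix y
    show "ennreal (g y) * indicator Q y \<le> ennreal th * indicator Q y +
      (ennreal (1 + th * V * E) * ennreal (g y powr s y) + ennreal (th * V) * ennreal (decay_weight y))"
    proof (cases "y \<in> Q")
      case True
      then show ?thesis
        using pt[of y] th V E decay_weight_pos[of y]
        by (simp add: ennreal_mult[symmetric] ennreal_plus[symmetric] add_ac ennreal_leI del: ennreal_plus)
    qed simp
  qed
  also have "\<dots> = ennreal th * emeasure lborel Q +
      (ennreal (1 + th * V * E) * (\<integral>\<^sup>+y. ennreal (g y powr s y) \<partial>lborel) +
       ennreal (th * V) * (\<integral>\<^sup>+y. ennreal (decay_weight (y :: real^'n)) \<partial>lborel))"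
    by (simp add: nn_integral_add nn_integral_cmult nn_integral_cmult_indicator)
  also have "\<dots> \<le> ennreal th * ennreal V + (ennreal (1 + th * V * E) * ennreal 1 + ennreal (th * V) * ennreal (decay_const TYPE('n)))"
    using int l by (intro add_mono mult_left_mono) (auto simp: Q_def V_def measure_cube decay_const)
  also have "\<dots> = ennreal (th * V + ((1 + th * V * E) + th * V * decay_const TYPE('n)))"
    using th V E decay_const(2)[where 'n='n] by (simp add: ennreal_mult)
  also have "\<dots> \<le> ennreal (large_const * (th * V))"
  proof (rule ennreal_leI)
    have th_V: "th * V = V powr (1 - 1 / s_inf)"
      using V by (simp add: th_def powr_diff powr_minus_divide)
    also have "1 \<le> V powr (1 - 1 / s_inf)"
      using V inf_lower by (intro ge_one_powr_ge_zero) auto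
    finally have "1 \<le> th * V" by simp
    then show "th * V + ((1 + th * V * E) + th * V * decay_const TYPE('n)) \<le> large_const * (th * V)"
      by (simp add: large_const_def E_def algebra_simps)
  qed
  also have "th * V = V powr (1 - 1 / s_inf)"
    using V by (simp add: th_def powr_diff powr_minus_divide)
  finally show ?thesis by (simp add: Q_def V_def)
qed

end

subsection \<open>Fractional averages\<close>

lemma log_exponentE:
  fixes s :: "real^'n::finite \<Rightarrow> real"
  assumes "log_exponent s"
  obtains C R m where "log_holder s (exponent_at_infinity s) C R" "1 < m" "\<And>x. m \<le> s x"
proof -
  from assms obtain C1 C2 sinf where C: "0 < C1" "0 < C2"
    and loc: "\<And>x y. \<bar>s x - s y\<bar> \<le> C1 / ln (exp 1 + 1 / norm (x - y))"
    and dec: "\<And>x. \<bar>s x - sinf\<bar> \<le> C2 / ln (exp 1 + norm x)"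
    and var: "1 < fun_inf s" "fun_sup s < \<infinity>"
    unfolding log_exponent_def var_exponent_def by blast
  have eq: "exponent_at_infinity s = sinf" using dec by (intro exponent_at_infinity_eqI) blast
  obtain m where m: "1 < ereal m" "ereal m < fun_inf s" using ereal_dense2[OF var(1)] by blast
  obtain R where R: "fun_sup s < ereal R" using ereal_dense2[OF var(2)] by blast
  have ms: "m \<le> s x" for x
    using m(2) INF_lower[of x UNIV "\<lambda>x. ereal (s x)"] unfolding fun_inf_def
    by (metis UNIV_I ereal_less_eq(3) less_imp_le order_trans)
  have sR: "s x \<le> R" for x
    using R SUP_upper[of x UNIV "\<lambda>x. ereal (s x)"] unfolding fun_sup_def
    by (metis UNIV_I ereal_less_eq(3) less_imp_le order_trans)
  have "log_holder s sinf (C1 + C2) R"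
  proof
    fix x y :: "real^'n"
    show "1 \<le> s x" using ms[of x] m(1) by simp
    show "s x \<le> R" by (rule sR)
    show "0 \<le> C1 + C2" using C by simp
    have "C1 / ln (exp 1 + 1 / norm (x - y)) \<le> (C1 + C2) / ln (exp 1 + 1 / norm (x - y))"
      using C one_le_ln_exp_plus[of "1 / norm (x - y)"] by (intro divide_right_mono) auto
    then show "\<bar>s x - s y\<bar> \<le> (C1 + C2) / ln (exp 1 + 1 / norm (x - y))" using loc[of x y] by linarith
    have "C2 / ln (exp 1 + norm x) \<le> (C1 + C2) / ln (exp 1 + norm x)"
      using C one_le_ln_exp_plus[of "norm x"] by (intro divide_right_mono) auto
    then show "\<bar>s x - sinf\<bar> \<le> (C1 + C2) / ln (exp 1 + norm x)" using dec[of x] by linarith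
  qed
  with eq ms m(1) show thesis by (intro that[of "C1 + C2" R m]) auto
qed

text \<open>V^(1/r - 1/q) a factors as (V^(1/r) a)^(1 - r/q) * a^(r/q), and the first factor is at
  most K^(1 - r/q) <= K.\<close>

lemma hedberg_bound:
  fixes V a r q K :: real
  assumes V: "0 < V" and a: "0 \<le> a" and K: "V powr (1 / r) * a \<le> K" "1 \<le> K" and rq: "0 < r" "r \<le> q"
  shows "V powr (1 / r - 1 / q) * a \<le> K * a powr (r / q)"
proof (cases "a = 0")
  case False
  then have a0: "0 < a" using a by simp
  have rq1: "r / q \<le> 1" "0 \<le> r / q" using rq by auto
  have "V powr (1 / r - 1 / q) * a = (V powr (1 / r) * a) powr (1 - r / q) * a powr (r / q)"
    using V a0 rq by (simp add: powr_mult powr_powr powr_diff diff_divide_distrib right_diff_distrib)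
  also have "\<dots> \<le> K powr (1 - r / q) * a powr (r / q)"
    using K rq1 a V by (intro mult_right_mono powr_mono2) auto
  also have "\<dots> \<le> K powr 1 * a powr (r / q)"
    using K rq1 by (intro mult_right_mono powr_mono) auto
  finally show ?thesis using K by simp
qed simp

lemma powr_add_le:
  fixes a b p R :: real
  assumes "0 \<le> a" "0 \<le> b" "0 \<le> p" "p \<le> R"
  shows "(a + b) powr p \<le> 2 powr R * (a powr p + b powr p)"
proof -
  have "(a + b) powr p \<le> (2 * max a b) powr p"
    using assms by (intro powr_mono2) auto
  also have "\<dots> = 2 powr p * max a b powr p" using assms by (simp add: powr_mult)
  also have "\<dots> \<le> 2 powr R * (a powr p + b powr p)"
    using assms by (intro mult_mono powr_mono) (auto simp: max_def)
  finally show ?thesis .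
qed

lemma abs_inverse_diff_le:
  fixes u v :: real
  assumes "1 \<le> u" "1 \<le> v"
  shows "\<bar>1 / u - 1 / v\<bar> \<le> \<bar>u - v\<bar>"
proof -
  have "\<bar>1 / u - 1 / v\<bar> = \<bar>u - v\<bar> / (u * v)"
    using assms by (simp add: abs_minus_commute divide_simps abs_divide abs_mult)
  also have "\<dots> \<le> \<bar>u - v\<bar> / 1"
    using assms mult_mono[of 1 u 1 v] by (intro divide_left_mono) auto
  finally show ?thesis by simp
qed

section \<open>Pointwise estimates for fractional averages on small and large cubes\<close>

locale frac_exponents =
  r: log_holder r r_inf Cr Rr + q: log_holder q q_inf Cq Rq
  for r :: "real^'n::finite \<Rightarrow> real" and r_inf Cr Rr and q q_inf Cq Rq +
  fixes \<gamma> :: "real^'n \<Rightarrow> real" and m G :: real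
  assumes m: "1 < m" and r_ge: "m \<le> r x"
    and \<gamma>: "\<gamma> x = real CARD('n) * (1 / r x - 1 / q x)" and \<gamma>_nonneg: "0 \<le> \<gamma> x"
    and \<gamma>_le: "\<gamma> x \<le> G" and r_inf_G: "r_inf * G < real CARD('n)"
begin

definition "n = real CARD('n)"

lemma n_ge_1: "1 \<le> n" by (simp add: n_def Suc_le_eq)

lemma \<gamma>_n: "\<gamma> x / n = 1 / r x - 1 / q x"
  using n_ge_1 by (simp add: \<gamma> n_def)

lemma r_le_q: "r x \<le> q x"
proof -
  have "1 / q x \<le> 1 / r x" using \<gamma>_nonneg[of x] n_ge_1 unfolding \<gamma> n_def[symmetric] by (simp add: zero_le_mult_iff)
  then show ?thesis using r.lower[of x] q.lower[of x] by (simp add: field_simps)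
qed

lemma r_inf_le_q_inf: "r_inf \<le> q_inf"
  using tendsto_le[OF trivial_limit_at_infinity q.tendsto_at_infinity r.tendsto_at_infinity] r_le_q by auto

lemma m_le_r_inf: "m \<le> r_inf" using r.ge_imp_inf_ge r_ge by blast

text \<open>The slack in \<open>r_inf * G < n\<close>: on a cube of volume V \<ge> 1 the factor
  V^(\<gamma>(x)/n - 1/r_inf) is at most V^(-\<epsilon>), uniformly in x.\<close>

definition "\<epsilon> = 1 / r_inf - G / n"

lemma \<epsilon>_pos: "0 < \<epsilon>"
  using r_inf_G n_ge_1 r.inf_lower by (simp add: \<epsilon>_def n_def field_simps)

lemma \<gamma>_diff: "\<bar>(1 / r x - 1 / q x) - (1 / r_inf - 1 / q_inf)\<bar> \<le> (Cr + Cq) / ln (exp 1 + norm x)"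
proof -
  have "\<bar>1 / r x - 1 / r_inf\<bar> \<le> Cr / ln (exp 1 + norm x)"
    using abs_inverse_diff_le[OF r.lower r.inf_lower] r.decay order_trans by blast
  moreover have "\<bar>1 / q x - 1 / q_inf\<bar> \<le> Cq / ln (exp 1 + norm x)"
    using abs_inverse_diff_le[OF q.lower q.inf_lower] q.decay order_trans by blast
  ultimately show ?thesis unfolding add_divide_distrib by linarith
qed

lemma small_cube_term:
  assumes K: "1 \<le> K" and V: "0 < V" and a: "0 \<le> a" and aK: "V powr (1 / r x) * a \<le> K"
  shows "(V powr (\<gamma> x / n) * a) powr q x \<le> K powr Rq * a powr r x"
proof -
  have r1: "1 \<le> r x" and q1: "1 \<le> q x" by (rule r.lower, rule q.lower)
  have "V powr (\<gamma> x / n) * a \<le> K * a powr (r x / q x)"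
    unfolding \<gamma>_n using V a aK K r_le_q r1 by (intro hedberg_bound) auto
  then have "(V powr (\<gamma> x / n) * a) powr q x \<le> (K * a powr (r x / q x)) powr q x"
    using q1 a by (intro powr_mono2) auto
  also have "\<dots> = K powr q x * a powr r x" using K q1 by (simp add: powr_mult powr_powr)
  also have "\<dots> \<le> K powr Rq * a powr r x"
    using K q.upper by (intro mult_right_mono powr_mono) auto
  finally show ?thesis .
qed

text \<open>Bounds V^(\<gamma>(x)/n - \<gamma>_inf/n) as long as \<epsilon> ln V <= 2 n ln (e +
  |x|): the exponent difference is at most (Cr + Cq) / ln (e + |x|).\<close>

definition "large_factor = exp (2 * n / \<epsilon> * (Cr + Cq))"

text \<open>The hypothesis on a fits Hedberg's inequality for the limiting exponents only, so
  \<gamma>(x) must be traded for its limit. This is possible while V^\<epsilon> is at most (e +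
  |x|)^(2n); for larger V the crude bound with V^(-\<epsilon>) already beats the weight.\<close>

lemma large_cube_term:
  assumes K: "1 \<le> K" and V: "1 \<le> V" and a: "0 \<le> a" and aK: "V powr (1 / r_inf) * a \<le> K"
  shows "(V powr (\<gamma> x / n) * a) powr q x
    \<le> (large_factor * K * K) powr Rq * (exp (2 * n * Cq) * a powr r_inf + decay_weight x)"
proof -
  define N where "N = exp 1 + norm x"
  have N: "1 \<le> N" "1 \<le> ln N" unfolding N_def using one_le_exp_plus_norm[of x] one_le_ln_exp_plus[of "norm x"] by auto
  have w: "decay_weight x = N powr (- 2 * n)" by (simp add: decay_weight_def N_def n_def)
  have q1: "1 \<le> q x" and ri: "1 \<le> r_inf" and qi: "1 \<le> q_inf"
    by (rule q.lower, rule r.inf_lower, rule q.inf_lower)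
  have L1: "1 \<le> large_factor"
    unfolding large_factor_def using n_ge_1 \<epsilon>_pos r.C_nonneg q.C_nonneg by simp
  have LKK: "K \<le> large_factor * K * K" "1 \<le> large_factor * K * K"
  proof -
    have "1 * 1 * K \<le> large_factor * K * K" using L1 K by (intro mult_mono) auto
    then show le: "K \<le> large_factor * K * K" by simp
    show "1 \<le> large_factor * K * K" using K le by linarith
  qed
  show ?thesis
  proof (cases "V powr \<epsilon> \<le> N powr (2 * n)")
    case True
    have lnV: "\<epsilon> * ln V \<le> 2 * n * ln N"
      using True V N by (simp add: powr_def)
    define d where "d = (1 / r x - 1 / q x) - (1 / r_inf - 1 / q_inf)"
    have "d * ln V \<le> \<bar>d\<bar> * ln V" using V by (intro mult_right_mono) auto
    also have "\<dots> \<le> (Cr + Cq) / ln N * (2 * n / \<epsilon> * ln N)"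
      using \<gamma>_diff[of x] lnV \<epsilon>_pos V N
      by (intro mult_mono) (auto simp: d_def N_def field_simps intro: order_trans[OF abs_ge_zero])
    also have "\<dots> = 2 * n / \<epsilon> * (Cr + Cq)"
    proof -
      have "(Cr + Cq) / c * (2 * n / \<epsilon> * c) = 2 * n / \<epsilon> * (Cr + Cq)" if "1 \<le> c" for c
        using that by simp
      then show ?thesis using N(2) .
    qed
    finally have Vd: "V powr d \<le> large_factor"
      using V by (simp add: powr_def large_factor_def)
    \<comment> \<open>Hedberg at infinity leaves K * t, where t may reach K. Writing this as K * K *
      (t / K) produces a base t / K at most 1, as the exchange of q x for q_inf requires.\<close>
    define t where "t = a powr (r_inf / q_inf)"
    have t0: "0 \<le> t" by (simp add: t_def)
    have "V powr (\<gamma> x / n) * a = V powr d * (V powr (1 / r_inf - 1 / q_inf) * a)"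
      unfolding \<gamma>_n d_def using V by (simp add: mult.assoc[symmetric] flip: powr_add)
    also have "\<dots> \<le> large_factor * (K * t)"
      unfolding t_def using Vd V a aK K r_inf_le_q_inf ri L1
      by (intro mult_mono hedberg_bound) auto
    finally have A1: "V powr (\<gamma> x / n) * a \<le> large_factor * (K * t)" .
    have "1 * a \<le> V powr (1 / r_inf) * a"
      using V ri a by (intro mult_right_mono ge_one_powr_ge_zero) auto
    then have "a \<le> K" using aK by simp
    then have "t \<le> K powr (r_inf / q_inf)" unfolding t_def using a ri qi by (intro powr_mono2) auto
    also have "\<dots> \<le> K powr 1" using K r_inf_le_q_inf ri qi by (intro powr_mono) auto
    finally have tK: "t / K \<le> 1" using K by simp
    have "(V powr (\<gamma> x / n) * a) powr q x \<le> (large_factor * K * K * (t / K)) powr q x"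
      using A1 q1 a K by (intro powr_mono2) auto
    also have "\<dots> = (large_factor * K * K) powr q x * (t / K) powr q x"
      by (rule powr_mult)
    also have "\<dots> \<le> (large_factor * K * K) powr Rq * (exp (2 * n * Cq) * (t / K) powr q_inf + decay_weight x)"
      using q.powr_le_powr_inf[of "t / K" x] tK t0 K LKK q.upper[of x]
      by (intro mult_mono powr_mono) (auto simp: n_def)
    also have "\<dots> \<le> (large_factor * K * K) powr Rq * (exp (2 * n * Cq) * a powr r_inf + decay_weight x)"
    proof -
      have "(t / K) powr q_inf \<le> t powr q_inf" using t0 K qi by (intro powr_mono2) (auto simp: divide_le_eq mult_le_cancel_left1)
      also have "\<dots> = a powr r_inf" using qi by (simp add: t_def powr_powr)
      finally show ?thesis by (intro mult_left_mono add_right_mono) auto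
    qed
    finally show ?thesis .
  next
    \<comment> \<open>Now V^(-\<epsilon>) lies below the decay weight, so the whole term is absorbed
      by the weight; its power q x \<ge> 1 is harmless because the weight is at most 1.\<close>
    case False
    have "V powr (\<gamma> x / n) * a = V powr (\<gamma> x / n - 1 / r_inf) * (V powr (1 / r_inf) * a)"
      using V by (simp add: mult.assoc[symmetric] flip: powr_add)
    also have "\<dots> \<le> V powr (- \<epsilon>) * K"
    proof (intro mult_mono powr_mono)
      have "\<gamma> x / n \<le> G / n" using \<gamma>_le n_ge_1 by (intro divide_right_mono) auto
      then show "\<gamma> x / n - 1 / r_inf \<le> - \<epsilon>" unfolding \<epsilon>_def by linarith
    qed (use V aK a K in auto)
    also have "\<dots> \<le> decay_weight x * K"
    proof (rule mult_right_mono)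
      have "1 / V powr \<epsilon> \<le> 1 / N powr (2 * n)" using False V N by (intro divide_left_mono mult_pos_pos) auto
      then show "V powr (- \<epsilon>) \<le> decay_weight x" by (simp add: w powr_minus_divide)
    qed (use K in auto)
    finally have "(V powr (\<gamma> x / n) * a) powr q x \<le> (decay_weight x * K) powr q x"
      using q1 a by (intro powr_mono2) auto
    also have "\<dots> = decay_weight x powr q x * K powr q x"
      by (rule powr_mult)
    also have "\<dots> \<le> decay_weight x powr 1 * (large_factor * K * K) powr Rq"
    proof (intro mult_mono)
      show "decay_weight x powr q x \<le> decay_weight x powr 1"
        using decay_weight_pos[of x] decay_weight_le_1[of x] q1 by (intro powr_mono') auto
      have "K powr q x \<le> K powr Rq" using K q.upper by (intro powr_mono) auto
      also have "\<dots> \<le> (large_factor * K * K) powr Rq"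
        using LKK K q1 q.upper[of x] by (intro powr_mono2) auto
      finally show "K powr q x \<le> (large_factor * K * K) powr Rq" .
    qed auto
    also have "\<dots> \<le> (large_factor * K * K) powr Rq * (exp (2 * n * Cq) * a powr r_inf + decay_weight x)"
    proof -
      have "decay_weight x powr 1 \<le> exp (2 * n * Cq) * a powr r_inf + decay_weight x"
        using decay_weight_pos[of x] by simp
      then show ?thesis by (subst mult.commute) (intro mult_left_mono, auto)
    qed
    finally show ?thesis .
  qed
qed

text \<open>Applying \<open>integral_small_cube\<close> to r/m leads to the m-th power of a mean of
  g^(r/m), and m > 1 is a constant exponent for which the maximal theorem holds. The locale asks
  only for 1 <= s, which m <= r guarantees.\<close>

lemma scaled_log_holder: "log_holder (\<lambda>x. r x / m) (r_inf / m) Cr Rr"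
proof
  fix x y
  have le: "z / m \<le> z" if "0 \<le> z" for z
    using that m by (simp add: divide_le_eq mult_le_cancel_left1)
  show "1 \<le> r x / m" using m r_ge[of x] by simp
  show "r x / m \<le> Rr" using le[of "r x"] r.lower[of x] r.upper[of x] by linarith
  show "0 \<le> Cr" by (rule r.C_nonneg)
  have "\<bar>r x / m - r y / m\<bar> = \<bar>r x - r y\<bar> / m" using m by (simp flip: diff_divide_distrib)
  then show "\<bar>r x / m - r y / m\<bar> \<le> Cr / ln (exp 1 + 1 / norm (x - y))"
    using le[of "\<bar>r x - r y\<bar>"] r.local[of x y] by simp
  have "\<bar>r x / m - r_inf / m\<bar> = \<bar>r x - r_inf\<bar> / m" using m by (simp flip: diff_divide_distrib)
  then show "\<bar>r x / m - r_inf / m\<bar> \<le> Cr / ln (exp 1 + norm x)"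
    using le[of "\<bar>r x - r_inf\<bar>"] r.decay[of x] by simp
qed

end

text \<open>The second form is for cubes on which the mean is at most 1: there the maximal function
  may be capped, since \<open>max_fun_const\<close> is at least 1.\<close>

lemma cube_average_powr_le_max_fun:
  fixes a :: "real^'n::finite" and h :: "real^'n \<Rightarrow> ennreal"
  assumes l: "0 < l" and x: "x \<in> cube a l" and p: "0 \<le> p" "p \<le> R"
    and J: "(\<integral>\<^sup>+y\<in>cube a l. h y \<partial>lborel) = ennreal J" "0 \<le> J"
  shows "ennreal ((J / l ^ CARD('n)) powr p)
      \<le> ennreal (max_fun_const TYPE('n) powr R) * ennreal_powr (max_fun h x) p"
    and "J \<le> l ^ CARD('n) \<Longrightarrow> ennreal ((J / l ^ CARD('n)) powr p)
      \<le> ennreal (max_fun_const TYPE('n) powr R) * ennreal_powr (min 1 (max_fun h x)) p"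
proof -
  define M where "M = max_fun_const TYPE('n)"
  define V where "V = l ^ CARD('n)"
  have V: "0 < V" using l by (simp add: V_def)
  have M: "1 \<le> M" unfolding M_def by (rule max_fun_const_ge_1)
  have "ennreal J \<le> ennreal (M * V) * max_fun h x"
    unfolding J(1)[symmetric] M_def V_def using l x by (rule cube_integral_le_max_fun)
  then have "ennreal (1 / V) * ennreal J \<le> ennreal (1 / V) * (ennreal (M * V) * max_fun h x)"
    by (intro mult_left_mono) auto
  then have avg: "ennreal (J / V) \<le> ennreal M * max_fun h x"
    using V M J(2) by (simp add: ennreal_mult[symmetric] mult.assoc[symmetric])
  have step: "ennreal ((J / V) powr p) \<le> ennreal (M powr R) * ennreal_powr u p"
    if "ennreal (J / V) \<le> ennreal M * u" for u
  proof -
    have "ennreal ((J / V) powr p) = ennreal_powr (ennreal (J / V)) p"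
      using J(2) V by (simp add: ennreal_powr_ennreal)
    also have "\<dots> \<le> ennreal_powr (ennreal M * u) p" using that p(1) by (rule ennreal_powr_mono)
    also have "\<dots> = ennreal (M powr p) * ennreal_powr u p" using M by (intro ennreal_powr_mult) simp
    also have "\<dots> \<le> ennreal (M powr R) * ennreal_powr u p"
      using M p by (intro mult_right_mono ennreal_leI powr_mono) auto
    finally show ?thesis .
  qed
  show "ennreal ((J / l ^ CARD('n)) powr p)
      \<le> ennreal (max_fun_const TYPE('n) powr R) * ennreal_powr (max_fun h x) p"
    using step[OF avg] by (simp add: M_def V_def)
  assume "J \<le> l ^ CARD('n)"
  then have "J / V \<le> M" using V M by (simp add: V_def[symmetric] divide_le_eq mult_le_cancel_right1 order_trans)
  then have "ennreal (J / V) \<le> ennreal M * min 1 (max_fun h x)"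
    using avg M by (auto simp: min_def ennreal_leI)
  from step[OF this] show "ennreal ((J / l ^ CARD('n)) powr p)
      \<le> ennreal (max_fun_const TYPE('n) powr R) * ennreal_powr (min 1 (max_fun h x)) p"
    by (simp add: M_def V_def)
qed

section \<open>A measurable majorant valid for all cubes at once\<close>

context frac_exponents
begin

definition "K\<^sub>0 = 1 + local_const TYPE('n) Cr + r.large_const"

lemma K0: "1 \<le> K\<^sub>0" "1 + local_const TYPE('n) Cr \<le> K\<^sub>0" "r.large_const \<le> K\<^sub>0"
  using local_const_ge_1[OF r.C_nonneg, where 'n='n] r.large_const_ge_1 by (auto simp: K\<^sub>0_def)

definition "D\<^sub>s = K\<^sub>0 powr Rq * (2 powr Rr * (K\<^sub>0 powr Rr + exp (2 * n * Cr) + 1))"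
definition "D\<^sub>l = (large_factor * K\<^sub>0 * K\<^sub>0) powr Rq * (exp (2 * n * Cq) * 2 powr Rr + 1)"

lemma D_nonneg: "0 \<le> D\<^sub>s" "0 \<le> D\<^sub>l"
  by (simp_all add: D\<^sub>s_def D\<^sub>l_def)

text \<open>Nonzero values of \<open>g1\<close> are at least 1, so raising its exponent increases
  it; values of \<open>g2\<close> are at most 1, the range in which exponents can be exchanged at
  infinity.\<close>

context
  fixes g g1 g2 :: "real^'n \<Rightarrow> real"
  assumes g_meas [measurable]: "g \<in> borel_measurable borel" and g_nonneg: "\<And>y. 0 \<le> g y"
    and g_int: "(\<integral>\<^sup>+y. ennreal (g y powr r y) \<partial>lborel) \<le> 1"
  defines "g1 \<equiv> \<lambda>y. if 1 \<le> g y then g y else 0"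
    and "g2 \<equiv> \<lambda>y. if 1 \<le> g y then 0 else g y"
begin

lemma g12_meas [measurable]: "g1 \<in> borel_measurable borel" "g2 \<in> borel_measurable borel"
  unfolding g1_def g2_def by measurable

lemma g12: "0 \<le> g1 y" "0 \<le> g2 y" "g2 y \<le> 1" "g y = g1 y + g2 y" "g1 y powr r y \<le> g y powr r y"
    "g2 y powr r y \<le> g y powr r y"
  using g_nonneg[of y] by (auto simp: g1_def g2_def)

lemma g1_powr_mono: "u \<le> v \<Longrightarrow> g1 y powr u \<le> g1 y powr v"
  by (auto simp: g1_def powr_mono)

lemma g1_le_powr: "1 \<le> u \<Longrightarrow> g1 y \<le> g1 y powr u"
  using g1_powr_mono[of 1 u y] g12(1)[of y] by simp

text \<open>Each summand has its own task: the first handles g1 on small cubes, the second g2 on all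
  cubes, the third g1 on large cubes, and the weight collects the errors from exchanging exponents.
  None of them depends on the cube.\<close>

lemma cube_term:
  assumes l: "0 < l" and x: "x \<in> cube a l"
  shows "ennreal_powr (ennreal ((l ^ CARD('n)) powr (\<gamma> x / n - 1)) *
      (\<integral>\<^sup>+y\<in>cube a l. ennreal (g y) \<partial>lborel)) (q x)
    \<le> ennreal ((D\<^sub>s + D\<^sub>l) * max_fun_const TYPE('n) powr Rr) *
       (ennreal_powr (max_fun (\<lambda>y. ennreal (g1 y powr (r y / m))) x) m
        + ennreal_powr (max_fun (\<lambda>y. ennreal (g2 y)) x) r_inf
        + ennreal_powr (min 1 (max_fun (\<lambda>y. ennreal (g1 y)) x)) r_inf
        + ennreal (decay_weight x))"
proof -
  define Q where "Q = cube a l"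
  define V where "V = l ^ CARD('n)"
  define M where "M = max_fun_const TYPE('n)"
  have [measurable]: "Q \<in> sets borel" by (simp add: Q_def)
  have V: "0 < V" using l by (simp add: V_def)
  have M: "1 \<le> M" unfolding M_def by (rule max_fun_const_ge_1)
  have rx: "1 \<le> r x" "r x \<le> Rr" "m \<le> r x" by (rule r.lower, rule r.upper, rule r_ge)
  have ri: "1 \<le> r_inf" "r_inf \<le> Rr" by (rule r.inf_lower, rule r.inf_upper)
  have mR: "m \<le> Rr" using rx by linarith
  have qx: "1 \<le> q x" by (rule q.lower)
  let ?I = "\<lambda>h. \<integral>\<^sup>+y\<in>Q. ennreal (h y) \<partial>lborel"
  have small_le: "?I g \<le> ennreal (K\<^sub>0 * V powr (1 - 1 / r x))" if "l \<le> 1"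
  proof -
    have "?I g \<le> ennreal ((1 + local_const TYPE('n) Cr) * V powr (1 - 1 / r x))"
      unfolding Q_def V_def using l that x g_meas g_nonneg g_int by (rule r.integral_small_cube_le)
    also have "\<dots> \<le> ennreal (K\<^sub>0 * V powr (1 - 1 / r x))"
      using K0 by (intro ennreal_leI mult_right_mono) auto
    finally show ?thesis .
  qed
  have large_le: "?I g \<le> ennreal (K\<^sub>0 * V powr (1 - 1 / r_inf))" if "1 \<le> l"
  proof -
    have "?I g \<le> ennreal (r.large_const * V powr (1 - 1 / r_inf))"
      unfolding Q_def V_def using that g_meas g_nonneg g_int by (rule r.integral_large_cube_le)
    also have "\<dots> \<le> ennreal (K\<^sub>0 * V powr (1 - 1 / r_inf))"
      using K0 by (intro ennreal_leI mult_right_mono) auto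
    finally show ?thesis .
  qed
  \<comment> \<open>Finiteness allows all averages to be treated as real numbers from here
    on.\<close>
  have "?I g < \<infinity>"
    using small_le large_le by (cases "l \<le> 1") (auto intro: order_le_less_trans)
  moreover have add: "?I g = ?I g1 + ?I g2"
    by (subst nn_integral_add[symmetric]) (auto simp: g12(4) ennreal_plus[OF g12(1,2)] distrib_right intro!: nn_integral_cong)
  ultimately obtain I1 I2 where I: "?I g1 = ennreal I1" "?I g2 = ennreal I2" "0 \<le> I1" "0 \<le> I2"
    by (cases "?I g1"; cases "?I g2") auto
  have G1_r: "ennreal (g1 y powr (r y / m)) \<le> ennreal (g y powr r y)" for y
  proof (rule ennreal_leI)
    have "r y / m \<le> r y" using m r.lower[of y] by (simp add: divide_le_eq mult_le_cancel_left1)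
    from g1_powr_mono[OF this, of y] show "g1 y powr (r y / m) \<le> g y powr r y" using g12(5)[of y] by linarith
  qed
  have "?I (\<lambda>y. g1 y powr (r y / m)) \<le> (\<integral>\<^sup>+y. ennreal (g y powr r y) \<partial>lborel)"
    using G1_r by (intro nn_integral_mono) (auto simp: indicator_def)
  with g_int have "?I (\<lambda>y. g1 y powr (r y / m)) \<le> 1" by (rule order_trans[rotated])
  then obtain J where J: "?I (\<lambda>y. g1 y powr (r y / m)) = ennreal J" "0 \<le> J" "J \<le> 1"
    by (cases "?I (\<lambda>y. g1 y powr (r y / m))") (auto simp: top_unique)
  have "?I g1 \<le> (\<integral>\<^sup>+y. ennreal (g y powr r y) \<partial>lborel)"
    using g12(5) g1_le_powr[OF r.lower]
    by (intro nn_integral_mono) (auto simp: indicator_def intro!: ennreal_leI intro: order_trans)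
  with g_int have "?I g1 \<le> 1" by (rule order_trans[rotated])
  then have I1_1: "I1 \<le> 1" using I by simp
  have "?I g1 \<le> ?I (\<lambda>y. g1 y powr (r y / m))"
  proof (intro nn_integral_mono mult_right_mono ennreal_leI)
    fix y
    have "1 \<le> r y / m" using m r_ge[of y] by simp
    then show "g1 y \<le> g1 y powr (r y / m)" by (rule g1_le_powr)
  qed auto
  then have I1_J: "I1 \<le> J" using I J by simp
  have "?I g2 \<le> (\<integral>\<^sup>+y. 1 * indicator Q y \<partial>lborel)"
    using g12(3) by (intro nn_integral_mono mult_right_mono) auto
  also have "\<dots> = ennreal V"
    using measure_cube(2)[OF l, of a] by (simp add: Q_def V_def)
  finally have I2_V: "I2 \<le> V" using I V by simp
  define a0 a1 a2 A where "a0 = (I1 + I2) / V" and "a1 = I1 / V" and "a2 = I2 / V" and "A = J / V"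
  have a: "0 \<le> a0" "0 \<le> a1" "0 \<le> a2" "0 \<le> A" "a0 = a1 + a2" "a2 \<le> 1" "a1 \<le> A"
    using V I J I2_V I1_J by (auto simp: a0_def a1_def a2_def A_def add_divide_distrib divide_right_mono)
  have Ig: "?I g = ennreal (V * a0)" using add I V by (simp add: a0_def)
  have lhs: "ennreal_powr (ennreal (V powr (\<gamma> x / n - 1)) * ?I g) (q x)
      = ennreal ((V powr (\<gamma> x / n) * a0) powr q x)"
    unfolding Ig using V a(1)
    by (simp add: ennreal_powr_ennreal powr_diff flip: ennreal_mult)
  define X1 X2 X3 where
    "X1 = ennreal_powr (max_fun (\<lambda>y. ennreal (g1 y powr (r y / m))) x) m" and
    "X2 = ennreal_powr (max_fun (\<lambda>y. ennreal (g2 y)) x) r_inf" and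
    "X3 = ennreal_powr (min 1 (max_fun (\<lambda>y. ennreal (g1 y)) x)) r_inf"
  have X1: "ennreal (A powr m) \<le> ennreal (M powr Rr) * X1"
    unfolding A_def V_def X1_def M_def using J m mR l x unfolding Q_def
    by (intro cube_average_powr_le_max_fun(1)[where a = a]) auto
  have X2: "ennreal (a2 powr r_inf) \<le> ennreal (M powr Rr) * X2"
    unfolding a2_def V_def X2_def M_def using I ri l x unfolding Q_def
    by (intro cube_average_powr_le_max_fun(1)[where a = a]) auto
  have X3: "ennreal (a1 powr r_inf) \<le> ennreal (M powr Rr) * X3" if "1 \<le> l"
  proof -
    \<comment> \<open>The total integral of g1 is at most 1 <= V, so its mean is at most 1 and the
      capped form applies.\<close>
    have "1 \<le> V" using that by (simp add: V_def)
    then have "I1 \<le> l ^ CARD('n)" using I1_1 by (simp add: V_def)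
    then show ?thesis
      unfolding a1_def V_def X3_def M_def using I ri l x unfolding Q_def
      by (intro cube_average_powr_le_max_fun(2)[where a = a]) auto
  qed
  have w: "0 \<le> decay_weight x" using decay_weight_pos[of x] by simp
  have M1: "1 \<le> M powr Rr" using M rx by (intro ge_one_powr_ge_zero) auto
  have X4: "ennreal (decay_weight x) \<le> ennreal (M powr Rr) * ennreal (decay_weight x)"
    using M1 w by (simp add: mult_le_cancel_right1 flip: ennreal_mult)
  have "ennreal ((V powr (\<gamma> x / n) * a0) powr q x)
      \<le> ennreal (D\<^sub>s + D\<^sub>l) * (ennreal (M powr Rr) * (X1 + X2 + X3 + ennreal (decay_weight x)))"
  proof (cases "l \<le> 1")
    case True
    have "ennreal (V * a0) \<le> ennreal (K\<^sub>0 * V powr (1 - 1 / r x))" using small_le[OF True] Ig by simp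
    then have "V * a0 \<le> K\<^sub>0 * V powr (1 - 1 / r x)" using K0(1) by (simp add: ennreal_le_iff)
    then have "V powr (1 / r x) * a0 \<le> K\<^sub>0"
      using V by (simp add: powr_diff field_simps)
    then have "(V powr (\<gamma> x / n) * a0) powr q x \<le> K\<^sub>0 powr Rq * a0 powr r x"
      using K0(1) V a(1) by (intro small_cube_term)
    also have "a0 powr r x \<le> 2 powr Rr * (a1 powr r x + a2 powr r x)"
      unfolding a(5) using a rx by (intro powr_add_le) auto
    also have "a1 powr r x \<le> K\<^sub>0 powr Rr * A powr m"
    \<comment> \<open>The Jensen substitute requires A \<ge> 1. For A < 1 it is dispensable: a1 <=
      A, and m <= r x gives A^(r x) <= A^m.\<close>
    proof (cases "1 \<le> A")
      case A1: True
      interpret s: log_holder "\<lambda>x. r x / m" "r_inf / m" Cr Rr by (rule scaled_log_holder)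
      have "?I g1 \<le> ennreal ((1 + local_const TYPE('n) Cr) * V * A powr (1 / (r x / m)))"
        unfolding Q_def V_def
      proof (rule s.integral_small_cube[OF l True x])
        have "A * V = J" using V by (simp add: A_def)
        then show "A * l ^ CARD('n) \<le> 1" using J by (simp add: V_def)
        show "(\<integral>\<^sup>+y\<in>cube a l. ennreal (g1 y powr (r y / m)) \<partial>lborel) \<le> ennreal (A * l ^ CARD('n))"
          using J \<open>A * V = J\<close> by (simp add: Q_def V_def)
      qed (use A1 g12 in auto)
      also have "\<dots> \<le> ennreal (K\<^sub>0 * V * A powr (m / r x))"
        using K0 V by (intro ennreal_leI) (simp add: mult_right_mono)
      finally have "I1 \<le> K\<^sub>0 * V * A powr (m / r x)" using I K0 V by (simp add: ennreal_le_iff)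
      then have "a1 \<le> K\<^sub>0 * A powr (m / r x)" using V by (simp add: a1_def field_simps)
      then have "a1 powr r x \<le> (K\<^sub>0 * A powr (m / r x)) powr r x" using a rx by (intro powr_mono2) auto
      also have "\<dots> = K\<^sub>0 powr r x * A powr m" using K0 rx by (simp add: powr_mult powr_powr)
      also have "\<dots> \<le> K\<^sub>0 powr Rr * A powr m" using K0 rx by (intro mult_right_mono powr_mono) auto
      finally show ?thesis .
    next
      case False
      have "a1 powr r x \<le> A powr r x" using a rx by (intro powr_mono2) auto
      also have "\<dots> \<le> A powr m" using a False rx by (intro powr_mono') auto
      also have "\<dots> \<le> K\<^sub>0 powr Rr * A powr m"
        using K0 rx ge_one_powr_ge_zero[of K\<^sub>0 Rr] by (simp add: mult_le_cancel_right1)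
      finally show ?thesis .
    qed
    also have "a2 powr r x \<le> exp (2 * n * Cr) * a2 powr r_inf + decay_weight x"
      unfolding n_def using a by (intro r.powr_le_powr_inf) auto
    finally have "(V powr (\<gamma> x / n) * a0) powr q x \<le> K\<^sub>0 powr Rq * (2 powr Rr *
        (K\<^sub>0 powr Rr * A powr m + (exp (2 * n * Cr) * a2 powr r_inf + decay_weight x)))"
      by (simp add: mult_left_mono)
    also have "\<dots> \<le> D\<^sub>s * (A powr m + a2 powr r_inf + decay_weight x)"
    proof -
      have "K\<^sub>0 powr Rr * A powr m + (exp (2 * n * Cr) * a2 powr r_inf + decay_weight x)
         \<le> (K\<^sub>0 powr Rr + exp (2 * n * Cr) + 1) * (A powr m + a2 powr r_inf + decay_weight x)"
        using w by (simp add: algebra_simps)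
      then show ?thesis unfolding D\<^sub>s_def mult.assoc by (intro mult_left_mono) auto
    qed
    also have "\<dots> \<le> (D\<^sub>s + D\<^sub>l) * (A powr m + a2 powr r_inf + decay_weight x)"
      using D_nonneg w by (intro mult_right_mono) auto
    finally have "ennreal ((V powr (\<gamma> x / n) * a0) powr q x)
      \<le> ennreal (D\<^sub>s + D\<^sub>l) * (ennreal (A powr m) + ennreal (a2 powr r_inf) + ennreal (decay_weight x))"
      using D_nonneg w by (simp add: ennreal_mult[symmetric] ennreal_plus[symmetric] ennreal_leI del: ennreal_plus)
    also have "\<dots> \<le> ennreal (D\<^sub>s + D\<^sub>l) * (ennreal (M powr Rr) * X1 + ennreal (M powr Rr) * X2 + ennreal (M powr Rr) * ennreal (decay_weight x))"
      using X1 X2 X4 by (intro mult_left_mono add_mono) auto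
    also have "\<dots> \<le> ennreal (D\<^sub>s + D\<^sub>l) * (ennreal (M powr Rr) * (X1 + X2 + X3 + ennreal (decay_weight x)))"
    proof -
      have "X1 + X2 + ennreal (decay_weight x) \<le> X1 + X2 + X3 + ennreal (decay_weight x)"
        by (intro add_right_mono) simp
      then show ?thesis unfolding distrib_left[symmetric] by (intro mult_left_mono) auto
    qed
    finally show ?thesis .
  next
    case False
    then have l1: "1 \<le> l" by simp
    have "ennreal (V * a0) \<le> ennreal (K\<^sub>0 * V powr (1 - 1 / r_inf))" using large_le[OF l1] Ig by simp
    then have "V * a0 \<le> K\<^sub>0 * V powr (1 - 1 / r_inf)" using K0(1) by (simp add: ennreal_le_iff)
    then have "V powr (1 / r_inf) * a0 \<le> K\<^sub>0"
      using V by (simp add: powr_diff field_simps)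
    moreover have "1 \<le> V" using l1 by (simp add: V_def)
    ultimately have "(V powr (\<gamma> x / n) * a0) powr q x
        \<le> (large_factor * K\<^sub>0 * K\<^sub>0) powr Rq * (exp (2 * n * Cq) * a0 powr r_inf + decay_weight x)"
      using K0(1) a(1) by (intro large_cube_term)
    also have "a0 powr r_inf \<le> 2 powr Rr * (a1 powr r_inf + a2 powr r_inf)"
      unfolding a(5) using a ri by (intro powr_add_le) auto
    finally have "(V powr (\<gamma> x / n) * a0) powr q x \<le> (large_factor * K\<^sub>0 * K\<^sub>0) powr Rq *
        (exp (2 * n * Cq) * (2 powr Rr * (a1 powr r_inf + a2 powr r_inf)) + decay_weight x)"
      by (simp add: mult_left_mono)
    also have "\<dots> \<le> D\<^sub>l * (a2 powr r_inf + a1 powr r_inf + decay_weight x)"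
    proof -
      have "exp (2 * n * Cq) * (2 powr Rr * (a1 powr r_inf + a2 powr r_inf)) + decay_weight x
         \<le> (exp (2 * n * Cq) * 2 powr Rr + 1) * (a2 powr r_inf + a1 powr r_inf + decay_weight x)"
        using w by (simp add: algebra_simps)
      then show ?thesis unfolding D\<^sub>l_def mult.assoc by (intro mult_left_mono) auto
    qed
    also have "\<dots> \<le> (D\<^sub>s + D\<^sub>l) * (a2 powr r_inf + a1 powr r_inf + decay_weight x)"
      using D_nonneg w by (intro mult_right_mono) auto
    finally have "ennreal ((V powr (\<gamma> x / n) * a0) powr q x)
      \<le> ennreal (D\<^sub>s + D\<^sub>l) * (ennreal (a2 powr r_inf) + ennreal (a1 powr r_inf) + ennreal (decay_weight x))"
      using D_nonneg w by (simp add: ennreal_mult[symmetric] ennreal_plus[symmetric] ennreal_leI del: ennreal_plus)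
    also have "\<dots> \<le> ennreal (D\<^sub>s + D\<^sub>l) * (ennreal (M powr Rr) * X2 + ennreal (M powr Rr) * X3 + ennreal (M powr Rr) * ennreal (decay_weight x))"
      using X2 X3[OF l1] X4 by (intro mult_left_mono add_mono) auto
    also have "\<dots> \<le> ennreal (D\<^sub>s + D\<^sub>l) * (ennreal (M powr Rr) * (X1 + X2 + X3 + ennreal (decay_weight x)))"
      unfolding distrib_left[symmetric] by (intro mult_left_mono add_mono) (auto simp: add.assoc add_increasing)
    finally show ?thesis .
  qed
  then show ?thesis
    using D_nonneg unfolding Q_def[symmetric] V_def[symmetric] lhs
    by (simp add: X1_def X2_def X3_def M_def ennreal_mult mult.assoc)
qed

text \<open>Each maximal function now carries a constant exponent. The m-th power of g1^(r/m) is
  g1^r; g2^r_inf is exchanged for g^r plus the weight; for the capped term g1 <= g1^r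
  suffices.\<close>

lemma majorant_integral:
  "(\<integral>\<^sup>+x. (ennreal_powr (max_fun (\<lambda>y. ennreal (g1 y powr (r y / m))) x) m
        + ennreal_powr (max_fun (\<lambda>y. ennreal (g2 y)) x) r_inf
        + ennreal_powr (min 1 (max_fun (\<lambda>y. ennreal (g1 y)) x)) r_inf
        + ennreal (decay_weight x)) \<partial>lborel)
    \<le> ennreal (2 * 5 ^ CARD('n) * m * 2 powr (m - 1) / (m - 1)
        + 2 * 5 ^ CARD('n) * r_inf * 2 powr (r_inf - 1) / (r_inf - 1) * (exp (2 * n * Cr) + decay_const TYPE('n))
        + 5 ^ CARD('n) * r_inf / (r_inf - 1) + decay_const TYPE('n))"
    (is "_ \<le> ennreal (?c1 + ?c2 * ?e + ?c3 + ?c4)")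
proof -
  have ri: "1 < r_inf" using m m_le_r_inf by linarith
  have c: "0 \<le> ?c1" "0 \<le> ?c2" "0 \<le> ?c3" "0 \<le> ?c4" "0 \<le> ?e"
    using m ri decay_const(2)[where 'n='n] by auto
  have "(\<integral>\<^sup>+x. ennreal_powr (max_fun (\<lambda>y. ennreal (g1 y powr (r y / m))) x) m \<partial>lborel)
      \<le> ennreal ?c1 * (\<integral>\<^sup>+x. ennreal ((g1 x powr (r x / m)) powr m) \<partial>lborel)"
    using max_fun_powr_bound[of "\<lambda>y. g1 y powr (r y / m)" m] m by simp
  also have "(\<integral>\<^sup>+x. ennreal ((g1 x powr (r x / m)) powr m) \<partial>lborel) \<le> (\<integral>\<^sup>+y. ennreal (g y powr r y) \<partial>lborel)"
    using m g12(5) by (intro nn_integral_mono ennreal_leI) (simp add: powr_powr)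
  also note g_int
  finally have 1: "(\<integral>\<^sup>+x. ennreal_powr (max_fun (\<lambda>y. ennreal (g1 y powr (r y / m))) x) m \<partial>lborel) \<le> ennreal ?c1"
    by (simp add: mult_left_mono)
  have "(\<integral>\<^sup>+x. ennreal_powr (max_fun (\<lambda>y. ennreal (g2 y)) x) r_inf \<partial>lborel)
      \<le> ennreal ?c2 * (\<integral>\<^sup>+x. ennreal (g2 x powr r_inf) \<partial>lborel)"
    using max_fun_powr_bound[of g2 r_inf] ri g12 by simp
  also have "(\<integral>\<^sup>+x. ennreal (g2 x powr r_inf) \<partial>lborel)
     \<le> (\<integral>\<^sup>+x. ennreal (exp (2 * n * Cr)) * ennreal (g x powr r x) + ennreal (decay_weight x) \<partial>lborel)"
  proof (rule nn_integral_mono)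
    fix x
    have "g2 x powr r_inf \<le> exp (2 * n * Cr) * g2 x powr r x + decay_weight x"
      unfolding n_def using g12 by (intro r.powr_inf_le_powr) auto
    also have "\<dots> \<le> exp (2 * n * Cr) * g x powr r x + decay_weight x"
      using g12(6) by (intro add_right_mono mult_left_mono) auto
    finally show "ennreal (g2 x powr r_inf) \<le> ennreal (exp (2 * n * Cr)) * ennreal (g x powr r x) + ennreal (decay_weight x)"
      using decay_weight_pos[of x]
      by (simp add: ennreal_mult[symmetric] ennreal_plus[symmetric] ennreal_leI del: ennreal_plus)
  qed
  also have "\<dots> = ennreal (exp (2 * n * Cr)) * (\<integral>\<^sup>+x. ennreal (g x powr r x) \<partial>lborel) + ennreal (decay_const TYPE('n))"
    by (simp add: nn_integral_add nn_integral_cmult decay_const)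
  also have "\<dots> \<le> ennreal (exp (2 * n * Cr)) * 1 + ennreal (decay_const TYPE('n))"
    using g_int by (intro add_right_mono mult_left_mono) auto
  finally have "(\<integral>\<^sup>+x. ennreal_powr (max_fun (\<lambda>y. ennreal (g2 y)) x) r_inf \<partial>lborel)
      \<le> ennreal ?c2 * (ennreal (exp (2 * n * Cr)) + ennreal (decay_const TYPE('n)))"
    by (simp add: mult_left_mono)
  also have "\<dots> = ennreal ?c2 * ennreal ?e" using decay_const(2)[where 'n='n] by simp
  also have "\<dots> = ennreal (?c2 * ?e)" by (rule ennreal_mult[symmetric, OF c(2,5)])
  finally have 2: "(\<integral>\<^sup>+x. ennreal_powr (max_fun (\<lambda>y. ennreal (g2 y)) x) r_inf \<partial>lborel) \<le> ennreal (?c2 * ?e)" .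
  have "(\<integral>\<^sup>+x. ennreal_powr (min 1 (max_fun (\<lambda>y. ennreal (g1 y)) x)) r_inf \<partial>lborel)
      \<le> ennreal ?c3 * (\<integral>\<^sup>+x. ennreal (g1 x) \<partial>lborel)"
    using min_max_fun_powr_bound[of "\<lambda>y. ennreal (g1 y)" r_inf] ri by simp
  also have "(\<integral>\<^sup>+x. ennreal (g1 x) \<partial>lborel) \<le> (\<integral>\<^sup>+y. ennreal (g y powr r y) \<partial>lborel)"
    using g12(5) g1_le_powr[OF r.lower] by (intro nn_integral_mono ennreal_leI) (blast intro: order_trans)
  also note g_int
  finally have 3: "(\<integral>\<^sup>+x. ennreal_powr (min 1 (max_fun (\<lambda>y. ennreal (g1 y)) x)) r_inf \<partial>lborel) \<le> ennreal ?c3"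
    by (simp add: mult_left_mono)
  have "(\<integral>\<^sup>+x. (ennreal_powr (max_fun (\<lambda>y. ennreal (g1 y powr (r y / m))) x) m
        + ennreal_powr (max_fun (\<lambda>y. ennreal (g2 y)) x) r_inf
        + ennreal_powr (min 1 (max_fun (\<lambda>y. ennreal (g1 y)) x)) r_inf
        + ennreal (decay_weight x)) \<partial>lborel)
     = (\<integral>\<^sup>+x. ennreal_powr (max_fun (\<lambda>y. ennreal (g1 y powr (r y / m))) x) m \<partial>lborel)
        + (\<integral>\<^sup>+x. ennreal_powr (max_fun (\<lambda>y. ennreal (g2 y)) x) r_inf \<partial>lborel)
        + (\<integral>\<^sup>+x. ennreal_powr (min 1 (max_fun (\<lambda>y. ennreal (g1 y)) x)) r_inf \<partial>lborel)
        + ennreal ?c4"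
    by (simp add: nn_integral_add decay_const)
  also have "\<dots> \<le> ennreal ?c1 + ennreal (?c2 * ?e) + ennreal ?c3 + ennreal ?c4"
    using 1 2 3 by (intro add_mono) auto
  also have "\<dots> = ennreal (?c1 + ?c2 * ?e + ?c3 + ?c4)" using c mult_nonneg_nonneg[OF c(2,5)] by (simp only: ennreal_plus[symmetric] add_nonneg_nonneg)
  finally show ?thesis .
qed

end

text \<open>One Borel function B dominates the contributions of all cubes, so the supremum over
  uncountably many cubes never has to be measurable.\<close>

lemma frac_max_majorant:
  obtains D where "1 \<le> D"
    "\<And>g. \<lbrakk>g \<in> borel_measurable borel; \<And>y. 0 \<le> g y; (\<integral>\<^sup>+y. ennreal (g y powr r y) \<partial>lborel) \<le> 1\<rbrakk> \<Longrightarrow>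
      \<exists>B \<in> borel_measurable borel. (\<integral>\<^sup>+x. B x \<partial>lborel) \<le> ennreal D \<and>
        (\<forall>x a l. 0 < l \<longrightarrow> x \<in> cube a l \<longrightarrow>
          ennreal_powr (ennreal ((l ^ CARD('n)) powr (\<gamma> x / n - 1)) *
            (\<integral>\<^sup>+y\<in>cube a l. ennreal (g y) \<partial>lborel)) (q x) \<le> B x)"
proof -
  define c where "c = (D\<^sub>s + D\<^sub>l) * max_fun_const TYPE('n) powr Rr"
  define d where "d = 2 * 5 ^ CARD('n) * m * 2 powr (m - 1) / (m - 1)
        + 2 * 5 ^ CARD('n) * r_inf * 2 powr (r_inf - 1) / (r_inf - 1) * (exp (2 * n * Cr) + decay_const TYPE('n))
        + 5 ^ CARD('n) * r_inf / (r_inf - 1) + decay_const TYPE('n)"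
  have c: "0 \<le> c" using D_nonneg by (simp add: c_def)
  show thesis
  \<comment> \<open>Taking D at least 1 serves the later rescaling, where (1/D)^(q x) <= 1/D is
    used.\<close>
  proof (rule that[of "max 1 (c * d)"])
    fix g :: "real^'n \<Rightarrow> real"
    assume g: "g \<in> borel_measurable borel" "\<And>y. 0 \<le> g y" "(\<integral>\<^sup>+y. ennreal (g y powr r y) \<partial>lborel) \<le> 1"
    note [measurable] = g(1)
    define B where "B x = (ennreal_powr (max_fun (\<lambda>y. ennreal ((if 1 \<le> g y then g y else 0) powr (r y / m))) x) m
        + ennreal_powr (max_fun (\<lambda>y. ennreal (if 1 \<le> g y then 0 else g y)) x) r_inf
        + ennreal_powr (min 1 (max_fun (\<lambda>y. ennreal (if 1 \<le> g y then g y else 0)) x)) r_inf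
        + ennreal (decay_weight x))" for x
    have [measurable]: "B \<in> borel_measurable borel" unfolding B_def by measurable
    have "(\<integral>\<^sup>+x. ennreal c * B x \<partial>lborel) = ennreal c * (\<integral>\<^sup>+x. B x \<partial>lborel)" by (intro nn_integral_cmult) simp
    also have "\<dots> \<le> ennreal c * ennreal d"
      unfolding B_def d_def by (intro mult_left_mono majorant_integral g) auto
    also have "\<dots> \<le> ennreal (max 1 (c * d))"
      using c by (simp add: ennreal_leI flip: ennreal_mult')
    finally show "\<exists>B \<in> borel_measurable borel. (\<integral>\<^sup>+x. B x \<partial>lborel) \<le> ennreal (max 1 (c * d)) \<and>
        (\<forall>x a l. 0 < l \<longrightarrow> x \<in> cube a l \<longrightarrow>
          ennreal_powr (ennreal ((l ^ CARD('n)) powr (\<gamma> x / n - 1)) *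
            (\<integral>\<^sup>+y\<in>cube a l. ennreal (g y) \<partial>lborel)) (q x) \<le> B x)"
      using cube_term[OF g, folded c_def B_def]
      by (intro bexI[of _ "\<lambda>x. ennreal c * B x"]) auto
  qed simp
qed

end

subsection \<open>Lipschitz symbols give bounded commutators\<close>

lemma var_norm_le:
  assumes "0 < l" "var_modular p (\<lambda>x. g x / ennreal l) \<le> 1"
  shows "var_norm p g \<le> ennreal l"
  unfolding var_norm_def using assms by (intro Inf_lower) blast

lemma (in frac_exponents) frac_max_commutator_bounded:
  fixes \<alpha> :: real and \<delta> b :: "real^'n \<Rightarrow> real"
  assumes \<gamma>_eq: "\<And>x. \<gamma> x = \<alpha> + \<delta> x" and \<delta>: "\<And>x. 0 < \<delta> x" "\<And>x. \<delta> x < real CARD('n)"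
    and b: "b \<in> var_Lipschitz \<delta>"
  shows "bounded_var_Lp r q (frac_max_commutator \<alpha> b)"
proof -
  obtain b' L0 where b': "AE x in lebesgue. b' x = b x"
      and L0: "\<And>x y. \<bar>b' x - b' y\<bar> \<le> L0 * norm (x - y) powr \<delta> x"
    using b unfolding var_Lipschitz_def by blast
  \<comment> \<open>The constant in the Lipschitz condition may have any sign; a positive one is
    needed for the division by c * D * k.\<close>
  define L where "L = \<bar>L0\<bar> + 1"
  have L: "0 < L" by (simp add: L_def add_nonneg_pos)
  have Lip: "\<bar>b' x - b' y\<bar> \<le> L * norm (x - y) powr \<delta> x" for x y
    using L0[of x y] by (rule order_trans) (auto simp: L_def intro!: mult_right_mono)
  obtain D where D: "1 \<le> D" and maj:
    "\<And>g. \<lbrakk>g \<in> borel_measurable borel; \<And>y. 0 \<le> g y; (\<integral>\<^sup>+y. ennreal (g y powr r y) \<partial>lborel) \<le> 1\<rbrakk> \<Longrightarrow>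
      \<exists>B \<in> borel_measurable borel. (\<integral>\<^sup>+x. B x \<partial>lborel) \<le> ennreal D \<and>
        (\<forall>x a l. 0 < l \<longrightarrow> x \<in> cube a l \<longrightarrow>
          ennreal_powr (ennreal ((l ^ CARD('n)) powr (\<gamma> x / n - 1)) *
            (\<integral>\<^sup>+y\<in>cube a l. ennreal (g y) \<partial>lborel)) (q x) \<le> B x)"
    using frac_max_majorant by blast
  \<comment> \<open>Points of a cube of side l are at distance at most n l, and (n l)^\<delta> <=
    n^n l^\<delta> because \<delta> < n and n \<ge> 1.\<close>
  define c where "c = L * n powr n"
  have c: "0 < c" using L n_ge_1 by (simp add: c_def)
  have key: "var_norm q (frac_max_commutator \<alpha> b f) \<le> ennreal (c * D * k)"
    if f: "f \<in> borel_measurable lebesgue" and k: "0 < k"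
      and mod: "var_modular r (\<lambda>x. ennreal \<bar>f x\<bar> / ennreal k) \<le> 1" for f k
  proof -
    obtain f' where f' [measurable]: "f' \<in> borel_measurable borel" and ff': "AE x in lborel. f x = f' x"
      using completion_ex_borel_measurable_real[OF f] by auto
    define g where "g y = \<bar>f' y\<bar> / k" for y
    have [measurable]: "g \<in> borel_measurable borel" unfolding g_def by measurable
    have "(\<integral>\<^sup>+y. ennreal (g y powr r y) \<partial>lborel) = var_modular r (\<lambda>x. ennreal \<bar>f x\<bar> / ennreal k)"
      unfolding var_modular_def nn_integral_completion
    proof (rule nn_integral_cong_AE)
      show "AE y in lborel. ennreal (g y powr r y) = ennreal_powr (ennreal \<bar>f y\<bar> / ennreal k) (r y)"
        using ff' by eventually_elim (use k in \<open>simp add: g_def divide_ennreal ennreal_powr_ennreal\<close>)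
    qed
    with mod have "(\<integral>\<^sup>+y. ennreal (g y powr r y) \<partial>lborel) \<le> 1" by simp
    then obtain B where B [measurable]: "B \<in> borel_measurable borel" and BD: "(\<integral>\<^sup>+x. B x \<partial>lborel) \<le> ennreal D"
      and Bx: "\<And>x a l. 0 < l \<Longrightarrow> x \<in> cube a l \<Longrightarrow>
          ennreal_powr (ennreal ((l ^ CARD('n)) powr (\<gamma> x / n - 1)) *
            (\<integral>\<^sup>+y\<in>cube a l. ennreal (g y) \<partial>lborel)) (q x) \<le> B x"
      using maj[of g] k by (auto simp: g_def)
    have bb': "AE x in lborel. b x = b' x"
      using b' by (simp add: AE_completion_iff eq_commute)
    \<comment> \<open>Restricted to points where b agrees with its Lipschitz representative:
      elsewhere b x is arbitrary, but such x form a null set.\<close>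
    have T: "frac_max_commutator \<alpha> b f x \<le> ennreal (c * k) * ennreal_powr (B x) (1 / q x)"
      if bx: "b x = b' x" for x
      unfolding frac_max_commutator_def
    proof (rule SUP_least, clarify)
      fix Q :: "(real^'n) set" assume "Q \<in> cubes" "x \<in> Q"
      then obtain a l where l: "0 < l" and Q: "Q = cube a l" by (metis cube_cases)
      define V where "V = l ^ CARD('n)"
      have V: "0 < V" using l by (simp add: V_def)
      have mQ: "measure lebesgue Q = V" unfolding Q V_def by (rule measure_cube(1)[OF l])
      have [measurable]: "Q \<in> sets borel" by (simp add: Q)
      have "(\<integral>\<^sup>+y\<in>Q. ennreal (\<bar>b x - b y\<bar> * \<bar>f y\<bar>) \<partial>lebesgue)
         \<le> (\<integral>\<^sup>+y. ennreal (c * k * V powr (\<delta> x / n)) * (ennreal (g y) * indicator Q y) \<partial>lborel)"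
        unfolding nn_integral_completion
      proof (rule nn_integral_mono_AE)
        show "AE y in lborel. ennreal (\<bar>b x - b y\<bar> * \<bar>f y\<bar>) * indicator Q y
            \<le> ennreal (c * k * V powr (\<delta> x / n)) * (ennreal (g y) * indicator Q y)"
          using ff' bb'
        proof eventually_elim
          case (elim y)
          show ?case
          proof (cases "y \<in> Q")
            case True
            have "\<bar>b x - b y\<bar> \<le> L * norm (x - y) powr \<delta> x"
              using Lip[of x y] bx elim by simp
            also have "\<dots> \<le> L * (n * l) powr \<delta> x"
              using norm_diff_cube[of x a l y] \<open>x \<in> Q\<close> True \<delta>(1)[of x] L
              by (intro mult_left_mono powr_mono2) (auto simp: Q n_def)
            also have "\<dots> = L * (n powr \<delta> x * l powr \<delta> x)" by (simp add: powr_mult)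
            also have "l powr \<delta> x = V powr (\<delta> x / n)"
              using l n_ge_1 by (simp add: V_def n_def powr_powr flip: powr_realpow)
            also have "L * (n powr \<delta> x * V powr (\<delta> x / n)) \<le> L * (n powr n * V powr (\<delta> x / n))"
              using \<delta>(2)[of x] n_ge_1 L by (intro mult_left_mono mult_right_mono powr_mono) (auto simp: n_def)
            finally have "\<bar>b x - b y\<bar> \<le> c * V powr (\<delta> x / n)" by (simp add: c_def mult.assoc)
            then have "\<bar>b x - b y\<bar> * \<bar>f y\<bar> \<le> c * V powr (\<delta> x / n) * \<bar>f y\<bar>"
              by (rule mult_right_mono) simp
            moreover have "\<bar>f y\<bar> = k * g y" using elim k by (simp add: g_def)
            ultimately have "\<bar>b x - b y\<bar> * \<bar>f y\<bar> \<le> c * V powr (\<delta> x / n) * (k * g y)" by simp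
            then show ?thesis
              using True c k by (simp add: g_def ennreal_leI mult_ac flip: ennreal_mult)
          qed simp
        qed
      qed
      also have "\<dots> = ennreal (c * k * V powr (\<delta> x / n)) * (\<integral>\<^sup>+y\<in>Q. ennreal (g y) \<partial>lborel)"
        by (rule nn_integral_cmult) auto
      finally have "(\<integral>\<^sup>+y\<in>Q. ennreal (\<bar>b x - b y\<bar> * \<bar>f y\<bar>) \<partial>lebesgue) / ennreal (V powr (1 - \<alpha> / n))
         \<le> (ennreal (c * k * V powr (\<delta> x / n)) * (\<integral>\<^sup>+y\<in>Q. ennreal (g y) \<partial>lborel)) / ennreal (V powr (1 - \<alpha> / n))"
        by (rule divide_right_mono_ennreal)
      also have "\<dots> = (ennreal (c * k * V powr (\<delta> x / n)) * ennreal (V powr (\<alpha> / n - 1))) * (\<integral>\<^sup>+y\<in>Q. ennreal (g y) \<partial>lborel)"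
      proof -
        have "u / ennreal (V powr (1 - \<alpha> / n)) = u * ennreal (V powr (\<alpha> / n - 1))" for u
          using V by (simp add: divide_ennreal_def inverse_ennreal powr_minus[symmetric])
        then show ?thesis by (simp add: mult_ac)
      qed
      also have "ennreal (c * k * V powr (\<delta> x / n)) * ennreal (V powr (\<alpha> / n - 1))
          = ennreal (c * k) * ennreal (V powr (\<gamma> x / n - 1))"
      proof -
        have "V powr (\<gamma> x / n - 1) = V powr (\<delta> x / n) * V powr (\<alpha> / n - 1)"
          unfolding powr_add[symmetric] by (simp add: \<gamma>_eq add_divide_distrib algebra_simps)
        then show ?thesis using c k by (simp add: mult.assoc flip: ennreal_mult)
      qed
      also have "\<dots> * (\<integral>\<^sup>+y\<in>Q. ennreal (g y) \<partial>lborel) =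
          ennreal (c * k) * (ennreal (V powr (\<gamma> x / n - 1)) * (\<integral>\<^sup>+y\<in>Q. ennreal (g y) \<partial>lborel))"
        by (simp add: mult.assoc)
      also have "\<dots> \<le> ennreal (c * k) * ennreal_powr (B x) (1 / q x)"
      proof (rule mult_left_mono)
        let ?u = "ennreal (V powr (\<gamma> x / n - 1)) * (\<integral>\<^sup>+y\<in>Q. ennreal (g y) \<partial>lborel)"
        have qx: "1 \<le> q x" by (rule q.lower)
        then have "?u = ennreal_powr (ennreal_powr ?u (q x)) (1 / q x)"
          using ennreal_powr_inverse[of "1 / q x" ?u] by simp
        also have "\<dots> \<le> ennreal_powr (B x) (1 / q x)"
          using Bx[OF l] \<open>x \<in> Q\<close> qx unfolding Q V_def by (intro ennreal_powr_mono) auto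
        finally show "?u \<le> ennreal_powr (B x) (1 / q x)" .
      qed simp
      finally show "(\<integral>\<^sup>+y\<in>Q. ennreal (\<bar>b x - b y\<bar> * \<bar>f y\<bar>) \<partial>lebesgue)
          / ennreal (measure lebesgue Q powr (1 - \<alpha> / real CARD('n)))
          \<le> ennreal (c * k) * ennreal_powr (B x) (1 / q x)"
        by (simp add: mQ n_def)
    qed
    \<comment> \<open>Monotonicity of the nonnegative integral under almost-everywhere domination is
      all that is used about the commutator; its measurability is never invoked.\<close>
    have "var_modular q (\<lambda>x. frac_max_commutator \<alpha> b f x / ennreal (c * D * k)) \<le> (\<integral>\<^sup>+x. ennreal (1 / D) * B x \<partial>lborel)"
      unfolding var_modular_def nn_integral_completion
    proof (rule nn_integral_mono_AE)
      show "AE x in lborel. ennreal_powr (frac_max_commutator \<alpha> b f x / ennreal (c * D * k)) (q x) \<le> ennreal (1 / D) * B x"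
        using bb'
      proof eventually_elim
        case (elim x)
        have qx: "1 \<le> q x" by (rule q.lower)
        have "frac_max_commutator \<alpha> b f x / ennreal (c * D * k)
            \<le> (ennreal (c * k) * ennreal_powr (B x) (1 / q x)) / ennreal (c * D * k)"
          using T[OF elim] by (rule divide_right_mono_ennreal)
        also have "\<dots> = ennreal (1 / D) * ennreal_powr (B x) (1 / q x)"
        proof -
          have *: "u / ennreal (c * D * k) = u * ennreal (1 / (c * D * k))" for u
            using c D k by (simp add: divide_ennreal_def inverse_ennreal inverse_eq_divide)
          have "ennreal (c * k) * ennreal (1 / (c * D * k)) = ennreal (1 / D)"
            using c D k by (simp flip: ennreal_mult)
          then show ?thesis unfolding * by (simp add: mult_ac) (metis mult.commute mult.left_commute)
        qed
        finally have "ennreal_powr (frac_max_commutator \<alpha> b f x / ennreal (c * D * k)) (q x)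
           \<le> ennreal_powr (ennreal (1 / D) * ennreal_powr (B x) (1 / q x)) (q x)"
          using qx by (intro ennreal_powr_mono) auto
        also have "\<dots> = ennreal ((1 / D) powr q x) * B x"
          using D qx by (simp add: ennreal_powr_mult ennreal_powr_inverse)
        also have "\<dots> \<le> ennreal (1 / D) * B x"
          using D qx powr_mono'[of 1 "q x" "1 / D"] by (intro mult_right_mono ennreal_leI) auto
        finally show ?case .
      qed
    qed
    also have "\<dots> = ennreal (1 / D) * (\<integral>\<^sup>+x. B x \<partial>lborel)" by (rule nn_integral_cmult) simp
    also have "\<dots> \<le> ennreal (1 / D) * ennreal D" using BD by (intro mult_left_mono) auto
    also have "\<dots> = 1" using D by (simp flip: ennreal_mult)
    finally show ?thesis using c D k by (intro var_norm_le) auto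
  qed
  show ?thesis
    unfolding bounded_var_Lp_def
  proof (intro exI ballI)
    fix f assume "f \<in> var_Lp r"
    then have f: "f \<in> borel_measurable lebesgue" by (simp add: var_Lp_def)
    let ?N = "var_norm q (frac_max_commutator \<alpha> b f)"
    have cD: "0 < c * D" using c D by simp
    \<comment> \<open>With the constant moved to the left, it suffices to compare with each
      admissible k in the infimum defining the norm.\<close>
    have "?N / ennreal (c * D) \<le> var_norm r (\<lambda>x. ennreal \<bar>f x\<bar>)"
      unfolding var_norm_def[of r]
    proof (rule Inf_greatest, clarify)
      fix k :: real assume "0 < k" "var_modular r (\<lambda>x. ennreal \<bar>f x\<bar> / ennreal k) \<le> 1"
      then have "?N / ennreal (c * D) \<le> ennreal (c * D * k) / ennreal (c * D)"
        using key[OF f] by (intro divide_right_mono_ennreal) auto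
      also have "\<dots> = ennreal k" using cD \<open>0 < k\<close> c D by (simp add: divide_ennreal)
      finally show "?N / ennreal (c * D) \<le> ennreal k" .
    qed
    then have "ennreal (c * D) * (?N / ennreal (c * D)) \<le> ennreal (c * D) * var_norm r (\<lambda>x. ennreal \<bar>f x\<bar>)"
      by (intro mult_left_mono) auto
    also have "ennreal (c * D) * (?N / ennreal (c * D)) = ?N"
      unfolding ennreal_times_divide mult.commute[of "ennreal (c * D)"]
      using cD by (intro ennreal_mult_divide_eq) (auto simp: ennreal_eq_0_iff not_le)
    finally show "?N \<le> ennreal (c * D) * var_norm r (\<lambda>x. ennreal \<bar>f x\<bar>)" .
  qed
qed

subsection \<open>Campanato characterisation\<close>

text \<open>A set S of coordinates encodes one of the 2^n subcubes: the one occupying the upper half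
  exactly in the directions of S.\<close>

lemma cube_subset_halves:
  fixes a :: "real^'n::finite"
  shows "cube a l \<subseteq> (\<Union>S\<in>UNIV. cube (\<chi> i. if i \<in> S then a $ i + l / 2 else a $ i) (l / 2))"
proof
  fix x assume x: "x \<in> cube a l"
  define S where "S = {i. a $ i + l / 2 \<le> x $ i}"
  have "x \<in> cube (\<chi> i. if i \<in> S then a $ i + l / 2 else a $ i) (l / 2)"
    unfolding mem_box_cart
  proof
    fix i
    have "a $ i \<le> x $ i \<and> x $ i \<le> a $ i + l" using x by (simp add: mem_box_cart)
    then show "(\<chi> i. if i \<in> S then a $ i + l / 2 else a $ i) $ i \<le> x $ i \<and>
        x $ i \<le> (\<chi> j. (\<chi> i. if i \<in> S then a $ i + l / 2 else a $ i) $ j + l / 2) $ i"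
      by (cases "i \<in> S") (auto simp: S_def)
  qed
  then show "x \<in> (\<Union>S\<in>UNIV. cube (\<chi> i. if i \<in> S then a $ i + l / 2 else a $ i) (l / 2))" by blast
qed

lemma nn_integral_cube_halves:
  fixes a :: "real^'n::finite"
  assumes [measurable]: "u \<in> borel_measurable borel"
  shows "(\<integral>\<^sup>+y\<in>cube a l. u y \<partial>lborel)
    \<le> (\<Sum>S\<in>UNIV. \<integral>\<^sup>+y\<in>cube (\<chi> i. if i \<in> S then a $ i + l / 2 else a $ i) (l / 2). u y \<partial>lborel)"
proof -
  let ?c = "\<lambda>S. cube (\<chi> i. if i \<in> S then a $ i + l / 2 else a $ i) (l / 2)"
  have [measurable]: "?c S \<in> sets borel" for S by simp
  have "(\<integral>\<^sup>+y\<in>cube a l. u y \<partial>lborel) \<le> (\<integral>\<^sup>+y. (\<Sum>S\<in>UNIV. u y * indicator (?c S) y) \<partial>lborel)"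
  proof (rule nn_integral_mono)
    fix y
    show "u y * indicator (cube a l) y \<le> (\<Sum>S\<in>UNIV. u y * indicator (?c S) y)"
    proof (cases "y \<in> cube a l")
      case True
      then obtain S where "y \<in> ?c S" using cube_subset_halves[of a l] by blast
      then have "u y \<le> u y * indicator (?c S) y" by simp
      also have "\<dots> \<le> (\<Sum>S\<in>UNIV. u y * indicator (?c S) y)"
        by (rule member_le_sum[of S UNIV "\<lambda>S. u y * indicator (?c S) y"]) auto
      finally show ?thesis using True by simp
    qed simp
  qed
  also have "\<dots> = (\<Sum>S\<in>UNIV. \<integral>\<^sup>+y\<in>?c S. u y \<partial>lborel)"
    by (rule nn_integral_sum) auto
  finally show ?thesis .
qed

text \<open>After \<open>k\<close> bisections the \<open>2 ^ (n k)\<close> subcubes carry total mass \<open>O((l / 2 ^ k) powr d)\<close>.\<close>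

lemma AE_zero_of_small_cubes:
  fixes u :: "real^'n::finite \<Rightarrow> real"
  assumes [measurable]: "u \<in> borel_measurable borel" and u: "\<And>y. 0 \<le> u y" and C: "0 \<le> C" and d: "0 < d" and e: "0 < e"
    and small: "\<And>a l. 0 < l \<Longrightarrow> l \<le> e \<Longrightarrow> (\<integral>\<^sup>+y\<in>cube a l. ennreal (u y) \<partial>lborel) \<le> ennreal (C * l ^ CARD('n) * l powr d)"
  shows "AE y in lborel. u y = 0"
proof -
  let ?F = "\<lambda>a l. \<integral>\<^sup>+y\<in>cube a l. ennreal (u y) \<partial>lborel"
  \<comment> \<open>The 2^n subcubes compensate the factor (l/2)^n exactly, so only the power d
    changes. The condition l <= e * 2^k brings the side below e after k bisections.\<close>
  have bisect: "?F a l \<le> ennreal (C * l ^ CARD('n) * (l / 2 ^ k) powr d)" if "0 < l" "l \<le> e * 2 ^ k" for a l k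
    using that
  proof (induction k arbitrary: a l)
    case 0
    then show ?case using small[of l a] by simp
  next
    case (Suc k)
    have "?F a l \<le> (\<Sum>S\<in>UNIV. ?F (\<chi> i. if i \<in> S then a $ i + l / 2 else a $ i) (l / 2))"
      by (rule nn_integral_cube_halves) simp
    also have "\<dots> \<le> (\<Sum>S\<in>(UNIV :: 'n set set). ennreal (C * (l / 2) ^ CARD('n) * (l / 2 / 2 ^ k) powr d))"
      using Suc by (intro sum_mono Suc.IH) auto
    also have "\<dots> = ennreal (2 ^ CARD('n) * (C * (l / 2) ^ CARD('n) * (l / 2 / 2 ^ k) powr d))"
      using C Suc by (simp add: card_UNIV_set ennreal_mult'' flip: ennreal_power)
    also have "2 ^ CARD('n) * (C * (l / 2) ^ CARD('n) * (l / 2 / 2 ^ k) powr d) = C * l ^ CARD('n) * (l / 2 ^ Suc k) powr d"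
      by (simp add: power_divide)
    finally show ?case .
  qed
  have zero: "?F a l = 0" if l: "0 < l" for a l
  proof -
    have to0: "(\<lambda>k. (l / 2 ^ k)) \<longlonglongrightarrow> 0" by (intro LIMSEQ_divide_realpow_zero) simp
    then have "(\<lambda>k. (l / 2 ^ k) powr d) \<longlonglongrightarrow> 0"
      using d l by (intro tendsto_zero_powrI[where b = d]) auto
    then have "(\<lambda>k. C * l ^ CARD('n) * (l / 2 ^ k) powr d) \<longlonglongrightarrow> C * l ^ CARD('n) * 0"
      by (intro tendsto_mult tendsto_const)
    then have lim: "(\<lambda>k. ennreal (C * l ^ CARD('n) * (l / 2 ^ k) powr d)) \<longlonglongrightarrow> ennreal 0"
      by (intro tendsto_ennrealI) simp
    have "\<forall>\<^sub>F k in sequentially. l / 2 ^ k < e" using to0 e by (rule order_tendstoD)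
    then have "\<forall>\<^sub>F k in sequentially. l \<le> e * 2 ^ k"
      by eventually_elim (simp add: divide_less_eq less_imp_le)
    then have "\<forall>\<^sub>F k in sequentially. ?F a l \<le> ennreal (C * l ^ CARD('n) * (l / 2 ^ k) powr d)"
      by eventually_elim (rule bisect[OF l])
    from tendsto_lowerbound[OF lim this] show ?thesis by simp
  qed
  \<comment> \<open>Countably many centred cubes exhaust the space, so the exceptional sets add up
    to a null set.\<close>
  have "AE y in lborel. \<forall>k::nat. ennreal (u y) * indicator (cube (vec (- real (Suc k))) (2 * real (Suc k))) y = 0"
    unfolding AE_all_countable
  proof
    fix k :: nat
    have "(\<integral>\<^sup>+y\<in>cube (vec (- real (Suc k))) (2 * real (Suc k)). ennreal (u y) \<partial>lborel) = 0"
      by (rule zero) simp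
    then show "AE y in lborel. ennreal (u y) * indicator (cube (vec (- real (Suc k))) (2 * real (Suc k))) y = 0"
      by (subst (asm) nn_integral_0_iff_AE) auto
  qed
  then show ?thesis
  proof eventually_elim
    case (elim y)
    obtain k :: nat where k: "norm y \<le> real k" using real_arch_simple by blast
    have "\<bar>y $ i\<bar> \<le> real (Suc k)" for i
      using component_le_norm_cart[of y i] k by simp
    then have "y \<in> cube (vec (- real (Suc k))) (2 * real (Suc k))"
      unfolding mem_box_cart by (simp add: abs_le_iff) (smt (verit))
    then have "ennreal (u y) = 0" using spec[OF elim, of k] by simp
    then show ?case using u[of y] by (simp add: ennreal_eq_0_iff)
  qed
qed

section \<open>Means over shrinking cubes and their limits\<close>

definition cube_mean :: "(real^'n::finite \<Rightarrow> real) \<Rightarrow> real^'n \<Rightarrow> real \<Rightarrow> real" where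
  "cube_mean b a l = (LINT y:cube a l|lborel. b y) / l ^ CARD('n)"

text \<open>The modulus depends on the point, and \<open>osc\<close> holds with the modulus of every
  point of the cube, so the most convenient one may be chosen. Halving makes the telescoping series
  geometric, while \<open>\<phi>_small\<close> gives a uniform Hoelder rate at small scales.\<close>

locale campanato =
  fixes b :: "real^'n::finite \<Rightarrow> real" and \<phi> :: "real^'n \<Rightarrow> real \<Rightarrow> real" and C \<rho> d :: real
  assumes b_meas [measurable]: "b \<in> borel_measurable borel"
    and b_int: "0 < l \<Longrightarrow> set_integrable lborel (cube a l) b"
    and \<phi>_nonneg: "0 \<le> \<phi> x l" and \<phi>_half: "0 < l \<Longrightarrow> \<phi> x (l / 2) \<le> \<rho> * \<phi> x l"
    and \<phi>_small: "0 < l \<Longrightarrow> l \<le> 1 \<Longrightarrow> \<phi> x l \<le> l powr d"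
    and \<rho>: "0 \<le> \<rho>" "\<rho> < 1" and d: "0 < d" and C: "0 \<le> C"
    and osc: "0 < l \<Longrightarrow> x \<in> cube a l \<Longrightarrow>
      (\<integral>\<^sup>+y\<in>cube a l. ennreal \<bar>b y - cube_mean b a l\<bar> \<partial>lborel) \<le> ennreal (C * l ^ CARD('n) * \<phi> x l)"
begin

lemma const_int: "set_integrable lborel (cube a l) (\<lambda>_. c :: real)"
  unfolding set_integrable_def
  using emeasure_lborel_cbox_finite[of a "\<chi> i. a $ i + l"]
  by (intro integrable_scaleR_left integrable_real_indicator) auto

lemma b_int': "0 < l \<Longrightarrow> set_integrable lborel (cube a l) (\<lambda>y. b y - c)"
  by (intro set_integral_diff(1) b_int const_int)

text \<open>The difference is the mean over the subcube of b minus the mean on the large cube;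
  enlarging the domain of integration costs the volume ratio t^n.\<close>

lemma mean_diff:
  assumes l: "0 < l" "0 < l'" "l = t * l'" and sub: "cube a' l' \<subseteq> cube a l" and x: "x \<in> cube a l"
  shows "\<bar>cube_mean b a' l' - cube_mean b a l\<bar> \<le> t ^ CARD('n) * C * \<phi> x l"
proof -
  let ?c = "cube_mean b a l"
  have m: "measure lborel (cube a' l') = l' ^ CARD('n)"
    using measure_cube(1)[OF l(2), of a'] by (simp add: measure_completion)
  have "(LINT y:cube a' l'|lborel. b y - ?c) = (LINT y:cube a' l'|lborel. b y) - ?c * l' ^ CARD('n)"
  proof -
    have "(LINT y:cube a' l'|lborel. ?c) = ?c * l' ^ CARD('n)"
      by (simp add: set_lebesgue_integral_def m)
    then show ?thesis using set_integral_diff(2)[OF b_int[OF l(2)] const_int] by simp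
  qed
  then have "(cube_mean b a' l' - ?c) * l' ^ CARD('n) = (LINT y:cube a' l'|lborel. b y - ?c)"
    using l by (simp add: cube_mean_def left_diff_distrib)
  then have "\<bar>cube_mean b a' l' - ?c\<bar> * l' ^ CARD('n) = \<bar>LINT y:cube a' l'|lborel. b y - ?c\<bar>"
    using l by (metis abs_mult abs_of_pos zero_less_power)
  also have "\<dots> \<le> (LINT y:cube a' l'|lborel. \<bar>b y - ?c\<bar>)"
    using set_integral_norm_bound[OF b_int'[OF l(2)], of a' ?c] by simp
  finally have "ennreal (\<bar>cube_mean b a' l' - ?c\<bar> * l' ^ CARD('n)) \<le> ennreal (LINT y:cube a' l'|lborel. \<bar>b y - ?c\<bar>)"
    by (rule ennreal_leI)
  also have "\<dots> = (\<integral>\<^sup>+y\<in>cube a' l'. ennreal \<bar>b y - ?c\<bar> \<partial>lborel)"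
    using set_integrable_abs[OF b_int'[OF l(2)], of a' ?c]
    unfolding set_lebesgue_integral_def set_integrable_def
    by (subst nn_integral_eq_integral[symmetric]) (auto intro!: nn_integral_cong simp: indicator_def)
  also have "\<dots> \<le> (\<integral>\<^sup>+y\<in>cube a l. ennreal \<bar>b y - ?c\<bar> \<partial>lborel)"
    using sub by (intro nn_integral_mono) (auto simp: indicator_def)
  also have "\<dots> \<le> ennreal (C * l ^ CARD('n) * \<phi> x l)" using osc[OF l(1) x] .
  finally have "\<bar>cube_mean b a' l' - ?c\<bar> * l' ^ CARD('n) \<le> C * l ^ CARD('n) * \<phi> x l"
    using C l \<phi>_nonneg by (subst (asm) ennreal_le_iff) auto
  also have "l ^ CARD('n) = t ^ CARD('n) * l' ^ CARD('n)" using l by (simp add: power_mult_distrib)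
  finally show ?thesis using l by (simp add: mult_ac)
qed

text \<open>The cube is centred at x with half-side h, so the modulus belonging to it is
  \<open>\<phi> x (2 * h)\<close>.\<close>

definition "mean x h = cube_mean b (x - vec h) (2 * h)"

lemma mem_cube_centre: "y \<in> cube (x - vec h) (2 * h) \<longleftrightarrow> (\<forall>i. \<bar>y $ i - x $ i\<bar> \<le> h)"
  by (auto simp: mem_box_cart abs_le_iff algebra_simps)

lemma mean_half:
  assumes "0 < h" "h \<le> h'" "h' \<le> 2 * h"
  shows "\<bar>mean x h - mean x h'\<bar> \<le> 2 ^ CARD('n) * C * \<phi> x (2 * h')"
proof -
  have "\<bar>mean x h - mean x h'\<bar> \<le> (h' / h) ^ CARD('n) * C * \<phi> x (2 * h')"
    unfolding mean_def
  proof (rule mean_diff)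
    show "cube (x - vec h) (2 * h) \<subseteq> cube (x - vec h') (2 * h')"
      unfolding subset_iff mem_cube_centre using assms(2) by (blast intro: order_trans)
    show "x \<in> cube (x - vec h') (2 * h')" unfolding mem_cube_centre using assms by simp
  qed (use assms in auto)
  also have "\<dots> \<le> 2 ^ CARD('n) * C * \<phi> x (2 * h')"
    using assms C \<phi>_nonneg by (intro mult_right_mono power_mono) (auto simp: divide_le_eq)
  finally show ?thesis .
qed

text \<open>The cost 2^n C of one halving times the geometric series in \<rho>. The fixed-point
  equation 2^n C + S \<rho> = S drives the induction.\<close>

definition "S = 2 ^ CARD('n) * C / (1 - \<rho>)"

lemma S: "0 \<le> S" "2 ^ CARD('n) * C \<le> S" "2 ^ CARD('n) * C + S * \<rho> = S"
proof -
  show "0 \<le> S" using C \<rho> by (simp add: S_def)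
  show eq: "2 ^ CARD('n) * C + S * \<rho> = S" using \<rho> by (simp add: S_def field_simps)
  show "2 ^ CARD('n) * C \<le> S" using eq mult_nonneg_nonneg[OF \<open>0 \<le> S\<close> \<rho>(1)] by linarith
qed

text \<open>Induction on the number of halvings needed to bring h' within a factor 2 of h. Allowing
  a last ratio below 2 covers all radii, not only dyadic multiples.\<close>

lemma mean_telescope:
  assumes "0 < h" "h \<le> h'"
  shows "\<bar>mean x h - mean x h'\<bar> \<le> S * \<phi> x (2 * h')"
proof -
  have "h' \<le> 2 ^ k * h \<Longrightarrow> h \<le> h' \<Longrightarrow> \<bar>mean x h - mean x h'\<bar> \<le> S * \<phi> x (2 * h')" for k h'
  proof (induction k arbitrary: h')
    case 0
    then have "h' = h" by simp
    then show ?case using S \<phi>_nonneg by simp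
  next
    case (Suc k)
    show ?case
    proof (cases "h' \<le> 2 * h")
      case True
      have "\<bar>mean x h - mean x h'\<bar> \<le> 2 ^ CARD('n) * C * \<phi> x (2 * h')"
        using True Suc assms by (intro mean_half) auto
      also have "\<dots> \<le> S * \<phi> x (2 * h')" using S \<phi>_nonneg by (intro mult_right_mono) auto
      finally show ?thesis .
    next
      case False
      have h': "0 < h'" using Suc assms by linarith
      have "\<bar>mean x h - mean x (h' / 2)\<bar> \<le> S * \<phi> x (2 * (h' / 2))"
        using Suc False by (intro Suc.IH) auto
      also have "2 * (h' / 2) = (2 * h') / 2" by simp
      also have "S * \<phi> x (2 * h' / 2) \<le> S * (\<rho> * \<phi> x (2 * h'))"
        using S h' by (intro mult_left_mono \<phi>_half) auto
      finally have 1: "\<bar>mean x h - mean x (h' / 2)\<bar> \<le> S * (\<rho> * \<phi> x (2 * h'))" .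
      have 2: "\<bar>mean x (h' / 2) - mean x h'\<bar> \<le> 2 ^ CARD('n) * C * \<phi> x (2 * h')"
        using h' by (intro mean_half) auto
      have "\<bar>mean x h - mean x h'\<bar> \<le> (2 ^ CARD('n) * C + S * \<rho>) * \<phi> x (2 * h')"
        using 1 2 unfolding distrib_right mult.assoc by linarith
      then show ?thesis unfolding S(3) .
    qed
  qed
  moreover obtain k where "h' / h \<le> 2 ^ k"
    using real_arch_pow[of 2 "h' / h"] by (auto intro: less_imp_le)
  then have "h' \<le> 2 ^ k * h" using assms by (simp add: divide_le_eq)
  ultimately show ?thesis using assms by blast
qed

definition "b' x = lim (\<lambda>k. mean x (1 / 2 ^ k))"

lemma \<phi>_to_0: "(\<lambda>k. \<phi> x (2 * (1 / 2 ^ k))) \<longlonglongrightarrow> 0"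
proof -
  have "\<phi> x (2 * (1 / 2 ^ k)) \<le> \<rho> ^ k * \<phi> x 2" for k
  proof (induction k)
    case (Suc k)
    have "\<phi> x (2 * (1 / 2 ^ k) / 2) \<le> \<rho> * \<phi> x (2 * (1 / 2 ^ k))" by (rule \<phi>_half) simp
    also have "\<dots> \<le> \<rho> * (\<rho> ^ k * \<phi> x 2)" using Suc \<rho> by (intro mult_left_mono) auto
    finally show ?case by (simp add: mult.assoc)
  qed simp
  then have le: "\<forall>\<^sub>F k in sequentially. norm (\<phi> x (2 * (1 / 2 ^ k))) \<le> \<rho> ^ k * \<phi> x 2"
    using \<phi>_nonneg by (intro always_eventually allI) (simp only: real_norm_def abs_of_nonneg)
  have "(\<lambda>k. \<rho> ^ k * \<phi> x 2) \<longlonglongrightarrow> 0 * \<phi> x 2"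
    by (rule tendsto_mult[OF LIMSEQ_realpow_zero[OF \<rho>] tendsto_const])
  then have "(\<lambda>k. \<rho> ^ k * \<phi> x 2) \<longlonglongrightarrow> 0" by simp
  with le show ?thesis by (rule Lim_null_comparison)
qed

lemma mean_tendsto: "(\<lambda>k. mean x (1 / 2 ^ k)) \<longlonglongrightarrow> b' x"
proof -
  have "Cauchy (\<lambda>k. mean x (1 / 2 ^ k))"
  proof (rule metric_CauchyI)
    fix e :: real assume e: "0 < e"
    have "(\<lambda>k. S * \<phi> x (2 * (1 / 2 ^ k))) \<longlonglongrightarrow> S * 0"
      by (intro tendsto_mult tendsto_const \<phi>_to_0)
    then have "\<forall>\<^sub>F k in sequentially. S * \<phi> x (2 * (1 / 2 ^ k)) < e / 2"
      using e by (intro order_tendstoD(2)) auto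
    then obtain N where N: "S * \<phi> x (2 * (1 / 2 ^ N)) < e / 2"
      by (auto simp: eventually_sequentially)
    have near: "\<bar>mean x (1 / 2 ^ k) - mean x (1 / 2 ^ N)\<bar> < e / 2" if "N \<le> k" for k
      using mean_telescope[of "1 / 2 ^ k" "1 / 2 ^ N" x] N that
      by (simp add: frac_le power_increasing)
    show "\<exists>M. \<forall>k\<ge>M. \<forall>j\<ge>M. dist (mean x (1 / 2 ^ k)) (mean x (1 / 2 ^ j)) < e"
    proof (intro exI allI impI)
      fix k j assume "N \<le> k" "N \<le> j"
      from near[OF this(1)] near[OF this(2)]
      show "dist (mean x (1 / 2 ^ k)) (mean x (1 / 2 ^ j)) < e" unfolding dist_real_def by linarith
    qed
  qed
  then show ?thesis unfolding b'_def using Cauchy_convergent_iff convergent_LIMSEQ_iff by blast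
qed

text \<open>The telescoped bound does not depend on the smaller radius, so it survives the limit
  along 1/2^k.\<close>

lemma b'_mean:
  assumes h: "0 < h"
  shows "\<bar>b' x - mean x h\<bar> \<le> S * \<phi> x (2 * h)"
proof (rule tendsto_upperbound)
  show "(\<lambda>k. \<bar>mean x (1 / 2 ^ k) - mean x h\<bar>) \<longlonglongrightarrow> \<bar>b' x - mean x h\<bar>"
    by (intro tendsto_rabs tendsto_diff mean_tendsto tendsto_const)
  have "(\<lambda>k. 1 / 2 ^ k :: real) \<longlonglongrightarrow> 0" by (intro LIMSEQ_divide_realpow_zero) simp
  then have "\<forall>\<^sub>F k in sequentially. 1 / 2 ^ k < h" using h by (rule order_tendstoD)
  then show "\<forall>\<^sub>F k in sequentially. \<bar>mean x (1 / 2 ^ k) - mean x h\<bar> \<le> S * \<phi> x (2 * h)"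
    by eventually_elim (intro mean_telescope, auto)
qed simp

text \<open>With h = |x - y|, the cube of half-side h about y lies in that of half-side 2 h about x.
  Three of the four differences are charged to the modulus at x, one to the modulus at y.\<close>

lemma b'_diff:
  assumes "x \<noteq> y"
  shows "\<bar>b' x - b' y\<bar> \<le> 3 * S * (\<phi> x (4 * norm (x - y)) + \<phi> y (4 * norm (x - y)))"
proof -
  define h where "h = norm (x - y)"
  have h: "0 < h" using assms by (simp add: h_def)
  have comp: "\<bar>y $ i - x $ i\<bar> \<le> h" for i
    using component_le_norm_cart[of "x - y" i] by (simp add: h_def abs_minus_commute)
  have 1: "\<bar>mean x h - mean x (2 * h)\<bar> \<le> S * \<phi> x (4 * h)"
    using mean_telescope[of h "2 * h" x] h by simp
  have "\<bar>mean y h - mean x (2 * h)\<bar> \<le> 2 ^ CARD('n) * C * \<phi> x (2 * (2 * h))"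
    unfolding mean_def
  proof (rule mean_diff)
    show "cube (y - vec h) (2 * h) \<subseteq> cube (x - vec (2 * h)) (2 * (2 * h))"
    proof
      fix z assume "z \<in> cube (y - vec h) (2 * h)"
      then have z: "\<bar>z $ i - y $ i\<bar> \<le> h" for i unfolding mem_cube_centre by blast
      have "\<bar>z $ i - x $ i\<bar> \<le> 2 * h" for i using z[of i] comp[of i] by linarith
      then show "z \<in> cube (x - vec (2 * h)) (2 * (2 * h))" unfolding mem_cube_centre by blast
    qed
    show "x \<in> cube (x - vec (2 * h)) (2 * (2 * h))" unfolding mem_cube_centre using h by simp
  qed (use h in auto)
  also have "\<dots> \<le> S * \<phi> x (2 * (2 * h))" using S \<phi>_nonneg by (intro mult_right_mono) auto
  finally have 2: "\<bar>mean y h - mean x (2 * h)\<bar> \<le> S * \<phi> x (4 * h)" by simp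
  have half: "S * \<phi> z (2 * h) \<le> S * \<phi> z (4 * h)" for z
  proof (intro mult_left_mono S)
    have "\<phi> z (4 * h / 2) \<le> \<rho> * \<phi> z (4 * h)" using h by (intro \<phi>_half) auto
    also have "\<dots> \<le> \<phi> z (4 * h)" using \<rho> \<phi>_nonneg by (simp add: mult_left_le_one_le)
    finally show "\<phi> z (2 * h) \<le> \<phi> z (4 * h)" by simp
  qed
  have "\<bar>b' x - b' y\<bar> \<le> 3 * (S * \<phi> x (4 * h)) + S * \<phi> y (4 * h)"
    using b'_mean[OF h, of x] b'_mean[OF h, of y] half[of x] half[of y] 1 2 by linarith
  also have "\<dots> \<le> 3 * S * (\<phi> x (4 * h) + \<phi> y (4 * h))"
    using S(1) \<phi>_nonneg[of y] by (simp add: algebra_simps)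
  finally show ?thesis by (simp add: h_def)
qed

lemma b'_measurable [measurable]: "b' \<in> borel_measurable borel"
proof (rule borel_measurable_continuous_onI, unfold continuous_on_eq_continuous_at[OF open_UNIV] isCont_def, rule)
  fix x :: "real^'n"
  have lim: "((\<lambda>y. 6 * S * (4 * norm (x - y)) powr d) \<longlongrightarrow> 6 * S * 0) (at x)"
  proof (intro tendsto_mult tendsto_const)
    have "((\<lambda>y. 4 * norm (x - y)) \<longlongrightarrow> 4 * norm (x - x)) (at x)"
      by (intro tendsto_intros)
    then show "((\<lambda>y. (4 * norm (x - y)) powr d) \<longlongrightarrow> 0) (at x)"
      using d by (intro tendsto_zero_powrI[where b = d]) auto
  qed
  have "\<forall>\<^sub>F y in at x. norm (b' y - b' x) \<le> 6 * S * (4 * norm (x - y)) powr d"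
    unfolding eventually_at
  \<comment> \<open>Radius 1/4 keeps 4 |x - y| at most 1, where both moduli obey the uniform bound
    with exponent d.\<close>
  proof (intro exI[of _ "1/4"] conjI ballI impI)
    fix y assume "y \<noteq> x \<and> dist y x < 1 / 4"
    then have y: "x \<noteq> y" "4 * norm (x - y) \<le> 1" by (auto simp: dist_norm norm_minus_commute)
    have "\<bar>b' x - b' y\<bar> \<le> 3 * S * (\<phi> x (4 * norm (x - y)) + \<phi> y (4 * norm (x - y)))"
      by (rule b'_diff[OF y(1)])
    also have "\<dots> \<le> 3 * S * ((4 * norm (x - y)) powr d + (4 * norm (x - y)) powr d)"
      using y S(1) by (intro mult_left_mono add_mono \<phi>_small) auto
    finally show "norm (b' y - b' x) \<le> 6 * S * (4 * norm (x - y)) powr d"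
      by (simp add: abs_minus_commute)
  qed simp
  from Lim_null_comparison[OF this] lim show "(b' \<longlongrightarrow> b' x) (at x)"
    by (simp add: LIM_zero_iff)
qed

text \<open>On a cube of side l both b, in mean, and b', pointwise, differ from the cube mean by
  O(l^d). Hence |b - b'| has integral O(l^(n + d)) there, and bisection forces it to vanish almost
  everywhere.\<close>

lemma b'_AE: "AE x in lborel. b' x = b x"
proof -
  have "AE x in lborel. \<bar>b x - b' x\<bar> = 0"
  proof (rule AE_zero_of_small_cubes)
    \<comment> \<open>The modulus is used at 2 l, which explains the factor 2^d and the restriction
      to sides at most 1/2.\<close>
    show "0 \<le> 2 powr d * (C + 2 * S)" "0 < d" "0 < (1/2 :: real)" using C S d by auto
    fix a :: "real^'n" and l :: real assume l: "0 < l" "l \<le> 1 / 2"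
    let ?c = "cube_mean b a l"
    have \<phi>l: "\<phi> x (2 * l) \<le> 2 powr d * l powr d" "\<phi> x l \<le> 2 powr d * l powr d" for x
    proof -
      show "\<phi> x (2 * l) \<le> 2 powr d * l powr d"
        using \<phi>_small[of "2 * l" x] l by (simp add: powr_mult)
      have "\<phi> x l \<le> 1 * l powr d" using \<phi>_small[of l x] l by simp
      also have "\<dots> \<le> 2 powr d * l powr d" using d by (intro mult_right_mono ge_one_powr_ge_zero) auto
      finally show "\<phi> x l \<le> 2 powr d * l powr d" .
    qed
    have near: "\<bar>?c - b' x\<bar> \<le> 2 * S * (2 powr d * l powr d)" if x: "x \<in> cube a l" for x
    proof -
      have "\<bar>?c - mean x l\<bar> \<le> 2 ^ CARD('n) * C * \<phi> x (2 * l)"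
        unfolding mean_def
      proof (rule mean_diff)
        show "cube a l \<subseteq> cube (x - vec l) (2 * l)"
        proof
          fix y assume y: "y \<in> cube a l"
          have "\<bar>y $ i - x $ i\<bar> \<le> l" for i
          proof -
            have "a $ i \<le> x $ i \<and> x $ i \<le> a $ i + l" "a $ i \<le> y $ i \<and> y $ i \<le> a $ i + l"
              using x y by (auto simp: mem_box_cart)
            then show ?thesis by (simp add: abs_le_iff)
          qed
          then show "y \<in> cube (x - vec l) (2 * l)" unfolding mem_cube_centre by blast
        qed
        show "x \<in> cube (x - vec l) (2 * l)" unfolding mem_cube_centre using l by simp
      qed (use l in auto)
      also have "\<dots> \<le> S * \<phi> x (2 * l)" using S \<phi>_nonneg by (intro mult_right_mono) auto
      finally have "\<bar>?c - b' x\<bar> \<le> 2 * S * \<phi> x (2 * l)" using b'_mean[OF l(1), of x] by linarith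
      also have "\<dots> \<le> 2 * S * (2 powr d * l powr d)" using \<phi>l S by (intro mult_left_mono) auto
      finally show ?thesis .
    qed
    have a: "a \<in> cube a l" using l by (simp add: mem_box_cart)
    have "(\<integral>\<^sup>+y\<in>cube a l. ennreal \<bar>b y - b' y\<bar> \<partial>lborel)
       \<le> (\<integral>\<^sup>+y. ennreal \<bar>b y - ?c\<bar> * indicator (cube a l) y + ennreal (2 * S * (2 powr d * l powr d)) * indicator (cube a l) y \<partial>lborel)"
    proof (rule nn_integral_mono)
      fix y
      show "ennreal \<bar>b y - b' y\<bar> * indicator (cube a l) y
        \<le> ennreal \<bar>b y - ?c\<bar> * indicator (cube a l) y + ennreal (2 * S * (2 powr d * l powr d)) * indicator (cube a l) y"
      proof (cases "y \<in> cube a l")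
        case True
        have "\<bar>b y - b' y\<bar> \<le> \<bar>b y - ?c\<bar> + 2 * S * (2 powr d * l powr d)"
          using near[OF True] by linarith
        then show ?thesis using True S by (simp add: ennreal_plus[symmetric] ennreal_leI del: ennreal_plus)
      qed simp
    qed
    also have "\<dots> = (\<integral>\<^sup>+y\<in>cube a l. ennreal \<bar>b y - ?c\<bar> \<partial>lborel) + ennreal (2 * S * (2 powr d * l powr d)) * emeasure lborel (cube a l)"
    proof -
      have [measurable]: "cube a l \<in> sets borel" by simp
      show ?thesis by (subst nn_integral_add) (auto simp: nn_integral_cmult_indicator)
    qed
    also have "\<dots> \<le> ennreal (C * l ^ CARD('n) * \<phi> a l) + ennreal (2 * S * (2 powr d * l powr d)) * ennreal (l ^ CARD('n))"
      unfolding measure_cube(2)[OF l(1)] by (intro add_right_mono osc l a)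
    also have "\<dots> = ennreal (C * l ^ CARD('n) * \<phi> a l + 2 * S * (2 powr d * l powr d) * l ^ CARD('n))"
      using l C S \<phi>_nonneg by (simp add: ennreal_mult)
    also have "\<dots> \<le> ennreal (2 powr d * (C + 2 * S) * l ^ CARD('n) * l powr d)"
    proof (rule ennreal_leI)
      have "C * l ^ CARD('n) * \<phi> a l \<le> C * l ^ CARD('n) * (2 powr d * l powr d)"
        using \<phi>l(2) C l by (intro mult_left_mono) auto
      then show "C * l ^ CARD('n) * \<phi> a l + 2 * S * (2 powr d * l powr d) * l ^ CARD('n)
         \<le> 2 powr d * (C + 2 * S) * l ^ CARD('n) * l powr d" by (simp add: algebra_simps)
    qed
    finally show "(\<integral>\<^sup>+y\<in>cube a l. ennreal \<bar>b y - b' y\<bar> \<partial>lborel)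
      \<le> ennreal (2 powr d * (C + 2 * S) * l ^ CARD('n) * l powr d)" .
  qed auto
  then show ?thesis by eventually_elim simp
qed

end

subsection \<open>Bounded commutators have Lipschitz symbols\<close>

text \<open>The majorant h is left free: a constant 1/|Q| serves small cubes, whereas large ones
  need an additional multiple of the decay weight.\<close>

lemma var_norm_indicator_le:
  fixes s :: "real^'n::finite \<Rightarrow> real"
  assumes Q: "Q \<in> sets borel" and k: "0 < k"
    and h: "\<And>y. y \<in> Q \<Longrightarrow> (1 / k) powr s y \<le> h y"
    and int: "(\<integral>\<^sup>+y\<in>Q. ennreal (h y) \<partial>lborel) \<le> 1"
  shows "var_norm s (\<lambda>x. ennreal \<bar>indicator Q x\<bar>) \<le> ennreal k"
    and "(indicator Q :: real^'n \<Rightarrow> real) \<in> var_Lp s"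
proof -
  have "var_modular s (\<lambda>x. ennreal \<bar>indicator Q x\<bar> / ennreal k) \<le> (\<integral>\<^sup>+y\<in>Q. ennreal (h y) \<partial>lborel)"
    unfolding var_modular_def nn_integral_completion
  proof (rule nn_integral_mono)
    fix y
    show "ennreal_powr (ennreal \<bar>indicator Q y\<bar> / ennreal k) (s y) \<le> ennreal (h y) * indicator Q y"
      using k h[of y] by (cases "y \<in> Q") (auto simp: divide_ennreal[of 1, simplified] ennreal_powr_ennreal ennreal_leI ennreal_powr_def)
  qed
  then have mod: "var_modular s (\<lambda>x. ennreal \<bar>indicator Q x\<bar> / ennreal k) \<le> 1" using int by (rule order_trans)
  show "var_norm s (\<lambda>x. ennreal \<bar>indicator Q x\<bar>) \<le> ennreal k"
    using k mod by (rule var_norm_le)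
  have "var_modular s (\<lambda>x. ennreal \<bar>indicator Q x\<bar> / ennreal k) < \<infinity>"
    using mod by (rule order_le_less_trans) simp
  then show "(indicator Q :: real^'n \<Rightarrow> real) \<in> var_Lp s"
    unfolding var_Lp_def using k Q by (auto intro!: borel_measurable_indicator)
qed

context log_holder
begin

text \<open>Since s y \<ge> 1, the power (1/K)^(s y) is at most 1/K, which pays for the factor K
  lost when s y is replaced by s x.\<close>

lemma small_cube_indicator:
  assumes l: "0 < l" "l \<le> 1" and x: "x \<in> cube a l"
  shows "var_norm s (\<lambda>x. ennreal \<bar>indicator (cube a l) x\<bar>)
      \<le> ennreal (local_const TYPE('n) C * (l ^ CARD('n)) powr (1 / s x))"
    and "(indicator (cube a l) :: real^'n \<Rightarrow> real) \<in> var_Lp s"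
proof -
  define V where "V = l ^ CARD('n)"
  define K where "K = local_const TYPE('n) C"
  have V: "0 < V" using l by (simp add: V_def)
  have K: "1 \<le> K" unfolding K_def by (rule local_const_ge_1[OF C_nonneg])
  have sx: "1 \<le> s x" by (rule lower)
  define k where "k = K * V powr (1 / s x)"
  have k: "0 < k" using K V by (simp add: k_def)
  have h: "(1 / k) powr s y \<le> 1 / V" if y: "y \<in> cube a l" for y
  proof -
    have "\<bar>(s x - s y) / s x\<bar> \<le> \<bar>s x - s y\<bar>"
      using sx by (simp add: abs_divide divide_le_eq mult_le_cancel_left1)
    then have loc: "V powr ((s x - s y) / s x) \<le> K"
      unfolding V_def K_def using l x y by (intro small_cube_powr)
    have e: "- (s y / s x) = (s x - s y) / s x - 1" using sx by (simp add: field_simps)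
    have "(1 / k) powr s y = (1 / K) powr s y * V powr (- (s y / s x))"
      using K V by (simp add: k_def powr_mult powr_divide powr_powr powr_minus_divide)
    also have "\<dots> = (1 / K) powr s y * (V powr ((s x - s y) / s x) * (1 / V))"
      unfolding e using V by (simp add: powr_diff)
    also have "\<dots> \<le> (1 / K) powr 1 * (K * (1 / V))"
      using K V loc lower[of y] by (intro mult_mono powr_mono') auto
    finally show ?thesis using K by simp
  qed
  have "(\<integral>\<^sup>+y\<in>cube a l. ennreal (1 / V) \<partial>lborel) = ennreal (1 / V) * ennreal V"
    using measure_cube(2)[OF l(1), of a] by (simp add: nn_integral_cmult_indicator V_def)
  also have "\<dots> = 1" using V by (simp flip: ennreal_mult)
  finally have int: "(\<integral>\<^sup>+y\<in>cube a l. ennreal (1 / V) \<partial>lborel) \<le> 1" by simp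
  have Q: "cube a l \<in> sets borel" by simp
  show "var_norm s (\<lambda>x. ennreal \<bar>indicator (cube a l) x\<bar>)
      \<le> ennreal (local_const TYPE('n) C * (l ^ CARD('n)) powr (1 / s x))"
    using var_norm_indicator_le(1)[OF Q k h int] by (simp add: k_def K_def V_def)
  show "(indicator (cube a l) :: real^'n \<Rightarrow> real) \<in> var_Lp s"
    using var_norm_indicator_le(2)[OF Q k h int] .
qed

text \<open>At the chosen scale the modular is at most (E + \<open>decay_const\<close>) /
  \<open>large_const\<close>, the two terms coming from the exponent exchange, and
  \<open>large_const\<close> exceeds the numerator.\<close>

lemma large_cube_indicator:
  assumes l: "1 \<le> l"
  shows "var_norm s (\<lambda>x. ennreal \<bar>indicator (cube a l) x\<bar>)
      \<le> ennreal (large_const * (l ^ CARD('n)) powr (1 / s_inf))"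
    and "(indicator (cube a l) :: real^'n \<Rightarrow> real) \<in> var_Lp s"
proof -
  define V where "V = l ^ CARD('n)"
  define E where "E = exp (2 * real CARD('n) * C)"
  have V: "1 \<le> V" using l by (simp add: V_def)
  have K: "1 \<le> large_const" by (rule large_const_ge_1)
  have E: "0 \<le> E" by (simp add: E_def)
  have si: "1 \<le> s_inf" by (rule inf_lower)
  define t where "t = V powr (- 1 / s_inf)"
  have t: "0 \<le> t" "t \<le> 1" "t powr s_inf = 1 / V"
  proof -
    show "t \<le> 1" using V si by (simp add: t_def powr_minus_divide ge_one_powr_ge_zero)
    show "t powr s_inf = 1 / V" using V si unfolding t_def powr_powr by (simp add: powr_minus_divide)
  qed (simp add: t_def)
  define k where "k = large_const * V powr (1 / s_inf)"
  have k: "0 < k" using K V by (simp add: k_def)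
  have kt: "1 / k = (1 / large_const) * t" by (simp add: k_def t_def powr_minus_divide)
  have h: "(1 / k) powr s y \<le> 1 / large_const * (E * (1 / V) + decay_weight y)" for y
  proof -
    have "(1 / k) powr s y = (1 / large_const) powr s y * t powr s y"
      unfolding kt by (rule powr_mult)
    also have "\<dots> \<le> (1 / large_const) powr 1 * (E * (1 / V) + decay_weight y)"
      using K lower[of y] powr_le_powr_inf[OF t(1,2), of y] unfolding t(3) E_def
      by (intro mult_mono powr_mono') auto
    finally show ?thesis using K by simp
  qed
  have [measurable]: "cube a l \<in> sets borel" by simp
  have "(\<integral>\<^sup>+y\<in>cube a l. ennreal (1 / large_const * (E * (1 / V) + decay_weight y)) \<partial>lborel)
     \<le> (\<integral>\<^sup>+y. ennreal (1 / large_const * (E * (1 / V))) * indicator (cube a l) y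
        + ennreal (1 / large_const) * ennreal (decay_weight y) \<partial>lborel)"
  proof (rule nn_integral_mono)
    fix y
    show "ennreal (1 / large_const * (E * (1 / V) + decay_weight y)) * indicator (cube a l) y
      \<le> ennreal (1 / large_const * (E * (1 / V))) * indicator (cube a l) y
        + ennreal (1 / large_const) * ennreal (decay_weight y)"
      using K E V decay_weight_pos[of y]
      by (cases "y \<in> cube a l") (simp_all add: ennreal_mult[symmetric] ennreal_plus[symmetric] distrib_left add_divide_distrib del: ennreal_plus)
  qed
  also have "\<dots> = ennreal (1 / large_const * (E * (1 / V))) * ennreal V + ennreal (1 / large_const) * ennreal (decay_const TYPE('n))"
    using l measure_cube(2)[of l a]
    by (simp add: nn_integral_add nn_integral_cmult nn_integral_cmult_indicator decay_const V_def)
  also have "\<dots> = ennreal ((E + decay_const TYPE('n)) / large_const)"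
    using K E V decay_const(2)[where 'n='n]
    by (simp add: ennreal_mult[symmetric] ennreal_plus[symmetric] add_divide_distrib del: ennreal_plus)
  also have "\<dots> \<le> ennreal 1"
    using K by (intro ennreal_leI) (simp add: large_const_def E_def)
  finally have int: "(\<integral>\<^sup>+y\<in>cube a l. ennreal (1 / large_const * (E * (1 / V) + decay_weight y)) \<partial>lborel) \<le> 1"
    by simp
  have Q: "cube a l \<in> sets borel" by simp
  show "var_norm s (\<lambda>x. ennreal \<bar>indicator (cube a l) x\<bar>)
      \<le> ennreal (large_const * (l ^ CARD('n)) powr (1 / s_inf))"
    using var_norm_indicator_le(1)[OF Q k h int] by (simp add: k_def V_def)
  show "(indicator (cube a l) :: real^'n \<Rightarrow> real) \<in> var_Lp s"
    using var_norm_indicator_le(2)[OF Q k h int] .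
qed

end

text \<open>Measurability is available only cube by cube. Borel versions of b cut off to growing
  cubes are eventually equal to b x at almost every x, so their pointwise limit glues them
  together.\<close>

lemma locally_integrable_borel_version:
  fixes b :: "real^'n::finite \<Rightarrow> real"
  assumes "locally_integrable b"
  obtains b0 where "b0 \<in> borel_measurable borel" "AE x in lborel. b x = b0 x"
    "\<And>a l. set_integrable lborel (cube a l) b0"
proof -
  have int: "set_integrable lebesgue (cube a l) b" for a l
    using assms unfolding locally_integrable_def by simp
  have "\<exists>f \<in> borel_measurable lborel. AE x in lborel. indicator (cube (vec (- real k)) (2 * real k)) x * b x = f x" for k :: nat
  proof -
    have "integrable lebesgue (\<lambda>x. indicator (cube (vec (- real k)) (2 * real k)) x *\<^sub>R b x)"
      using int[of "vec (- real k)" "2 * real k"] unfolding set_integrable_def .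
    from borel_measurable_integrable[OF this] show ?thesis
      unfolding real_scaleR_def by (rule completion_ex_borel_measurable_real)
  qed
  then have "\<forall>k::nat. \<exists>f. f \<in> borel_measurable lborel \<and>
      (AE x in lborel. indicator (cube (vec (- real k)) (2 * real k)) x * b x = f x)"
    unfolding Bex_def by (rule allI)
  from choice[OF this] obtain f where f_all: "\<forall>k::nat. f k \<in> borel_measurable lborel \<and>
      (AE x in lborel. indicator (cube (vec (- real k)) (2 * real k)) x * b x = f k x)" by (rule exE)
  note f = f_all[THEN spec, THEN conjunct1] f_all[THEN spec, THEN conjunct2]
  define b0 where "b0 x = lim (\<lambda>k. f k x)" for x
  have [measurable]: "f k \<in> borel_measurable borel" for k using f(1) by simp
  have b0: "b0 \<in> borel_measurable borel" unfolding b0_def by measurable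
  have "AE x in lborel. \<forall>k. indicator (cube (vec (- real k)) (2 * real k)) x * b x = f k x"
    using f(2) by (simp add: AE_all_countable)
  then have ae: "AE x in lborel. b x = b0 x"
  proof eventually_elim
    case (elim x)
    obtain N :: nat where N: "norm x \<le> real N" using real_arch_simple by blast
    have "f k x = b x" if "N \<le> k" for k
    proof -
      have "- real k \<le> x $ i \<and> x $ i \<le> real k" for i
        using component_le_norm_cart[of x i] N that by linarith
      then have "x \<in> cube (vec (- real k)) (2 * real k)" by (simp add: mem_box_cart)
      then show ?thesis using elim[rule_format, of k] by simp
    qed
    then have "(\<lambda>k. f k x) \<longlonglongrightarrow> b x"
      by (intro tendsto_eventually) (auto simp: eventually_sequentially)
    then show ?case unfolding b0_def by (simp add: limI)
  qed
  have "set_integrable lborel (cube a l) b0" for a l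
  proof -
    have "set_integrable lebesgue (cube a l) b0"
      unfolding set_integrable_def
    proof (rule integrable_cong_AE_imp)
      show "integrable lebesgue (\<lambda>x. indicator (cube a l) x *\<^sub>R b x)"
        using int unfolding set_integrable_def .
      show "(\<lambda>x. indicator (cube a l) x *\<^sub>R b0 x) \<in> borel_measurable lebesgue"
        using b0 by (intro measurable_completion) simp
      show "AE x in lebesgue. indicator (cube a l) x *\<^sub>R b x = indicator (cube a l) x *\<^sub>R b0 x"
        using ae by (intro AE_completion) auto
    qed
    then show ?thesis
      unfolding set_integrable_def using b0 by (subst (asm) integrable_completion) simp_all
  qed
  with b0 ae show thesis by (rule that)
qed

section \<open>From the commutator bound to mean oscillation and back to a modulus of
  continuity\<close>

context frac_exponents
begin

text \<open>For f the indicator of Q, the commutator dominates |Q|^(\<alpha>/n) |b - mean| almost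
  everywhere on Q, because |Q| |b y - mean| is at most the integral of |b y - b z| over z in Q. The
  hypothesis \<open>test\<close> then plays the part of Hoelder's inequality in the variable
  space.\<close>

lemma oscillation_le:
  fixes \<alpha> :: real
  assumes C0: "0 < C0" and Ck: "0 < k" and M: "0 \<le> M" and l: "0 < l"
    and bdd: "\<And>f. f \<in> var_Lp r \<Longrightarrow> var_norm q (frac_max_commutator \<alpha> b f) \<le> ennreal C0 * var_norm r (\<lambda>x. ennreal \<bar>f x\<bar>)"
    and b0 [measurable]: "b0 \<in> borel_measurable borel" and ae: "AE x in lborel. b x = b0 x"
    and int: "set_integrable lborel (cube a l) b0"
    and k: "var_norm r (\<lambda>x. ennreal \<bar>indicator (cube a l) x\<bar>) \<le> ennreal k"
      "(indicator (cube a l) :: real^'n \<Rightarrow> real) \<in> var_Lp r"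
    and test: "\<And>g. \<lbrakk>g \<in> borel_measurable borel; \<And>y. 0 \<le> g y; (\<integral>\<^sup>+y. ennreal (g y powr q y) \<partial>lborel) \<le> 1\<rbrakk>
      \<Longrightarrow> (\<integral>\<^sup>+y\<in>cube a l. ennreal (g y) \<partial>lborel) \<le> ennreal M"
  shows "(\<integral>\<^sup>+y\<in>cube a l. ennreal \<bar>b0 y - cube_mean b0 a l\<bar> \<partial>lborel)
     \<le> ennreal (2 * C0 * k * (l ^ CARD('n)) powr (- \<alpha> / n) * M)"
proof -
  define Q where "Q = cube a l"
  define V where "V = l ^ CARD('n)"
  define c where "c = cube_mean b0 a l"
  \<comment> \<open>The factor 2 puts k' strictly above the bound C0 * k on the norm, so an
    admissible j below k' exists even if the infimum is not attained.\<close>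
  define k' where "k' = 2 * C0 * k"
  have V: "0 < V" using l by (simp add: V_def)
  have k': "0 < k'" using C0 Ck by (simp add: k'_def)
  have [measurable]: "Q \<in> sets borel" by (simp add: Q_def)
  let ?T = "frac_max_commutator \<alpha> b (indicator Q)"
  have "var_norm q ?T \<le> ennreal C0 * ennreal k"
    using bdd[OF k(2)] k(1) mult_left_mono[of _ _ "ennreal C0"] unfolding Q_def by (meson order_trans zero_le)
  also have "\<dots> = ennreal (C0 * k)" using C0 Ck by (simp add: ennreal_mult)
  also have "\<dots> < ennreal k'" using C0 Ck by (simp add: k'_def ennreal_less_iff)
  finally obtain j where j: "0 < j" "ennreal j < ennreal k'" "var_modular q (\<lambda>x. ?T x / ennreal j) \<le> 1"
    unfolding var_norm_def Inf_less_iff by blast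
  have jk: "j \<le> k'" using j by (simp add: ennreal_less_iff)
  define g where "g y = indicator Q y * (V powr (\<alpha> / n) * \<bar>b0 y - c\<bar> / k')" for y
  have [measurable]: "g \<in> borel_measurable borel" unfolding g_def by measurable
  have g0: "0 \<le> g y" for y using k' by (simp add: g_def)
  have mQ: "measure lborel Q = V" "measure lebesgue Q = V"
    using measure_cube(1)[OF l, of a] by (simp_all add: Q_def V_def measure_completion)
  have gT: "ennreal (g y) \<le> ?T y / ennreal j" if "b y = b0 y" for y
  proof (cases "y \<in> Q")
    case True
    have intc: "set_integrable lborel Q (\<lambda>_. b0 y)"
      unfolding set_integrable_def Q_def using emeasure_lborel_cbox_finite[of a "\<chi> i. a $ i + l"]
      by (intro integrable_scaleR_left integrable_real_indicator) auto
    have intd: "set_integrable lborel Q (\<lambda>z. b0 y - b0 z)"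
      using intc int unfolding Q_def by (rule set_integral_diff(1))
    have "V * \<bar>b0 y - c\<bar> = \<bar>V * (b0 y - c)\<bar>" using V by (simp add: abs_mult)
    also have "V * (b0 y - c) = V * b0 y - (LINT z:Q|lborel. b0 z)"
      using l by (simp add: c_def cube_mean_def Q_def V_def right_diff_distrib)
    also have "V * b0 y - (LINT z:Q|lborel. b0 z) = (LINT z:Q|lborel. b0 y - b0 z)"
      using set_integral_diff(2)[OF intc int[folded Q_def]] by (simp add: set_lebesgue_integral_def mQ)
    also have "\<bar>\<dots>\<bar> \<le> (LINT z:Q|lborel. \<bar>b0 y - b0 z\<bar>)"
      using set_integral_norm_bound[OF intd] by simp
    finally have "ennreal (V * \<bar>b0 y - c\<bar>) \<le> ennreal (LINT z:Q|lborel. \<bar>b0 y - b0 z\<bar>)"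
      by (rule ennreal_leI)
    also have "\<dots> = (\<integral>\<^sup>+z\<in>Q. ennreal \<bar>b0 y - b0 z\<bar> \<partial>lborel)"
      using set_integrable_abs[OF intd]
      unfolding set_lebesgue_integral_def set_integrable_def
      by (subst nn_integral_eq_integral[symmetric]) (auto intro!: nn_integral_cong simp: indicator_def)
    also have "\<dots> = (\<integral>\<^sup>+z\<in>Q. ennreal (\<bar>b y - b z\<bar> * \<bar>indicator Q z\<bar>) \<partial>lebesgue)"
      unfolding nn_integral_completion
    proof (rule nn_integral_cong_AE)
      show "AE z in lborel. ennreal \<bar>b0 y - b0 z\<bar> * indicator Q z = ennreal (\<bar>b y - b z\<bar> * \<bar>indicator Q z\<bar>) * indicator Q z"
        using ae by eventually_elim (simp add: that indicator_def)
    qed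
    finally have "ennreal (V * \<bar>b0 y - c\<bar>) / ennreal (V powr (1 - \<alpha> / n))
       \<le> (\<integral>\<^sup>+z\<in>Q. ennreal (\<bar>b y - b z\<bar> * \<bar>indicator Q z\<bar>) \<partial>lebesgue) / ennreal (V powr (1 - \<alpha> / n))"
      by (rule divide_right_mono_ennreal)
    also have "\<dots> = (\<integral>\<^sup>+z\<in>Q. ennreal (\<bar>b y - b z\<bar> * \<bar>indicator Q z\<bar>) \<partial>lebesgue)
        / ennreal (measure lebesgue Q powr (1 - \<alpha> / real CARD('n)))"
      by (simp add: mQ n_def)
    also have "\<dots> \<le> ?T y"
      unfolding frac_max_commutator_def
    proof (rule SUP_upper)
      show "Q \<in> {Q \<in> cubes. y \<in> Q}" using True l unfolding Q_def cubes_def by blast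
    qed
    also have "ennreal (V * \<bar>b0 y - c\<bar>) / ennreal (V powr (1 - \<alpha> / n)) = ennreal (V powr (\<alpha> / n) * \<bar>b0 y - c\<bar>)"
      using V by (simp add: divide_ennreal powr_diff)
    finally have "ennreal (V powr (\<alpha> / n) * \<bar>b0 y - c\<bar>) / ennreal j \<le> ?T y / ennreal j"
      by (rule divide_right_mono_ennreal)
    moreover have "ennreal (g y) \<le> ennreal (V powr (\<alpha> / n) * \<bar>b0 y - c\<bar>) / ennreal j"
      using True j(1) jk k' by (simp add: g_def divide_ennreal ennreal_leI divide_left_mono)
    ultimately show ?thesis by (rule order_trans[rotated])
  qed (simp add: g_def)
  have "(\<integral>\<^sup>+y. ennreal (g y powr q y) \<partial>lborel) \<le> var_modular q (\<lambda>x. ?T x / ennreal j)"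
    unfolding var_modular_def nn_integral_completion
  proof (rule nn_integral_mono_AE)
    show "AE y in lborel. ennreal (g y powr q y) \<le> ennreal_powr (?T y / ennreal j) (q y)"
      using ae
    proof eventually_elim
      case (elim y)
      then show ?case
        using ennreal_powr_mono[OF gT, of y "q y"] q.lower[of y] g0[of y] by (simp add: ennreal_powr_ennreal)
    qed
  qed
  then have "(\<integral>\<^sup>+y. ennreal (g y powr q y) \<partial>lborel) \<le> 1" using j(3) by (rule order_trans)
  then have gM: "(\<integral>\<^sup>+y\<in>Q. ennreal (g y) \<partial>lborel) \<le> ennreal M"
    unfolding Q_def using g0 by (intro test) auto
  have "(\<integral>\<^sup>+y\<in>Q. ennreal \<bar>b0 y - c\<bar> \<partial>lborel) = (\<integral>\<^sup>+y. ennreal (k' * V powr (- \<alpha> / n)) * (ennreal (g y) * indicator Q y) \<partial>lborel)"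
    using k' V by (intro nn_integral_cong) (auto simp: g_def indicator_def powr_minus_divide simp flip: ennreal_mult)
  also have "\<dots> = ennreal (k' * V powr (- \<alpha> / n)) * (\<integral>\<^sup>+y\<in>Q. ennreal (g y) \<partial>lborel)"
    by (rule nn_integral_cmult) simp
  also have "\<dots> \<le> ennreal (k' * V powr (- \<alpha> / n)) * ennreal M"
    using gM by (rule mult_left_mono) simp
  also have "\<dots> = ennreal (2 * C0 * k * V powr (- \<alpha> / n) * M)"
    using k' M by (simp add: k'_def ennreal_mult)
  finally show ?thesis by (simp add: Q_def V_def c_def)
qed

lemma bounded_imp_var_Lipschitz:
  fixes \<alpha> d0 :: real and \<delta> b :: "real^'n \<Rightarrow> real"
  defines "\<delta>_inf \<equiv> n * (1 / r_inf - 1 / q_inf) - \<alpha>"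
  assumes \<gamma>_eq: "\<And>x. \<gamma> x = \<alpha> + \<delta> x" and \<delta>: "\<And>x. d0 \<le> \<delta> x" "0 < d0" "\<And>x. \<delta> x < real CARD('n)" "\<And>x. \<delta>_inf \<le> \<delta> x"
    and b: "locally_integrable b"
    and bdd: "bounded_var_Lp r q (frac_max_commutator \<alpha> b)"
  shows "b \<in> var_Lipschitz \<delta>"
proof -
  have \<delta>_eq: "\<delta> x / n = 1 / r x - 1 / q x - \<alpha> / n" for x
    using \<gamma>_n[of x] by (simp add: \<gamma>_eq add_divide_distrib)
  have \<delta>_inf_eq: "\<delta>_inf / n = 1 / r_inf - 1 / q_inf - \<alpha> / n"
    using n_ge_1 by (simp add: \<delta>_inf_def diff_divide_distrib)
  \<comment> \<open>\<delta>_inf is the limit of \<delta> at infinity, so the uniform lower bound d0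
    is inherited.\<close>
  have d0_inf: "d0 \<le> \<delta>_inf"
  proof (rule tendsto_lowerbound[OF _ _ trivial_limit_at_infinity])
    show "((\<lambda>x. n * (1 / r x - 1 / q x) - \<alpha>) \<longlongrightarrow> \<delta>_inf) at_infinity"
      unfolding \<delta>_inf_def using r.inf_lower q.inf_lower
      by (intro tendsto_intros r.tendsto_at_infinity q.tendsto_at_infinity) auto
    have "n * (1 / r x - 1 / q x) - \<alpha> = \<delta> x" for x using \<gamma>[of x] by (simp add: \<gamma>_eq n_def)
    then show "\<forall>\<^sub>F x in at_infinity. d0 \<le> n * (1 / r x - 1 / q x) - \<alpha>" using \<delta>(1) by simp
  qed
  obtain C1 where C1: "\<And>f. f \<in> var_Lp r \<Longrightarrow>
      var_norm q (frac_max_commutator \<alpha> b f) \<le> ennreal C1 * var_norm r (\<lambda>x. ennreal \<bar>f x\<bar>)"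
    using bdd unfolding bounded_var_Lp_def by blast
  \<comment> \<open>The given constant may be nonpositive, whereas \<open>oscillation_le\<close>
    needs strict positivity for its strict inequality.\<close>
  define C0 where "C0 = \<bar>C1\<bar> + 1"
  have C0: "0 < C0" by (simp add: C0_def add_nonneg_pos)
  have bd: "var_norm q (frac_max_commutator \<alpha> b f) \<le> ennreal C0 * var_norm r (\<lambda>x. ennreal \<bar>f x\<bar>)"
    if "f \<in> var_Lp r" for f
    using C1[OF that] by (rule order_trans) (intro mult_right_mono ennreal_leI, auto simp: C0_def)
  obtain b0 where b0 [measurable]: "b0 \<in> borel_measurable borel" and ae: "AE x in lborel. b x = b0 x"
    and int: "\<And>a l. set_integrable lborel (cube a l) b0"
    using locally_integrable_borel_version[OF b] by blast
  \<comment> \<open>Up to side 1 the exponent at the point governs the oscillation, beyond that only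
    its limit; both branches equal 1 at side 1.\<close>
  define \<phi> where "\<phi> x l = (if l \<le> 1 then l powr \<delta> x else l powr \<delta>_inf)" for x l
  define Kr where "Kr = local_const TYPE('n) Cr + r.large_const"
  define Kq where "Kq = 1 + local_const TYPE('n) Cq + q.large_const"
  have loc: "1 \<le> local_const TYPE('n) Cr" "1 \<le> local_const TYPE('n) Cq"
    using local_const_ge_1 r.C_nonneg q.C_nonneg by auto
  have K: "0 < Kr" "0 < Kq"
    using loc r.large_const_ge_1 q.large_const_ge_1 by (auto simp: Kr_def Kq_def)
  define C where "C = 2 * C0 * Kr * Kq"
  have C: "0 \<le> C" using C0 K by (simp add: C_def)
  have combine: "2 * C0 * (k1 * V powr u) * V powr (- \<alpha> / n) * (k2 * V powr (1 - v)) \<le> C * V * V powr ((u - v) - \<alpha> / n)"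
    if "0 < V" "0 \<le> k1" "k1 \<le> Kr" "0 \<le> k2" "k2 \<le> Kq" for V k1 k2 u v
  proof -
    have e: "V powr u * V powr (- \<alpha> / n) * V powr (1 - v) = V * V powr ((u - v) - \<alpha> / n)"
      using that(1) by (simp add: powr_diff powr_minus_divide mult_ac)
    have "2 * C0 * (k1 * V powr u) * V powr (- \<alpha> / n) * (k2 * V powr (1 - v))
      = 2 * C0 * (k1 * k2) * (V powr u * V powr (- \<alpha> / n) * V powr (1 - v))" by (simp only: mult_ac)
    also have "\<dots> = 2 * C0 * (k1 * k2) * (V * V powr ((u - v) - \<alpha> / n))" by (simp only: e)
    also have "\<dots> \<le> 2 * C0 * (Kr * Kq) * (V * V powr ((u - v) - \<alpha> / n))"
      using that C0 K by (intro mult_right_mono mult_left_mono mult_mono) auto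
    finally show ?thesis by (simp only: C_def mult.assoc)
  qed
  have pow: "(l ^ CARD('n)) powr (u / n) = l powr u" if "0 < l" for l u
    using that n_ge_1 by (simp add: n_def powr_powr flip: powr_realpow)
  interpret campanato b0 \<phi> C "2 powr (- d0)" d0
  proof
    fix x a :: "real^'n" and l :: real
    show "b0 \<in> borel_measurable borel" by simp
    show "set_integrable lborel (cube a l) b0" by (rule int)
    show "0 \<le> \<phi> x l" by (simp add: \<phi>_def)
    show "0 \<le> 2 powr (- d0)" "2 powr (- d0) < 1" "0 < d0" "0 \<le> C"
      using \<delta>(2) C by (auto simp: powr_minus_divide)
    assume l: "0 < l"
    have half: "(l / 2) powr u \<le> 2 powr (- d0) * l powr u" if "d0 \<le> u" for u
    proof -
      have "(l / 2) powr u = 2 powr (- u) * l powr u" by (simp add: powr_divide powr_minus_divide)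
      also have "\<dots> \<le> 2 powr (- d0) * l powr u" using that by (intro mult_right_mono powr_mono) auto
      finally show ?thesis .
    qed
    consider "l \<le> 1" | "1 < l" "l \<le> 2" | "2 < l" by linarith
    then show "\<phi> x (l / 2) \<le> 2 powr (- d0) * \<phi> x l"
    proof cases
      case 1
      then show ?thesis using half[OF \<delta>(1)] by (simp add: \<phi>_def)
    next
      \<comment> \<open>Halving crosses side 1, so the exponent changes from \<delta>_inf to
        \<delta> x. Both are compared with the common lower bound d0: l/2 <= 1 allows lowering the
        exponent, l > 1 allows raising it again.\<close>
      case 2
      have "(l / 2) powr \<delta> x \<le> (l / 2) powr d0" using 2 \<delta>(1) by (intro powr_mono') auto
      also have "\<dots> \<le> 2 powr (- d0) * l powr d0" by (rule half) simp
      also have "\<dots> \<le> 2 powr (- d0) * l powr \<delta>_inf" using 2 d0_inf by (intro mult_left_mono powr_mono) auto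
      finally show ?thesis using 2 by (simp add: \<phi>_def)
    next
      case 3
      then show ?thesis using half[OF d0_inf] by (simp add: \<phi>_def)
    qed
    show "\<phi> x l \<le> l powr d0" if "l \<le> 1"
      using that l \<delta>(1)[of x] by (simp add: \<phi>_def powr_mono')
    assume x: "x \<in> cube a l"
    define V where "V = l ^ CARD('n)"
    have V: "0 < V" using l by (simp add: V_def)
    show "(\<integral>\<^sup>+y\<in>cube a l. ennreal \<bar>b0 y - cube_mean b0 a l\<bar> \<partial>lborel) \<le> ennreal (C * l ^ CARD('n) * \<phi> x l)"
    proof (cases "l \<le> 1")
      case True
      have "(\<integral>\<^sup>+y\<in>cube a l. ennreal \<bar>b0 y - cube_mean b0 a l\<bar> \<partial>lborel)
         \<le> ennreal (2 * C0 * (local_const TYPE('n) Cr * V powr (1 / r x)) * V powr (- \<alpha> / n)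
            * ((1 + local_const TYPE('n) Cq) * V powr (1 - 1 / q x)))"
        unfolding V_def
        by (rule oscillation_le[OF C0 _ _ l bd b0 ae int r.small_cube_indicator[OF l True x] q.integral_small_cube_le[OF l True x]])
          (use l loc in auto)
      also have "\<dots> \<le> ennreal (C * V * V powr ((1 / r x - 1 / q x) - \<alpha> / n))"
        using loc r.large_const_ge_1 q.large_const_ge_1
        by (intro ennreal_leI combine V) (auto simp: Kr_def Kq_def)
      also have "V powr ((1 / r x - 1 / q x) - \<alpha> / n) = \<phi> x l"
        using True pow[OF l, of "\<delta> x"] by (simp add: \<phi>_def \<delta>_eq V_def)
      finally show ?thesis by (simp add: V_def)
    next
      case False
      then have l1: "1 \<le> l" by simp
      have "(\<integral>\<^sup>+y\<in>cube a l. ennreal \<bar>b0 y - cube_mean b0 a l\<bar> \<partial>lborel)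
         \<le> ennreal (2 * C0 * (r.large_const * V powr (1 / r_inf)) * V powr (- \<alpha> / n)
            * (q.large_const * V powr (1 - 1 / q_inf)))"
        unfolding V_def
        by (rule oscillation_le[OF C0 _ _ l bd b0 ae int r.large_cube_indicator[OF l1] q.integral_large_cube_le[OF l1]])
          (use l r.large_const_ge_1 q.large_const_ge_1 in auto)
      also have "\<dots> \<le> ennreal (C * V * V powr ((1 / r_inf - 1 / q_inf) - \<alpha> / n))"
        using loc r.large_const_ge_1 q.large_const_ge_1
        by (intro ennreal_leI combine V) (auto simp: Kr_def Kq_def)
      also have "V powr ((1 / r_inf - 1 / q_inf) - \<alpha> / n) = \<phi> x l"
        using False pow[OF l, of "\<delta>_inf"] by (simp add: \<phi>_def \<delta>_inf_eq V_def)
      finally show ?thesis by (simp add: V_def)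
    qed
  qed
  define P where "P = local_const TYPE('n) (Cr + Cq)"
  have P: "1 \<le> P" unfolding P_def using r.C_nonneg q.C_nonneg by (intro local_const_ge_1) simp
  \<comment> \<open>Up to 4 |x - y| = 1 log-Hoelder continuity of 1/r and 1/q controls \<delta> y -
    \<delta> x; beyond that the modulus no longer depends on the point, and \<delta>_inf <= \<delta>
    x finishes.\<close>
  have swap: "\<phi> y (4 * norm (x - y)) \<le> P * (4 * norm (x - y)) powr \<delta> x" if xy: "x \<noteq> y" for x y
  proof (cases "4 * norm (x - y) \<le> 1")
    case True
    define u where "u = 4 * norm (x - y)"
    have u: "0 < u" "u \<le> 1" using xy True by (auto simp: u_def)
    define th where "th = (\<delta> y - \<delta> x) / n"
    have th: "\<bar>th\<bar> \<le> (Cr + Cq) / ln (exp 1 + 1 / norm (x - y))"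
    proof -
      have "th = (1 / r y - 1 / r x) - (1 / q y - 1 / q x)"
        by (simp add: th_def diff_divide_distrib \<delta>_eq)
      moreover have "\<bar>1 / r y - 1 / r x\<bar> \<le> Cr / ln (exp 1 + 1 / norm (x - y))"
        using abs_inverse_diff_le[OF r.lower[of y] r.lower[of x]] r.local[of x y] by linarith
      moreover have "\<bar>1 / q y - 1 / q x\<bar> \<le> Cq / ln (exp 1 + 1 / norm (x - y))"
        using abs_inverse_diff_le[OF q.lower[of y] q.lower[of x]] q.local[of x y] by linarith
      ultimately show ?thesis unfolding add_divide_distrib by linarith
    qed
    \<comment> \<open>The exponent bound is phrased for cubes; the one of side 4 |x - y| centred at
      x contains both points.\<close>
    have in_cube: "x \<in> cube (x - vec (u / 2)) u" "y \<in> cube (x - vec (u / 2)) u"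
    proof -
      have "\<bar>z $ i - x $ i\<bar> \<le> u / 2" if "z \<in> {x, y}" for z i
        using component_le_norm_cart[of "x - y" i] u that by (auto simp: u_def abs_minus_commute)
      then show "x \<in> cube (x - vec (u / 2)) u" "y \<in> cube (x - vec (u / 2)) u"
        using mem_cube_centre[of _ x "u / 2"] u by auto
    qed
    have "(u ^ CARD('n)) powr th \<le> P"
      unfolding P_def
      by (rule small_cube_powr_bound[OF u in_cube _ th]) (use xy r.C_nonneg q.C_nonneg in auto)
    then have "u powr (\<delta> y - \<delta> x) \<le> P" unfolding th_def pow[OF u(1)] .
    then have "u powr (\<delta> y - \<delta> x) * u powr \<delta> x \<le> P * u powr \<delta> x" by (intro mult_right_mono) auto
    then have "u powr \<delta> y \<le> P * u powr \<delta> x" by (simp flip: powr_add)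
    then show ?thesis using u by (simp add: \<phi>_def u_def)
  next
    case False
    then have "\<phi> y (4 * norm (x - y)) = (4 * norm (x - y)) powr \<delta>_inf" by (simp add: \<phi>_def)
    also have "\<dots> \<le> (4 * norm (x - y)) powr \<delta> x" using False \<delta>(4) by (intro powr_mono) auto
    also have "\<dots> \<le> P * (4 * norm (x - y)) powr \<delta> x" using P by (simp add: mult_le_cancel_right1)
    finally show ?thesis .
  qed
  have "\<bar>b' x - b' y\<bar> \<le> 6 * S * P * 4 powr n * norm (x - y) powr \<delta> x" for x y
  proof (cases "x = y")
    case False
    have own: "\<phi> x (4 * norm (x - y)) \<le> P * (4 * norm (x - y)) powr \<delta> x"
    proof -
      have "\<phi> x (4 * norm (x - y)) \<le> (4 * norm (x - y)) powr \<delta> x"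
        using \<delta>(4)[of x] by (simp add: \<phi>_def powr_mono)
      also have "\<dots> \<le> P * (4 * norm (x - y)) powr \<delta> x" using P by (simp add: mult_le_cancel_right1)
      finally show ?thesis .
    qed
    have "\<bar>b' x - b' y\<bar> \<le> 3 * S * (\<phi> x (4 * norm (x - y)) + \<phi> y (4 * norm (x - y)))"
      by (rule b'_diff[OF False])
    also have "\<dots> \<le> 3 * S * (P * (4 * norm (x - y)) powr \<delta> x + P * (4 * norm (x - y)) powr \<delta> x)"
      using S(1) own swap[OF False] by (intro mult_left_mono add_mono) auto
    also have "\<dots> = 6 * S * P * (4 powr \<delta> x * norm (x - y) powr \<delta> x)" by (simp add: powr_mult)
    also have "\<dots> \<le> 6 * S * P * (4 powr n * norm (x - y) powr \<delta> x)"
      using S(1) P \<delta>(3)[of x] by (intro mult_left_mono mult_right_mono powr_mono) (auto simp: n_def)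
    finally show ?thesis by (simp add: mult.assoc)
  qed simp
  moreover have "AE x in lborel. b' x = b x" using b'_AE ae by eventually_elim simp
  then have "AE x in lebesgue. b' x = b x" by (rule AE_completion)
  ultimately show ?thesis unfolding var_Lipschitz_def by blast
qed

end

theorem theorem3p2:
  fixes \<alpha> \<beta> :: real
    and \<delta> p q r b :: "real^'n::finite \<Rightarrow> real"
  assumes "0 \<le> \<alpha>" and "\<alpha> < real CARD('n)"
    and "\<forall>x. 0 < \<delta> x \<and> \<delta> x < real CARD('n)"
    and "log_exponent p" and "log_exponent q" and "log_exponent r"
    and "1 < \<beta>" and "ereal \<beta> < fun_inf p"
    and "0 < fun_inf \<delta>"
    and "fun_sup (\<lambda>x. r x * (\<alpha> + \<delta> x)) < ereal (real CARD('n))"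
    and "ereal (exponent_at_infinity r) * fun_sup (\<lambda>x. \<alpha> + \<delta> x) < ereal (real CARD('n))"
    and "AE x in lebesgue. p x \<ge> exponent_at_infinity p"
    and "\<forall>x. 1 / \<beta> - 1 / p x = \<delta> x / real CARD('n) \<and>
             \<delta> x / real CARD('n) = 1 / r x - \<alpha> / real CARD('n) - 1 / q x"
    and "locally_integrable b"
  shows "b \<in> var_Lipschitz \<delta> \<longleftrightarrow> bounded_var_Lp r q (frac_max_commutator \<alpha> b)"
proof -
  obtain Cp Rp mp where p: "log_holder p (exponent_at_infinity p) Cp Rp"
    using log_exponentE[OF assms(4)] by blast
  obtain Cq Rq mq where q: "log_holder q (exponent_at_infinity q) Cq Rq"
    using log_exponentE[OF assms(5)] by blast
  obtain Cr Rr m where r: "log_holder r (exponent_at_infinity r) Cr Rr" and m: "1 < m" "\<And>x. m \<le> r x"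
    using log_exponentE[OF assms(6)] by blast
  interpret p: log_holder p "exponent_at_infinity p" Cp Rp by (rule p)
  interpret q: log_holder q "exponent_at_infinity q" Cq Rq by (rule q)
  interpret r: log_holder r "exponent_at_infinity r" Cr Rr by (rule r)
  have sup_ge: "ereal (\<alpha> + \<delta> x) \<le> fun_sup (\<lambda>x. \<alpha> + \<delta> x)" for x
    unfolding fun_sup_def by (rule SUP_upper) simp
  have ri: "0 < exponent_at_infinity r" using r.inf_lower by simp
  \<comment> \<open>Multiplied by the positive exponent at infinity, an infinite supremum would
    violate the bound by n.\<close>
  have "fun_sup (\<lambda>x. \<alpha> + \<delta> x) \<noteq> \<infinity>" using assms(11) ri by auto
  moreover have "fun_sup (\<lambda>x. \<alpha> + \<delta> x) \<noteq> - \<infinity>" using sup_ge[of 0] by auto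
  ultimately obtain G where G: "fun_sup (\<lambda>x. \<alpha> + \<delta> x) = ereal G" by (cases "fun_sup (\<lambda>x. \<alpha> + \<delta> x)") auto
  interpret frac_exponents r "exponent_at_infinity r" Cr Rr q "exponent_at_infinity q" Cq Rq "\<lambda>x. \<alpha> + \<delta> x" m G
  proof
    fix x
    show "1 < m" "m \<le> r x" by (rule m)+
    have "\<delta> x / real CARD('n) + \<alpha> / real CARD('n) = 1 / r x - 1 / q x" using assms(13) by simp
    then show "\<alpha> + \<delta> x = real CARD('n) * (1 / r x - 1 / q x)" by (simp add: field_simps)
    show "0 \<le> \<alpha> + \<delta> x" using assms(1,3) by (simp add: less_imp_le)
    show "\<alpha> + \<delta> x \<le> G" using sup_ge[of x] G by simp
    show "exponent_at_infinity r * G < real CARD('n)" using assms(11) G by simp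
  qed
  obtain d0 where d0: "0 < ereal d0" "ereal d0 < fun_inf \<delta>" using ereal_dense2[OF assms(9)] by blast
  have d0_le: "d0 \<le> \<delta> x" for x
    using d0(2) INF_lower[of x UNIV "\<lambda>x. ereal (\<delta> x)"] unfolding fun_inf_def
    by (metis UNIV_I ereal_less_eq(3) less_imp_le order_trans)
  \<comment> \<open>By continuity the exceptional set is open, and a null open set is empty. The
    inequality is needed at every x, as the Lipschitz condition is pointwise.\<close>
  have p_ge: "exponent_at_infinity p \<le> p x" for x
  proof (rule ccontr)
    assume "\<not> exponent_at_infinity p \<le> p x"
    define A where "A = {x. p x < exponent_at_infinity p}"
    have "open A" unfolding A_def
      by (intro open_Collect_less p.continuous continuous_on_const)
    moreover have "x \<in> A" using \<open>\<not> exponent_at_infinity p \<le> p x\<close> by (simp add: A_def)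
    ultimately have "\<not> negligible A" using open_not_negligible by blast
    moreover have "A \<in> null_sets lebesgue"
    proof (rule AE_iff_null_sets[THEN iffD2])
      show "A \<in> sets lebesgue" using \<open>open A\<close> by simp
      show "AE x in lebesgue. x \<notin> A" using assms(12) by eventually_elim (simp add: A_def not_less)
    qed
    ultimately show False by (simp add: negligible_iff_null_sets)
  qed
  \<comment> \<open>In the limit the exponent identity reads \<delta>_inf = n (1/\<beta> - 1/p_inf),
    so \<delta>(x) - \<delta>_inf = n (1/p_inf - 1/p(x)), which has the sign of p(x) -
    p_inf.\<close>
  have "((\<lambda>x. 1 / \<beta> - 1 / p x) \<longlongrightarrow> 1 / \<beta> - 1 / exponent_at_infinity p) at_infinity"
    using p.inf_lower by (intro tendsto_intros p.tendsto_at_infinity) auto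
  moreover have "((\<lambda>x. 1 / r x - \<alpha> / n - 1 / q x) \<longlongrightarrow> 1 / exponent_at_infinity r - \<alpha> / n - 1 / exponent_at_infinity q) at_infinity"
    using r.inf_lower q.inf_lower by (intro tendsto_intros r.tendsto_at_infinity q.tendsto_at_infinity) auto
  moreover have "(\<lambda>x. 1 / \<beta> - 1 / p x) = (\<lambda>x. 1 / r x - \<alpha> / n - 1 / q x)"
    using assms(13) by (simp add: n_def)
  ultimately have lim_eq: "1 / \<beta> - 1 / exponent_at_infinity p = 1 / exponent_at_infinity r - \<alpha> / n - 1 / exponent_at_infinity q"
    using tendsto_unique[OF trivial_limit_at_infinity] by metis
  have \<delta>_inf: "n * (1 / exponent_at_infinity r - 1 / exponent_at_infinity q) - \<alpha> \<le> \<delta> x" for x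
  proof -
    have "n * (1 / exponent_at_infinity r - 1 / exponent_at_infinity q) - \<alpha>
        = n * (1 / exponent_at_infinity r - \<alpha> / n - 1 / exponent_at_infinity q)"
      using n_ge_1 by (simp add: algebra_simps)
    also have "\<dots> = n * (1 / \<beta> - 1 / exponent_at_infinity p)" by (simp add: lim_eq)
    also have "\<dots> \<le> n * (1 / \<beta> - 1 / p x)"
      using p_ge[of x] p.inf_lower n_ge_1 by (intro mult_left_mono diff_left_mono divide_left_mono) auto
    also have "\<dots> = n * (\<delta> x / n)" using assms(13) by (simp add: n_def)
    also have "\<dots> = \<delta> x" using n_ge_1 by simp
    finally show ?thesis .
  qed
  show ?thesis
  proof
    assume "b \<in> var_Lipschitz \<delta>"
    then show "bounded_var_Lp r q (frac_max_commutator \<alpha> b)"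
      using assms(3) by (intro frac_max_commutator_bounded) auto
  next
    assume "bounded_var_Lp r q (frac_max_commutator \<alpha> b)"
    then show "b \<in> var_Lipschitz \<delta>"
      using assms(3,14) d0 d0_le \<delta>_inf by (intro bounded_imp_var_Lipschitz[of \<alpha> \<delta> d0]) auto
  qed
qed

end
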